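(* Let $f:S^n\to S^m$ be an LOMSE whose nonzero singular value is $\lambda$, of multiplicity $p$, and let $\rho:U\to\mathbb R$ be smooth with $U\subset(0,+\infty)$ open. Then $$M_{f,\rho}:=\{(rx,\rho(r)f(x)):x\in S^n,\ r\in U\}$$ is minimal in $\mathbb R^{n+m+2}$ if and only if, on $U$, $$\frac{\rho_{rr}}{1+\rho_r^2}+\frac{(n-p)\rho_r}{r}+\frac{p\big(\frac{\rho_r}{r}-\frac{\lambda^2\rho}{r^2}\big)}{1+\frac{\lambda^2\rho^2}{r^2}}=0 .$$
   Context: $S^d\subset\mathbb R^{d+1}$ is the unit sphere with canonical metric $g_d$; subscripts $r$ denote derivatives with respect to $r$. Singular values of $(f_* )_x:(T_xS^n,g_n)\to(T_{f(x)}S^m,g_m)$ are counted with multiplicity. A smooth map $f:S^n\to S^m$ is a Lawson-Osserman map (LOM) if there is $\theta\in(0,\pi/2)$ such that $\{(\cos\theta\cdot x,\sin\theta\cdot f(x)):x\in S^n\}$ is a minimal submanifold of $S^{n+m+1}$. An LOMSE is an LOM that is not totally geodesic (as a map $(S^n,g_n)\to(S^m,g_m)$) and such that, for each $x$, all nonzero singular values of $(f_* )_x$ are equal. For an LOMSE the nonzero singular value $\lambda$ and its multiplicity $p$ are constant on $S^n$; moreover there is an integer $k\ge2$ with $\lambda=\sqrt{k(k+n-1)/p}$. *)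

theory Defs
  imports "HOL-Analysis.Analysis"
begin

section \<open>Smooth maps, submanifolds and tangent spaces in Euclidean spaces\<close>

fun Ck_on :: "nat \<Rightarrow> 'a::real_normed_vector set \<Rightarrow> ('a \<Rightarrow> 'b::real_normed_vector) \<Rightarrow> bool" where
  "Ck_on 0 S f \<longleftrightarrow> continuous_on S f"
| "Ck_on (Suc k) S f \<longleftrightarrow>
     f differentiable_on S \<and> (\<forall>v. Ck_on k S (\<lambda>x. frechet_derivative f (at x) v))"

text \<open>Used for open sets only.\<close>

definition smooth_on :: "'a::real_normed_vector set \<Rightarrow> ('a \<Rightarrow> 'b::real_normed_vector) \<Rightarrow> bool" where
  "smooth_on S f \<longleftrightarrow> (\<forall>k. Ck_on k S f)"

text \<open>Smoothness of a map on an embedded submanifold: it locally extends to a smooth map of the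
  ambient space.\<close>

definition smooth_map_on :: "'a::real_normed_vector set \<Rightarrow> ('a \<Rightarrow> 'b::real_normed_vector) \<Rightarrow> bool" where
  "smooth_map_on M f \<longleftrightarrow>
     (\<forall>x\<in>M. \<exists>W F. open W \<and> x \<in> W \<and> smooth_on W F \<and> (\<forall>y\<in>M \<inter> W. f y = F y))"

text \<open>Embedded submanifolds are described by slice charts: a diffeomorphism of open sets of the
  ambient space that straightens \<open>M\<close> to a piece of a \<open>d\<close>-dimensional linear subspace.\<close>

definition embedded_submanifold :: "nat \<Rightarrow> 'a::euclidean_space set \<Rightarrow> bool" where
  "embedded_submanifold d M \<longleftrightarrow>
     (\<forall>p\<in>M. \<exists>W W' \<Phi> \<Psi> (S::'a set).
        open W \<and> p \<in> W \<and> open W' \<and> homeomorphism W W' \<Phi> \<Psi> \<and> smooth_on W \<Phi> \<and> smooth_on W' \<Psi> \<and>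
        subspace S \<and> dim S = d \<and> \<Phi> ` (M \<inter> W) = S \<inter> W')"

definition tangent_space :: "'a::euclidean_space set \<Rightarrow> 'a \<Rightarrow> 'a set" where
  "tangent_space M x =
     {v. \<exists>\<epsilon>>0. \<exists>\<gamma>::real \<Rightarrow> 'a. smooth_on {-\<epsilon><..<\<epsilon>} \<gamma> \<and> \<gamma> ` {-\<epsilon><..<\<epsilon>} \<subseteq> M \<and> \<gamma> 0 = x \<and>
           (\<gamma> has_vector_derivative v) (at 0)}"

text \<open>The derivative within \<open>M\<close> is determined on tangent vectors of \<open>M\<close> only, where it is the
  differential \<open>(f\<^sub>*)\<^sub>x\<close>; it is never applied to other vectors below.\<close>

definition differential :: "'a::euclidean_space set \<Rightarrow> ('a \<Rightarrow> 'b::euclidean_space) \<Rightarrow> 'a \<Rightarrow> 'a \<Rightarrow> 'b" where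
  "differential M f x = frechet_derivative f (at x within M)"

definition orth_proj :: "'a::euclidean_space set \<Rightarrow> 'a \<Rightarrow> 'a" where
  "orth_proj S v = (THE w. w \<in> S \<and> (\<forall>s\<in>S. orthogonal (v - w) s))"

definition tangent_field_near :: "'a::euclidean_space set \<Rightarrow> 'a \<Rightarrow> ('a \<Rightarrow> 'a) \<Rightarrow> bool" where
  "tangent_field_near M p V \<longleftrightarrow>
     (\<exists>W. open W \<and> p \<in> W \<and> smooth_map_on (M \<inter> W) V \<and> (\<forall>q\<in>M \<inter> W. V q \<in> tangent_space M q))"


section \<open>Second fundamental form and minimality\<close>

text \<open>Submanifolds carry the metric induced from the ambient Euclidean space, so covariant
  differentiation on \<open>N\<close> (of vector fields tangent to \<open>N\<close> along the submanifold \<open>M \<subseteq> N\<close>)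
  is the tangential part of the Euclidean derivative.\<close>

definition covariant_derivative ::
    "'a::euclidean_space set \<Rightarrow> 'a set \<Rightarrow> ('a \<Rightarrow> 'a) \<Rightarrow> 'a \<Rightarrow> 'a \<Rightarrow> 'a" where
  "covariant_derivative N M V p u = orth_proj (tangent_space N p) (differential M V p u)"

text \<open>The value does not depend on the extension \<open>V\<close> of the tangent vector \<open>v\<close>.\<close>

definition second_fundamental_form ::
    "'a::euclidean_space set \<Rightarrow> 'a set \<Rightarrow> 'a \<Rightarrow> 'a \<Rightarrow> 'a \<Rightarrow> 'a" where
  "second_fundamental_form N M p u v =
     (let V = (SOME V. tangent_field_near M p V \<and> V p = v)
      in covariant_derivative N M V p u - covariant_derivative M M V p u)"

definition orthonormal_basis :: "'a::euclidean_space set \<Rightarrow> 'a set \<Rightarrow> bool" where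
  "orthonormal_basis T B \<longleftrightarrow> pairwise orthogonal B \<and> (\<forall>b\<in>B. norm b = 1) \<and> span B = T"

text \<open>The (unnormalised) mean curvature vector: the trace of the second fundamental form.\<close>

definition mean_curvature :: "'a::euclidean_space set \<Rightarrow> 'a set \<Rightarrow> 'a \<Rightarrow> 'a" where
  "mean_curvature N M p =
     (let B = (SOME B. orthonormal_basis (tangent_space M p) B)
      in \<Sum>e\<in>B. second_fundamental_form N M p e e)"

definition minimal_submanifold :: "'a::euclidean_space set \<Rightarrow> 'a set \<Rightarrow> bool" where
  "minimal_submanifold N M \<longleftrightarrow>
     M \<subseteq> N \<and> (\<exists>d. embedded_submanifold d M) \<and> (\<forall>p\<in>M. mean_curvature N M p = 0)"

text \<open>Vanishing of the second fundamental form
  \<open>(\<nabla>df)(u, Y) = \<nabla>\<^sub>u (f\<^sub>* Y) - f\<^sub>* (\<nabla>\<^sub>u Y)\<close> of the map \<open>f : M \<rightarrow> N\<close>.\<close>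

definition totally_geodesic_map ::
    "'a::euclidean_space set \<Rightarrow> 'b::euclidean_space set \<Rightarrow> ('a \<Rightarrow> 'b) \<Rightarrow> bool" where
  "totally_geodesic_map M N f \<longleftrightarrow>
     (\<forall>x\<in>M. \<forall>u\<in>tangent_space M x. \<forall>Y. tangent_field_near M x Y \<longrightarrow>
        orth_proj (tangent_space N (f x)) (differential M (\<lambda>q. differential M f q (Y q)) x u)
        = differential M f x (covariant_derivative M M Y x u))"


section \<open>Singular values\<close>

text \<open>For a linear map \<open>A\<close> defined on the subspace \<open>T\<close>, with \<open>A\<^sup>*\<close> the adjoint of
  \<open>A\<close> on \<open>T\<close>, this is the kernel of \<open>A\<^sup>* A - \<sigma>\<^sup>2\<close>.\<close>

definition singular_space ::
    "'a::euclidean_space set \<Rightarrow> ('a \<Rightarrow> 'b::euclidean_space) \<Rightarrow> real \<Rightarrow> 'a set" where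
  "singular_space T A \<sigma> = {u\<in>T. \<forall>w\<in>T. A u \<bullet> A w = \<sigma>\<^sup>2 * (u \<bullet> w)}"

definition singular_multiplicity ::
    "'a::euclidean_space set \<Rightarrow> ('a \<Rightarrow> 'b::euclidean_space) \<Rightarrow> real \<Rightarrow> nat" where
  "singular_multiplicity T A \<sigma> = dim (singular_space T A \<sigma>)"

definition singular_values ::
    "'a::euclidean_space set \<Rightarrow> ('a \<Rightarrow> 'b::euclidean_space) \<Rightarrow> real set" where
  "singular_values T A = {\<sigma>. \<sigma> \<ge> 0 \<and> singular_multiplicity T A \<sigma> > 0}"


section \<open>Lawson-Osserman maps\<close>

text \<open>The spheres \<open>S\<^sup>n\<close> and \<open>S\<^sup>m\<close> are the unit spheres of Euclidean spaces of
  dimensions \<open>n + 1\<close> and \<open>m + 1\<close>; the product type, whose norm is the Euclidean one, serves as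
  the Euclidean space of dimension \<open>n + m + 2\<close>.\<close>

definition smooth_sphere_map :: "('a::euclidean_space \<Rightarrow> 'b::euclidean_space) \<Rightarrow> bool" where
  "smooth_sphere_map f \<longleftrightarrow> f ` sphere 0 1 \<subseteq> sphere 0 1 \<and> smooth_map_on (sphere 0 1) f"

definition LOM :: "('a::euclidean_space \<Rightarrow> 'b::euclidean_space) \<Rightarrow> bool" where
  "LOM f \<longleftrightarrow> smooth_sphere_map f \<and>
     (\<exists>\<theta>\<in>{0<..<pi/2}. minimal_submanifold (sphere 0 1)
        {(cos \<theta> *\<^sub>R x, sin \<theta> *\<^sub>R f x) | x. x \<in> sphere 0 1})"

definition nonzero_singular_values_at ::
    "('a::euclidean_space \<Rightarrow> 'b::euclidean_space) \<Rightarrow> 'a \<Rightarrow> real set" where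
  "nonzero_singular_values_at f x =
     singular_values (tangent_space (sphere 0 1) x) (differential (sphere 0 1) f x) - {0}"

definition singular_multiplicity_at ::
    "('a::euclidean_space \<Rightarrow> 'b::euclidean_space) \<Rightarrow> 'a \<Rightarrow> real \<Rightarrow> nat" where
  "singular_multiplicity_at f x \<sigma> =
     singular_multiplicity (tangent_space (sphere 0 1) x) (differential (sphere 0 1) f x) \<sigma>"

definition LOMSE :: "('a::euclidean_space \<Rightarrow> 'b::euclidean_space) \<Rightarrow> bool" where
  "LOMSE f \<longleftrightarrow> LOM f \<and> \<not> totally_geodesic_map (sphere 0 1) (sphere 0 1) f \<and>
     (\<forall>x\<in>sphere 0 1. \<forall>\<sigma>\<in>nonzero_singular_values_at f x. \<forall>\<tau>\<in>nonzero_singular_values_at f x. \<sigma> = \<tau>)"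

definition LO_graph :: "('a::euclidean_space \<Rightarrow> 'b::euclidean_space) \<Rightarrow> (real \<Rightarrow> real) \<Rightarrow> real set
    \<Rightarrow> ('a \<times> 'b) set" where
  "LO_graph f \<rho> U = {(r *\<^sub>R x, \<rho> r *\<^sub>R f x) | x r. x \<in> sphere 0 1 \<and> r \<in> U}"

end

(*
Let F be the extension of f to R^(n+1) - {0} that is constant on rays, d its differential and
d2 its second derivative.  At each point of S^n the tangent space splits orthogonally
into V = ker d and a p-dimensional H on which d is lam times an isometry.  Put
A = sum of d2(v,v) over an orthonormal basis of V, and B likewise for H.

Both submanifolds are graphs, M_{f,rho} over the open cone {|y| in U} and the given minimal submanifold
of the sphere over a sphere of radius cos theta.  For a graph of G, every normal vector extends to
an explicit normal field, and the mean curvature is a trace of the second derivative of G weighted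
by the inverse of the induced metric.  For the minimal submanifold of the sphere this yields
alpha F + A + kappa B = 0 with scalars alpha and kappa <> 0.

Differentiating d d* d = lam^2 d shows that A lies in the image of d, while B is orthogonal to
that image by the symmetry of d2 (as for Riemannian submersions).  Hence A and B are orthogonal;
A is also orthogonal to F, so A = 0 and B = - p lam^2 F.  With these values the
weighted trace for M = M_{f,rho} at a point with |y| = r is the left side of the differential equation at r
times F.
*)
theory Submission
  imports Defs
begin

section \<open>Calculus of smooth maps\<close>

text \<open>Minimality of the sphere submanifold yields a single vector equation in which A and B
  carry fixed weights, whereas the weight of B for M_{f,rho} varies with rho(r)/r. The two traces
  must therefore be known separately, and their orthogonality is what separates them: pairing the
  equation with A leaves only |A|^2. The identity d d* d = lam^2 d (with a factor |y|^2 off the unit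
  sphere) is polynomial in d and holds for all fixed vectors. It can therefore be differentiated
  although no smooth frame of V or H is at hand. The weights come from normalising the lifts (b, L
  b) of a basis that diagonalises the metric: each has squared length 1 + \<mu> b. Equal singular
  values make \<mu> constant on H and zero on V, so that only the sums A and B survive. The second
  fundamental form and the mean curvature are defined through arbitrary choices of a tangent field
  and a basis. Pairing with an explicit normal field and differentiating the orthogonality relation
  removes both choices.\<close>

lemma open_differentiable_onD:
  assumes "f differentiable_on S" "open S" "x \<in> S"
  shows "(f has_derivative frechet_derivative f (at x)) (at x)"
  using assms at_within_open differentiable_on_def frechet_derivative_works by metis

lemma open_differentiable_onI:
  assumes "open S" "\<And>x. x \<in> S \<Longrightarrow> (f has_derivative f' x) (at x)"
  shows "f differentiable_on S"
  using assms at_within_open[of _ S] unfolding differentiable_on_def differentiable_def by metis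

text \<open>\<open>frechet_derivative\<close> is a choice among all derivatives; the two maps have
  the same derivatives, so the same choice is made.\<close>

lemma frechet_derivative_cong_open:
  assumes "open S" "x \<in> S" "\<And>y. y \<in> S \<Longrightarrow> f y = g y"
  shows "frechet_derivative f (at x) = frechet_derivative g (at x)"
proof -
  have "(f has_derivative D) (at x) = (g has_derivative D) (at x)" for D
    using has_derivative_transform_within_open[of f D x UNIV S g] has_derivative_transform_within_open[of g D x UNIV S f]
      assms by auto
  then show ?thesis unfolding frechet_derivative_def by simp
qed

lemma Ck_on_cong:
  assumes "open S" "\<And>y. y \<in> S \<Longrightarrow> f y = g y" "Ck_on k S f"
  shows "Ck_on k S g"
  using assms(2,3)
proof (induction k arbitrary: f g)
  case 0 then show ?case using continuous_on_cong[of S S f g] by simp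
next
  case (Suc k)
  have "frechet_derivative f (at x) = frechet_derivative g (at x)" if "x \<in> S" for x
    using frechet_derivative_cong_open[of S x f g] assms(1) that Suc.prems(1) by auto
  moreover have "g differentiable_on S"
    using Suc.prems differentiable_transform_within[OF _ zero_less_one, of f _ S g]
    by (auto simp: differentiable_on_def)
  ultimately show ?case using Suc.IH[of "\<lambda>x. frechet_derivative f (at x) v" "\<lambda>x. frechet_derivative g (at x) v" for v] Suc.prems
    by auto
qed

lemma Ck_on_subset: "Ck_on k S f \<Longrightarrow> T \<subseteq> S \<Longrightarrow> Ck_on k T f"
  by (induction k arbitrary: f) (auto intro: continuous_on_subset differentiable_on_subset)

lemma Ck_on_local:
  assumes "\<And>x. x \<in> S \<Longrightarrow> \<exists>W. open W \<and> x \<in> W \<and> Ck_on k W f"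
  shows "Ck_on k S f"
  using assms
proof (induction k arbitrary: f)
  case 0
  have "isCont f x" if "x \<in> S" for x
  proof -
    from 0[OF that] obtain W where "open W" "x \<in> W" "continuous_on W f" by auto
    then show ?thesis by (simp add: continuous_on_eq_continuous_at)
  qed
  then show ?case by (simp add: continuous_at_imp_continuous_on)
next
  case (Suc k)
  have "f differentiable (at x)" if "x \<in> S" for x
  proof -
    from Suc.prems[OF that] obtain W where "open W" "x \<in> W" "f differentiable_on W" by auto
    then show ?thesis by (simp add: differentiable_on_eq_differentiable_at)
  qed
  then have "f differentiable_on S" by (simp add: differentiable_at_imp_differentiable_on)
  moreover have "Ck_on k S (\<lambda>x. frechet_derivative f (at x) v)" for v
  proof (rule Suc.IH)
    fix x assume "x \<in> S"
    with Suc.prems obtain W where "open W" "x \<in> W" "Ck_on (Suc k) W f" by blast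
    then show "\<exists>W. open W \<and> x \<in> W \<and> Ck_on k W (\<lambda>x. frechet_derivative f (at x) v)" by auto
  qed
  ultimately show ?case by simp
qed

text \<open>Lets a derivative found by calculus rules stand in for the chosen
  \<open>frechet_derivative\<close>.\<close>

lemma Ck_on_SucI:
  assumes "open S" "\<And>x. x \<in> S \<Longrightarrow> (f has_derivative f' x) (at x)" "\<And>v. Ck_on k S (\<lambda>x. f' x v)"
  shows "Ck_on (Suc k) S f"
proof -
  have "f' x = frechet_derivative f (at x)" if "x \<in> S" for x
    using assms(2) frechet_derivative_at that by blast
  then have "Ck_on k S (\<lambda>x. frechet_derivative f (at x) v)" for v
    using Ck_on_cong[OF assms(1) _ assms(3)] by auto
  then show ?thesis using open_differentiable_onI[OF assms(1,2)] by auto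
qed

lemma Ck_on_Suc_imp: "Ck_on (Suc k) S f \<Longrightarrow> Ck_on k S f"
  by (induction k arbitrary: f) (auto intro: differentiable_imp_continuous_on)

lemma Ck_on_const: "Ck_on k S (\<lambda>x. c)"
  by (induction k arbitrary: c) auto

lemma Ck_on_bounded_linear:
  assumes "bounded_linear L" "open S"
  shows "Ck_on k S L"
proof (cases k)
  case 0 then show ?thesis using assms linear_continuous_on by auto
next
  case (Suc j)
  then show ?thesis
    using Ck_on_SucI[OF assms(2) bounded_linear_imp_has_derivative[OF assms(1)] Ck_on_const] by simp
qed

lemma Ck_on_add:
  assumes "open S" "Ck_on k S f" "Ck_on k S g"
  shows "Ck_on k S (\<lambda>x. f x + g x)"
  using assms(2,3)
proof (induction k arbitrary: f g)
  case 0 then show ?case by (auto intro: continuous_intros)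
next
  case (Suc k)
  have f: "f differentiable_on S" "\<And>v. Ck_on k S (\<lambda>x. frechet_derivative f (at x) v)"
    using Suc.prems(1) by simp_all
  have g: "g differentiable_on S" "\<And>v. Ck_on k S (\<lambda>x. frechet_derivative g (at x) v)"
    using Suc.prems(2) by simp_all
  show ?case
    by (rule Ck_on_SucI[OF assms(1) has_derivative_add[OF
          open_differentiable_onD[OF f(1) assms(1)] open_differentiable_onD[OF g(1) assms(1)]]])
       (assumption | intro Suc.IH f g)+
qed

lemma Ck_on_sum:
  assumes "open S" "\<And>i. i \<in> I \<Longrightarrow> Ck_on k S (f i)"
  shows "Ck_on k S (\<lambda>x. \<Sum>i\<in>I. f i x)"
  using assms(2) by (induction I rule: infinite_finite_induct) (auto intro: Ck_on_const Ck_on_add assms(1))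

lemma Ck_on_bilinear:
  assumes "bounded_bilinear P" "open S" "Ck_on k S f" "Ck_on k S g"
  shows "Ck_on k S (\<lambda>x. P (f x) (g x))"
  using assms(3,4)
proof (induction k arbitrary: f g)
  case 0 then show ?case by (auto intro: bounded_bilinear.continuous_on[OF assms(1)])
next
  case (Suc k)
  have f: "f differentiable_on S" "Ck_on k S f" "\<And>v. Ck_on k S (\<lambda>x. frechet_derivative f (at x) v)"
    using Suc.prems(1) Ck_on_Suc_imp[OF Suc.prems(1)] by simp_all
  have g: "g differentiable_on S" "Ck_on k S g" "\<And>v. Ck_on k S (\<lambda>x. frechet_derivative g (at x) v)"
    using Suc.prems(2) Ck_on_Suc_imp[OF Suc.prems(2)] by simp_all
  show ?case
    by (rule Ck_on_SucI[OF assms(2) bounded_bilinear.FDERIV[OF assms(1)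
          open_differentiable_onD[OF f(1) assms(2)] open_differentiable_onD[OF g(1) assms(2)]]])
       (assumption | intro Ck_on_add[OF assms(2)] Suc.IH f g)+
qed

text \<open>In the chain rule the direction in which \<open>g\<close> is differentiated moves with
  the point, while \<open>Ck_on\<close> speaks of fixed directions only. Expanding that direction in
  \<open>Basis\<close> gives a finite sum of products to which the induction hypothesis applies;
  this is why the middle space is Euclidean.\<close>

lemma Ck_on_compose:
  fixes f :: "'a::real_normed_vector \<Rightarrow> 'b::euclidean_space" and g :: "'b \<Rightarrow> 'c::real_normed_vector"
  assumes "open S" "open T" "f ` S \<subseteq> T" "Ck_on k S f" "Ck_on k T g"
  shows "Ck_on k S (\<lambda>x. g (f x))"
  using assms(4,5)
proof (induction k arbitrary: g)
  case 0 then show ?case using continuous_on_compose2[of T g S f] assms(3) by auto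
next
  case (Suc k)
  show ?case
  proof (rule Ck_on_SucI[OF assms(1), where f'="\<lambda>x v. \<Sum>b\<in>Basis. (frechet_derivative f (at x) v \<bullet> b) *\<^sub>R frechet_derivative g (at (f x)) b"])
    fix x assume x: "x \<in> S"
    then have fx: "f x \<in> T" using assms(3) by auto
    have g': "(g has_derivative frechet_derivative g (at (f x))) (at (f x))"
      using open_differentiable_onD[OF _ assms(2) fx] Suc.prems by auto
    then have lin: "linear (frechet_derivative g (at (f x)))" using has_derivative_linear by blast
    have "(\<Sum>b\<in>Basis. (w \<bullet> b) *\<^sub>R frechet_derivative g (at (f x)) b) = frechet_derivative g (at (f x)) w" for w
    proof -
      have "frechet_derivative g (at (f x)) w = frechet_derivative g (at (f x)) (\<Sum>b\<in>Basis. (w \<bullet> b) *\<^sub>R b)"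
        by (simp add: euclidean_representation)
      then show ?thesis by (simp only: linear_sum[OF lin] linear_cmul[OF lin])
    qed
    moreover have "(f has_derivative frechet_derivative f (at x)) (at x)"
      using open_differentiable_onD[OF _ assms(1) x] Suc.prems by auto
    ultimately show "((\<lambda>x. g (f x)) has_derivative (\<lambda>v. \<Sum>b\<in>Basis. (frechet_derivative f (at x) v \<bullet> b) *\<^sub>R frechet_derivative g (at (f x)) b)) (at x)"
      using has_derivative_compose g' by fastforce
  next
    fix v
    show "Ck_on k S (\<lambda>x. \<Sum>b\<in>Basis. (frechet_derivative f (at x) v \<bullet> b) *\<^sub>R frechet_derivative g (at (f x)) b)"
    proof (intro Ck_on_sum[OF assms(1)] Ck_on_bilinear[OF bounded_bilinear_scaleR assms(1)])
      show "Ck_on k S (\<lambda>x. frechet_derivative f (at x) v \<bullet> b)" for b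
        using Suc.prems by (intro Ck_on_bilinear[OF bounded_bilinear_inner assms(1)] Ck_on_const) auto
      show "Ck_on k S (\<lambda>x. frechet_derivative g (at (f x)) b)" for b
        using Suc.IH[of "\<lambda>y. frechet_derivative g (at y) b"] Suc.prems Ck_on_Suc_imp by auto
    qed
  qed
qed

text \<open>The derivative is a product of constants and the function itself, so the induction
  hypothesis covers it.\<close>

lemma Ck_on_inverse: "Ck_on k (-{0}) (inverse :: real \<Rightarrow> real)"
proof (induction k)
  case 0 then show ?case by (auto intro!: continuous_intros)
next
  case (Suc k)
  show ?case
  proof (rule Ck_on_SucI[where f'="\<lambda>x h. - (inverse x * h * inverse x)"])
    show "Ck_on k (-{0}) (\<lambda>x. - (inverse x * v * inverse x))" for v :: real
    proof -
      have "Ck_on k (-{0}) (\<lambda>x. inverse x * (- v) * inverse x)"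
        using Suc by (intro Ck_on_bilinear[OF bounded_bilinear_mult] Ck_on_const) auto
      then show ?thesis by simp
    qed
  qed (simp_all add: has_derivative_inverse' open_Compl)
qed

text \<open>The derivative is a multiple of \<open>inverse\<close> composed with
  \<open>sqrt\<close>, so the hypothesis for \<open>sqrt\<close> combines with
  \<open>Ck_on_inverse\<close>.\<close>

lemma Ck_on_sqrt: "Ck_on k {0<..} sqrt"
proof (induction k)
  case 0 then show ?case by (auto intro!: continuous_intros)
next
  case (Suc k)
  show ?case
  proof (rule Ck_on_SucI[where f'="\<lambda>x h. inverse (sqrt x) * (h / 2)"])
    show "(sqrt has_derivative (\<lambda>h. inverse (sqrt x) * (h / 2))) (at x)" if "x \<in> {0<..}" for x
    proof -
      have "(sqrt has_field_derivative (inverse (sqrt x) / 2)) (at x)" using that DERIV_real_sqrt by auto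
      moreover have "(*) (inverse (sqrt x) / 2) = (\<lambda>h. inverse (sqrt x) * (h / 2))" by auto
      ultimately show ?thesis by (simp only: has_field_derivative_def)
    qed
    show "Ck_on k {0<..} (\<lambda>x. inverse (sqrt x) * (v / 2))" for v
    proof (intro Ck_on_bilinear[OF bounded_bilinear_mult] Ck_on_const)
      show "Ck_on k {0<..} (\<lambda>x. inverse (sqrt x))"
        by (rule Ck_on_compose[where T="-{0}", OF _ _ _ Suc Ck_on_inverse]) auto
    qed auto
  qed auto
qed

section \<open>Closure properties of smooth maps\<close>

lemma smooth_onI: "(\<And>k. Ck_on k S f) \<Longrightarrow> smooth_on S f" by (simp add: smooth_on_def)

lemma smooth_onD: "smooth_on S f \<Longrightarrow> Ck_on k S f" by (simp add: smooth_on_def)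

lemma smooth_on_cong:
  assumes "open S" "\<And>y. y \<in> S \<Longrightarrow> f y = g y" "smooth_on S f"
  shows "smooth_on S g"
  using Ck_on_cong[OF assms(1,2) smooth_onD[OF assms(3)]] by (simp add: smooth_on_def)

lemma smooth_on_subset: "smooth_on S f \<Longrightarrow> T \<subseteq> S \<Longrightarrow> smooth_on T f"
  unfolding smooth_on_def using Ck_on_subset by blast

lemma smooth_on_local:
  "(\<And>x. x \<in> S \<Longrightarrow> \<exists>W. open W \<and> x \<in> W \<and> smooth_on W f) \<Longrightarrow> smooth_on S f"
  unfolding smooth_on_def by (intro allI Ck_on_local) blast

lemma smooth_on_const: "smooth_on S (\<lambda>x. c)"
  by (simp add: smooth_on_def Ck_on_const)

lemma smooth_on_bounded_linear: "bounded_linear L \<Longrightarrow> open S \<Longrightarrow> smooth_on S L"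
  by (simp add: smooth_on_def Ck_on_bounded_linear)

lemma smooth_on_add: "open S \<Longrightarrow> smooth_on S f \<Longrightarrow> smooth_on S g \<Longrightarrow> smooth_on S (\<lambda>x. f x + g x)"
  by (simp add: smooth_on_def Ck_on_add)

lemma smooth_on_bilinear:
  "bounded_bilinear P \<Longrightarrow> open S \<Longrightarrow> smooth_on S f \<Longrightarrow> smooth_on S g \<Longrightarrow> smooth_on S (\<lambda>x. P (f x) (g x))"
  by (simp add: smooth_on_def Ck_on_bilinear)

lemmas smooth_on_scaleR = smooth_on_bilinear[OF bounded_bilinear_scaleR]
lemmas smooth_on_inner = smooth_on_bilinear[OF bounded_bilinear_inner]

lemma smooth_on_compose:
  fixes f :: "'a::real_normed_vector \<Rightarrow> 'b::euclidean_space" and g :: "'b \<Rightarrow> 'c::real_normed_vector"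
  assumes "open S" "open T" "f ` S \<subseteq> T" "smooth_on S f" "smooth_on T g"
  shows "smooth_on S (\<lambda>x. g (f x))"
proof -
  show ?thesis
    by (rule smooth_onI) (rule Ck_on_compose[OF assms(1,2,3) smooth_onD[OF assms(4)] smooth_onD[OF assms(5)]])
qed

lemma smooth_on_linear_compose:
  fixes f :: "'a::real_normed_vector \<Rightarrow> 'b::euclidean_space"
  assumes "bounded_linear L" "open S" "smooth_on S f"
  shows "smooth_on S (\<lambda>x. L (f x))"
  by (rule smooth_on_compose[OF assms(2) open_UNIV subset_UNIV assms(3) smooth_on_bounded_linear[OF assms(1) open_UNIV]])

lemma smooth_on_diff:
  fixes f g :: "'a::real_normed_vector \<Rightarrow> 'b::euclidean_space"
  assumes "open S" "smooth_on S f" "smooth_on S g"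
  shows "smooth_on S (\<lambda>x. f x - g x)"
  using smooth_on_add[OF assms(1,2) smooth_on_linear_compose[OF bounded_linear_minus[OF bounded_linear_ident] assms(1,3)]]
  by simp

lemma smooth_on_Pair:
  fixes f :: "'a::real_normed_vector \<Rightarrow> 'b::euclidean_space" and g :: "'a \<Rightarrow> 'c::euclidean_space"
  assumes "open S" "smooth_on S f" "smooth_on S g"
  shows "smooth_on S (\<lambda>x. (f x, g x))"
proof -
  have l: "bounded_linear (\<lambda>y::'b. (y, 0::'c))" and r: "bounded_linear (\<lambda>y::'c. (0::'b, y))"
    by (intro bounded_linear_Pair bounded_linear_ident bounded_linear_zero)+
  have "smooth_on S (\<lambda>x. (f x, 0) + (0, g x))"
    by (rule smooth_on_add[OF assms(1) smooth_on_linear_compose[OF l assms(1,2)] smooth_on_linear_compose[OF r assms(1,3)]])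
  then show ?thesis by simp
qed

lemma smooth_on_derivative:
  assumes "smooth_on S f"
  shows "smooth_on S (\<lambda>x. frechet_derivative f (at x) v)"
proof (rule smooth_onI)
  show "Ck_on k S (\<lambda>x. frechet_derivative f (at x) v)" for k
    using smooth_onD[OF assms, of "Suc k"] by simp
qed

lemma smooth_on_has_derivative:
  assumes "smooth_on S f" "open S" "x \<in> S"
  shows "(f has_derivative frechet_derivative f (at x)) (at x)"
proof (rule open_differentiable_onD[OF _ assms(2,3)])
  show "f differentiable_on S" using smooth_onD[OF assms(1), of "Suc 0"] by simp
qed

lemma smooth_on_continuous: "smooth_on S f \<Longrightarrow> continuous_on S f"
  using smooth_onD[of S f 0] by simp

lemma smooth_on_norm:
  fixes S :: "'a::euclidean_space set"
  assumes "open S" "0 \<notin> S"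
  shows "smooth_on S norm"
proof -
  have id: "smooth_on S (\<lambda>x. x)" by (rule smooth_on_bounded_linear[OF bounded_linear_ident assms(1)])
  have inner: "smooth_on S (\<lambda>x. x \<bullet> x)" by (rule smooth_on_inner[OF assms(1) id id])
  have sub: "(\<lambda>x. x \<bullet> x) ` S \<subseteq> {0<..}" using assms(2) by auto
  have sqrt: "smooth_on {0<..} sqrt" by (rule smooth_onI) (rule Ck_on_sqrt)
  have "smooth_on S (\<lambda>x. sqrt (x \<bullet> x))"
    by (rule smooth_on_compose[OF assms(1) open_greaterThan sub inner sqrt])
  then show ?thesis by (simp only: norm_eq_sqrt_inner[symmetric])
qed

lemma smooth_on_inverse:
  fixes f :: "'a::real_normed_vector \<Rightarrow> real"
  assumes "open S" "smooth_on S f" "\<And>x. x \<in> S \<Longrightarrow> f x \<noteq> 0"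
  shows "smooth_on S (\<lambda>x. inverse (f x))"
proof -
  have inv: "smooth_on (-{0}) (inverse :: real \<Rightarrow> real)"
    by (rule smooth_onI) (rule Ck_on_inverse)
  have sub: "f ` S \<subseteq> - {0}" using assms(3) by auto
  have op: "open (-{0::real})" by (rule open_Compl) (rule closed_singleton)
  show ?thesis by (rule smooth_on_compose[OF assms(1) op sub assms(2) inv])
qed

lemma smooth_on_normalize:
  fixes S :: "'a::euclidean_space set"
  assumes "open S" "0 \<notin> S"
  shows "smooth_on S (\<lambda>x. x /\<^sub>R norm x)"
proof (rule smooth_on_scaleR[OF assms(1)])
  show "smooth_on S (\<lambda>x. inverse (norm x))"
    by (rule smooth_on_inverse[OF assms(1) smooth_on_norm[OF assms]]) (use assms in auto)
  show "smooth_on S (\<lambda>x. x)" by (rule smooth_on_bounded_linear[OF bounded_linear_ident assms(1)])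
qed

section \<open>Tangent spaces and Weingarten's equation\<close>

lemma tangent_spaceI:
  assumes "open A" "0 \<in> A" "smooth_on A \<gamma>" "\<gamma> ` A \<subseteq> M" "\<gamma> 0 = x" "(\<gamma> has_vector_derivative v) (at 0)"
  shows "v \<in> tangent_space M x"
proof -
  obtain \<epsilon> where e: "\<epsilon> > 0" "ball 0 \<epsilon> \<subseteq> A" using assms(1,2) open_contains_ball by metis
  have eq: "{-\<epsilon><..<\<epsilon>} = ball 0 \<epsilon>" by (auto simp: dist_real_def)
  have "smooth_on {-\<epsilon><..<\<epsilon>} \<gamma>" using smooth_on_subset[OF assms(3) e(2)] by (simp only: eq)
  moreover have "\<gamma> ` {-\<epsilon><..<\<epsilon>} \<subseteq> M" using e(2) assms(4) eq by blast
  ultimately show ?thesis unfolding tangent_space_def using e(1) assms(5,6) by blast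
qed

lemma tangent_spaceE:
  assumes "v \<in> tangent_space M x"
  obtains \<epsilon> and \<gamma> :: "real \<Rightarrow> 'a::euclidean_space" where "\<epsilon> > 0" "\<gamma> ` {-\<epsilon><..<\<epsilon>} \<subseteq> M" "\<gamma> 0 = x"
    "(\<gamma> has_vector_derivative v) (at 0)"
  using assms unfolding tangent_space_def by blast

text \<open>A derivative within \<open>M\<close> is enough, since the curve does not leave
  \<open>M\<close>.\<close>

lemma has_derivative_along_curve:
  fixes \<gamma> :: "real \<Rightarrow> 'a::euclidean_space"
  assumes "\<epsilon> > 0" "\<gamma> ` {-\<epsilon><..<\<epsilon>} \<subseteq> M" "(\<gamma> has_vector_derivative v) (at 0)"
    and g: "(g has_derivative g') (at (\<gamma> 0) within M)"
  shows "((\<lambda>t. g (\<gamma> t)) has_vector_derivative g' v) (at 0)"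
proof -
  have I: "at (0::real) within {-\<epsilon><..<\<epsilon>} = at 0" using assms(1) by (intro at_within_open) auto
  have "((\<lambda>t. g (\<gamma> t)) has_derivative (\<lambda>t. g' (t *\<^sub>R v))) (at 0 within {-\<epsilon><..<\<epsilon>})"
  proof (rule has_derivative_in_compose[where g=g and g'=g'])
    show "(\<gamma> has_derivative (\<lambda>t. t *\<^sub>R v)) (at 0 within {-\<epsilon><..<\<epsilon>})"
      using assms(3) by (simp only: I has_vector_derivative_def)
    show "(g has_derivative g') (at (\<gamma> 0) within \<gamma> ` {-\<epsilon><..<\<epsilon>})"
      by (rule has_derivative_subset[OF g assms(2)])
  qed
  then show ?thesis
    by (simp add: I has_vector_derivative_def linear_cmul[OF has_derivative_linear[OF g]])
qed

text \<open>Derivatives within \<open>M\<close> need not be unique as linear maps; on tangent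
  vectors they are, being read off along curves.\<close>

lemma tangent_derivative_unique:
  assumes "(g has_derivative g1) (at x within M)" "(g has_derivative g2) (at x within M)" "v \<in> tangent_space M x"
  shows "g1 v = g2 v"
proof -
  obtain \<epsilon> \<gamma> where g: "\<epsilon> > 0" "\<gamma> ` {-\<epsilon><..<\<epsilon>} \<subseteq> M" "\<gamma> 0 = x" "(\<gamma> has_vector_derivative v) (at 0)"
    using tangent_spaceE[OF assms(3)] by blast
  show ?thesis
    using has_derivative_along_curve[OF g(1,2,4)] assms(1,2) g(3) vector_derivative_unique_at by metis
qed

text \<open>The way out of the choice hidden in \<open>differential\<close>.\<close>

lemma differential_eq:
  assumes "(g has_derivative g') (at x within M)" "v \<in> tangent_space M x"
  shows "differential M g x v = g' v"
proof -
  have "(g has_derivative differential M g x) (at x within M)"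
    unfolding differential_def using assms(1) differentiableI frechet_derivative_works by blast
  then show ?thesis using tangent_derivative_unique assms by blast
qed

section \<open>Orthogonal projections, orthonormal bases and traces\<close>

lemma orth_proj_subspace:
  fixes S :: "'a::euclidean_space set"
  assumes "subspace S"
  shows "orth_proj S v \<in> S" "\<And>s. s \<in> S \<Longrightarrow> orth_proj S v \<bullet> s = v \<bullet> s"
proof -
  obtain y z where yz: "y \<in> span S" "\<And>w. w \<in> span S \<Longrightarrow> orthogonal z w" "v = y + z"
    using orthogonal_subspace_decomp_exists[of S v] by blast
  have sp: "span S = S" using assms span_eq_iff by blast
  have "orth_proj S v = y" unfolding orth_proj_def
  proof (rule the_equality)
    show "y \<in> S \<and> (\<forall>s\<in>S. orthogonal (v - y) s)" using yz sp by auto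
    fix w assume w: "w \<in> S \<and> (\<forall>s\<in>S. orthogonal (v - w) s)"
    then have d: "w - y \<in> S" using assms subspace_diff yz sp by metis
    then have "(v - w) \<bullet> (w - y) = 0" "(v - y) \<bullet> (w - y) = 0" using w yz sp by (auto simp: orthogonal_def)
    then have "(w - y) \<bullet> (w - y) = 0" by (simp add: inner_diff_left)
    then show "w = y" by simp
  qed
  then show "orth_proj S v \<in> S" "\<And>s. s \<in> S \<Longrightarrow> orth_proj S v \<bullet> s = v \<bullet> s"
    using yz sp by (auto simp: orthogonal_def inner_add_left)
qed

lemma orthonormal_basis_exists:
  assumes "subspace T" shows "\<exists>B. orthonormal_basis T B"
  using orthonormal_basis_subspace[OF assms] unfolding orthonormal_basis_def by metis

lemma orthonormal_basis_finite:
  fixes B :: "'a::euclidean_space set"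
  assumes "orthonormal_basis T B" shows "finite B" "independent B"
proof -
  have "0 \<notin> B" using assms unfolding orthonormal_basis_def by force
  then show "independent B" using assms pairwise_orthogonal_independent unfolding orthonormal_basis_def by blast
  then show "finite B" using independent_bound by blast
qed

lemma orthonormal_basis_sum:
  fixes B :: "'a::euclidean_space set"
  assumes "orthonormal_basis T B" "x \<in> T"
  shows "(\<Sum>b\<in>B. (x \<bullet> b) *\<^sub>R b) = x"
  using assms orthonormal_basis_expand[of B x] orthonormal_basis_finite(1)[OF assms(1)]
  unfolding orthonormal_basis_def by blast

lemma orthonormal_basis_subset: "orthonormal_basis T B \<Longrightarrow> B \<subseteq> T"
  unfolding orthonormal_basis_def using span_superset by blast

lemma orthonormal_basis_trace:
  fixes B C :: "'a::euclidean_space set"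
  assumes B: "orthonormal_basis T B" and C: "orthonormal_basis T C" and L: "linear L"
  shows "(\<Sum>e\<in>B. e \<bullet> L e) = (\<Sum>e\<in>C. e \<bullet> L e)"
proof -
  have "(\<Sum>e\<in>B. e \<bullet> L e) = (\<Sum>e\<in>B. \<Sum>c\<in>C. (e \<bullet> c) * (c \<bullet> L e))"
  proof (rule sum.cong)
    fix e assume "e \<in> B"
    then have "e = (\<Sum>c\<in>C. (e \<bullet> c) *\<^sub>R c)"
      using orthonormal_basis_sum[OF C] orthonormal_basis_subset[OF B] by (metis subsetD)
    then have "e \<bullet> L e = (\<Sum>c\<in>C. (e \<bullet> c) *\<^sub>R c) \<bullet> L e" by simp
    then show "e \<bullet> L e = (\<Sum>c\<in>C. (e \<bullet> c) * (c \<bullet> L e))" by (simp add: inner_sum_left)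
  qed simp
  also have "\<dots> = (\<Sum>c\<in>C. \<Sum>e\<in>B. (c \<bullet> e) * (c \<bullet> L e))"
    by (subst sum.swap) (simp add: inner_commute)
  also have "\<dots> = (\<Sum>c\<in>C. c \<bullet> L c)"
  proof (rule sum.cong)
    fix c assume "c \<in> C"
    then have "L c = L (\<Sum>e\<in>B. (c \<bullet> e) *\<^sub>R e)"
      using orthonormal_basis_sum[OF B] orthonormal_basis_subset[OF C] by (metis subsetD)
    also have "\<dots> = (\<Sum>e\<in>B. (c \<bullet> e) *\<^sub>R L e)" by (simp add: linear_sum[OF L] linear_cmul[OF L])
    finally have "L c = (\<Sum>e\<in>B. (c \<bullet> e) *\<^sub>R L e)" .
    then show "(\<Sum>e\<in>B. (c \<bullet> e) * (c \<bullet> L e)) = c \<bullet> L c" by (simp add: inner_sum_right)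
  qed simp
  finally show ?thesis .
qed

section \<open>Derivatives along submanifolds and tangent spaces of spheres\<close>

lemma smooth_map_on_has_derivative:
  assumes "smooth_map_on M f" "x \<in> M"
  shows "\<exists>D. (f has_derivative D) (at x within M)"
proof -
  obtain W F where W: "open W" "x \<in> W" "smooth_on W F" "\<And>y. y \<in> M \<inter> W \<Longrightarrow> f y = F y"
    using bspec[OF assms(1)[unfolded smooth_map_on_def] assms(2)] by metis
  obtain d where d: "d > 0" "ball x d \<subseteq> W" using W(1,2) open_contains_ball by metis
  have "(F has_derivative frechet_derivative F (at x)) (at x within M)"
    using smooth_on_has_derivative[OF W(3,1,2)] by (rule has_derivative_at_withinI)
  then have "(f has_derivative frechet_derivative F (at x)) (at x within M)"
  proof (rule has_derivative_transform_within[OF _ d(1) assms(2)])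
    show "F x' = f x'" if "x' \<in> M" "dist x' x < d" for x'
    proof -
      have "x' \<in> M \<inter> W" using that d(2) by (auto simp: dist_commute)
      then show ?thesis using W(4) by simp
    qed
  qed
  then show ?thesis by blast
qed

lemma tangent_space_UNIV: "tangent_space UNIV x = (UNIV :: 'a::euclidean_space set)"
proof -
  have "v \<in> tangent_space UNIV x" for v
  proof (rule tangent_spaceI[where A=UNIV and \<gamma>="\<lambda>t. x + t *\<^sub>R v"])
    show "smooth_on UNIV (\<lambda>t. x + t *\<^sub>R v)"
      by (rule smooth_on_add[OF open_UNIV smooth_on_const smooth_on_bounded_linear[OF bounded_linear_scaleR_left open_UNIV]])
    show "((\<lambda>t. x + t *\<^sub>R v) has_vector_derivative v) (at 0)"
      by (auto intro!: derivative_eq_intros)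
  qed auto
  then show ?thesis by auto
qed

lemma smooth_on_normalized_line:
  fixes x u :: "'a::euclidean_space"
  shows "smooth_on {t. x + t *\<^sub>R u \<noteq> 0} (\<lambda>t. (x + t *\<^sub>R u) /\<^sub>R norm (x + t *\<^sub>R u))"
    "open {t. x + t *\<^sub>R u \<noteq> 0}"
proof -
  show o: "open {t. x + t *\<^sub>R u \<noteq> 0}"
    by (intro open_Collect_neq continuous_intros)
  have l: "smooth_on {t. x + t *\<^sub>R u \<noteq> 0} (\<lambda>t. x + t *\<^sub>R u)"
    by (rule smooth_on_add[OF o smooth_on_const smooth_on_bounded_linear[OF bounded_linear_scaleR_left o]])
  have op: "open (-{0::'a})" by (rule open_Compl) (rule closed_singleton)
  show "smooth_on {t. x + t *\<^sub>R u \<noteq> 0} (\<lambda>t. (x + t *\<^sub>R u) /\<^sub>R norm (x + t *\<^sub>R u))"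
    by (rule smooth_on_compose[OF o op _ l smooth_on_normalize[OF op]]) auto
qed

text \<open>The norm of \<open>x + t *\<^sub>R u\<close> is stationary at 0 because \<open>u\<close>
  is orthogonal to \<open>x\<close>, so projecting the line to the sphere does not change its
  velocity.\<close>

lemma normalized_line_derivative:
  fixes x u :: "'a::euclidean_space"
  assumes "x \<bullet> u = 0" "norm x = c" "c > 0"
  shows "((\<lambda>t. (c / norm (x + t *\<^sub>R u)) *\<^sub>R (x + t *\<^sub>R u)) has_vector_derivative u) (at 0)"
proof -
  have x0: "x \<noteq> 0" using assms by auto
  have "((\<lambda>t. norm (x + t *\<^sub>R u)) has_derivative (\<lambda>t. 0)) (at 0)"
  proof -
    have l: "((\<lambda>t. x + t *\<^sub>R u) has_derivative (\<lambda>t. t *\<^sub>R u)) (at 0)" by (auto intro!: derivative_eq_intros)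
    have "((\<lambda>t. norm (x + t *\<^sub>R u)) has_derivative (\<lambda>t. (t *\<^sub>R u) \<bullet> sgn (x + 0 *\<^sub>R u))) (at 0)"
      by (rule has_derivative_compose[OF l]) (use x0 in \<open>simp add: has_derivative_norm\<close>)
    then show ?thesis using assms(1) by (simp add: sgn_div_norm inner_commute)
  qed
  then have "((\<lambda>t. norm (x + t *\<^sub>R u)) has_real_derivative 0) (at 0)"
    by (simp add: has_field_derivative_def mult_commute_abs[of 0] lambda_zero)
  then have 1: "((\<lambda>t. c / norm (x + t *\<^sub>R u)) has_real_derivative 0) (at 0)"
    using DERIV_divide[OF DERIV_const[of c]] x0 by force
  have 2: "((\<lambda>t. x + t *\<^sub>R u) has_vector_derivative u) (at 0)"
    by (auto intro!: derivative_eq_intros)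
  show ?thesis using has_vector_derivative_scaleR[OF 1 2] assms(2,3) x0 by simp
qed

lemma tangent_space_sphere:
  fixes x :: "'a::euclidean_space"
  assumes "norm x = c" "c > 0"
  shows "tangent_space (sphere 0 c) x = {u. x \<bullet> u = 0}"
proof (intro set_eqI iffI; clarsimp)
  fix u assume "u \<in> tangent_space (sphere 0 c) x"
  then obtain \<epsilon> \<gamma> where g: "\<epsilon> > 0" "\<gamma> ` {-\<epsilon><..<\<epsilon>} \<subseteq> sphere 0 c" "\<gamma> 0 = x" "(\<gamma> has_vector_derivative u) (at 0)"
    by (rule tangent_spaceE)
  have "((\<lambda>y. y \<bullet> y) has_derivative (\<lambda>h. x \<bullet> h + h \<bullet> x)) (at (\<gamma> 0) within sphere 0 c)"
    by (auto intro!: derivative_eq_intros simp: g(3))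
  then have 1: "((\<lambda>t. \<gamma> t \<bullet> \<gamma> t) has_vector_derivative (x \<bullet> u + u \<bullet> x)) (at 0)"
    using has_derivative_along_curve[OF g(1,2,4)] by blast
  have 2: "((\<lambda>t. \<gamma> t \<bullet> \<gamma> t) has_vector_derivative 0) (at 0)"
  proof (rule has_vector_derivative_transform_within_open[where S="{-\<epsilon><..<\<epsilon>}" and f="\<lambda>t. c\<^sup>2"])
    fix t assume "t \<in> {-\<epsilon><..<\<epsilon>}"
    then have "\<gamma> t \<in> sphere 0 c" using g(2) by blast
    then have "norm (\<gamma> t) = c" by simp
    then show "c\<^sup>2 = \<gamma> t \<bullet> \<gamma> t" by (simp add: dot_square_norm)
  qed (use g(1) in auto)
  have "x \<bullet> u + u \<bullet> x = 0" by (rule vector_derivative_unique_at[OF 1 2])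
  then show "x \<bullet> u = 0" by (simp add: inner_commute)
next
  fix u assume u: "x \<bullet> u = 0"
  let ?A = "{t. x + t *\<^sub>R u \<noteq> 0}"
  show "u \<in> tangent_space (sphere 0 c) x"
  proof (rule tangent_spaceI[where A="?A" and \<gamma>="\<lambda>t. (c / norm (x + t *\<^sub>R u)) *\<^sub>R (x + t *\<^sub>R u)"])
    show "open ?A" by (rule smooth_on_normalized_line)
    have "smooth_on ?A (\<lambda>t. c *\<^sub>R ((x + t *\<^sub>R u) /\<^sub>R norm (x + t *\<^sub>R u)))"
      by (rule smooth_on_linear_compose[OF bounded_linear_scaleR_right]) (rule smooth_on_normalized_line)+
    then show "smooth_on ?A (\<lambda>t. (c / norm (x + t *\<^sub>R u)) *\<^sub>R (x + t *\<^sub>R u))" by (simp add: divide_inverse)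
    show "((\<lambda>t. (c / norm (x + t *\<^sub>R u)) *\<^sub>R (x + t *\<^sub>R u)) has_vector_derivative u) (at 0)"
      using u assms by (rule normalized_line_derivative)
  qed (use assms in auto)
qed

text \<open>Holds whatever field and basis the choice operators return: only the two projections
  matter, and they have equal inner products with vectors tangent to \<open>M\<close>.\<close>

lemma mean_curvature_subspace:
  assumes N: "subspace (tangent_space N p)" and M: "subspace (tangent_space M p)"
    and sub: "tangent_space M p \<subseteq> tangent_space N p"
  shows "mean_curvature N M p \<in> tangent_space N p"
    and "\<And>u. u \<in> tangent_space M p \<Longrightarrow> mean_curvature N M p \<bullet> u = 0"
proof -
  show "mean_curvature N M p \<in> tangent_space N p"
    unfolding mean_curvature_def second_fundamental_form_def covariant_derivative_def Let_def
    using orth_proj_subspace(1)[OF N] orth_proj_subspace(1)[OF M] sub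
    by (intro subspace_sum[OF N] subspace_diff[OF N]) auto
  show "mean_curvature N M p \<bullet> u = 0" if "u \<in> tangent_space M p" for u
    using that sub orth_proj_subspace(2)[OF N, of u] orth_proj_subspace(2)[OF M, of u]
    unfolding mean_curvature_def second_fundamental_form_def covariant_derivative_def Let_def
    by (auto simp: inner_sum_left inner_diff_left)
qed

text \<open>Weingarten's equation; pairing with a normal field removes the dependence on the tangent
  fields chosen in the definition of the second fundamental form.\<close>

lemma mean_curvature_inner:
  assumes N: "subspace (tangent_space N p)" and M: "subspace (tangent_space M p)"
    and pM: "p \<in> M"
    and ext: "\<And>e. e \<in> tangent_space M p \<Longrightarrow> \<exists>V. tangent_field_near M p V \<and> V p = e"
    and B: "orthonormal_basis (tangent_space M p) B"
    and W: "open W" "p \<in> W" "\<And>q t. q \<in> M \<inter> W \<Longrightarrow> t \<in> tangent_space M q \<Longrightarrow> t \<bullet> \<nu> q = 0"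
    and \<nu>: "(\<nu> has_derivative \<nu>') (at p)" "\<nu> p \<in> tangent_space N p"
  shows "mean_curvature N M p \<bullet> \<nu> p = - (\<Sum>e\<in>B. e \<bullet> \<nu>' e)"
proof -
  have sff: "second_fundamental_form N M p e e \<bullet> \<nu> p = - (e \<bullet> \<nu>' e)" if e: "e \<in> tangent_space M p" for e
  proof -
    define V where "V = (SOME V. tangent_field_near M p V \<and> V p = e)"
    have "tangent_field_near M p V \<and> V p = e"
      unfolding V_def using ext[OF e] by (rule someI_ex)
    then obtain W' where W': "open W'" "p \<in> W'" "smooth_map_on (M \<inter> W') V"
        "\<And>q. q \<in> M \<inter> W' \<Longrightarrow> V q \<in> tangent_space M q" and Vp: "V p = e"
      unfolding tangent_field_near_def by blast
    obtain D where "(V has_derivative D) (at p within M \<inter> W')"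
      using smooth_map_on_has_derivative[OF W'(3)] pM W'(2) by blast
    then have D: "(V has_derivative D) (at p within M)"
      using at_within_nhd[of p W' "M \<inter> W'" M] W'(1,2) by (simp add: Int_Diff Int_assoc)
    have d: "differential M V p e = D e" using differential_eq[OF D e] .
    obtain \<epsilon> \<gamma> where g: "\<epsilon> > 0" "\<gamma> ` {-\<epsilon><..<\<epsilon>} \<subseteq> M" "\<gamma> 0 = p" "(\<gamma> has_vector_derivative e) (at 0)"
      using tangent_spaceE[OF e] by metis
    have "((\<lambda>q. V q \<bullet> \<nu> q) has_derivative (\<lambda>h. V p \<bullet> \<nu>' h + D h \<bullet> \<nu> p)) (at (\<gamma> 0) within M)"
      unfolding g(3) using bounded_bilinear.FDERIV[OF bounded_bilinear_inner D has_derivative_at_withinI[OF \<nu>(1)]] .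
    then have 1: "((\<lambda>t. V (\<gamma> t) \<bullet> \<nu> (\<gamma> t)) has_vector_derivative (e \<bullet> \<nu>' e + D e \<bullet> \<nu> p)) (at 0)"
      using has_derivative_along_curve[OF g(1,2,4)] Vp by blast
    \<comment> \<open>\<open>V\<close> is known to be tangent and \<open>\<nu>\<close> to be normal
      only near \<open>p\<close>; continuity keeps the curve there for small t.\<close>
    have "isCont \<gamma> 0" by (rule has_vector_derivative_continuous[OF g(4)])
    then have "(\<gamma> \<longlongrightarrow> p) (nhds 0)"
      using tendsto_at_iff_tendsto_nhds[of \<gamma> 0] g(3) by (simp add: isCont_def)
    then have "\<forall>\<^sub>F t in nhds 0. \<gamma> t \<in> W \<inter> W'"
      using topological_tendstoD[of \<gamma> p "nhds 0" "W \<inter> W'"] W(1,2) W'(1,2) by (simp add: open_Int)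
    moreover have "\<forall>\<^sub>F t in nhds (0::real). t \<in> {-\<epsilon><..<\<epsilon>}"
      using g(1) by (intro eventually_nhds_in_open) auto
    ultimately have "\<forall>\<^sub>F t in nhds 0. V (\<gamma> t) \<bullet> \<nu> (\<gamma> t) = 0"
    proof eventually_elim
      case (elim t)
      moreover have "\<gamma> t \<in> M" using elim(2) g(2) by blast
      ultimately have "\<gamma> t \<in> M \<inter> W" "\<gamma> t \<in> M \<inter> W'" by auto
      then show ?case using W(3) W'(4) by blast
    qed
    then have 2: "((\<lambda>t. V (\<gamma> t) \<bullet> \<nu> (\<gamma> t)) has_vector_derivative 0) (at 0)"
      by (subst has_vector_derivative_cong_ev[where g="\<lambda>_. 0"]) (auto dest: eventually_nhds_x_imp_x elim: eventually_mono)
    \<comment> \<open>The product rule for \<open>V \<bullet> \<nu> = 0\<close> along the curve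
      trades the derivative of the unknown \<open>V\<close> for that of
      \<open>\<nu>\<close>.\<close>
    have "e \<bullet> \<nu>' e + D e \<bullet> \<nu> p = 0" by (rule vector_derivative_unique_at[OF 1 2])
    moreover have "second_fundamental_form N M p e e \<bullet> \<nu> p = D e \<bullet> \<nu> p"
      using orth_proj_subspace(2)[OF N \<nu>(2)] W(3)[of p] W(2) pM orth_proj_subspace(1)[OF M]
      unfolding second_fundamental_form_def covariant_derivative_def V_def[symmetric] Let_def
      by (simp add: inner_diff_left d)
    ultimately show ?thesis by simp
  qed
  \<comment> \<open>The basis picked by the definition is unknown; the trace does not see the change
    to \<open>B\<close>.\<close>
  define C where "C = (SOME B. orthonormal_basis (tangent_space M p) B)"
  have C: "orthonormal_basis (tangent_space M p) C"
    unfolding C_def using orthonormal_basis_exists[OF M] by (rule someI_ex)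
  have "mean_curvature N M p \<bullet> \<nu> p = (\<Sum>e\<in>C. second_fundamental_form N M p e e \<bullet> \<nu> p)"
    unfolding mean_curvature_def Let_def C_def[symmetric] by (simp add: inner_sum_left)
  also have "\<dots> = (\<Sum>e\<in>C. - (e \<bullet> \<nu>' e))"
    using sff orthonormal_basis_subset[OF C] by (intro sum.cong) auto
  also have "\<dots> = - (\<Sum>e\<in>B. e \<bullet> \<nu>' e)"
    by (simp add: sum_negf orthonormal_basis_trace[OF C B has_derivative_linear[OF \<nu>(1)]])
  finally show ?thesis .
qed

section \<open>Second derivatives and singular values\<close>

text \<open>The direction precedes the point, so that \<open>dir_deriv f v\<close> is again a map of
  the same kind and can be differentiated in turn.\<close>

definition dir_deriv :: "('a::real_normed_vector \<Rightarrow> 'b::real_normed_vector) \<Rightarrow> 'a \<Rightarrow> 'a \<Rightarrow> 'b" where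
  "dir_deriv f v x = frechet_derivative f (at x) v"

lemma smooth_on_dir_deriv: "smooth_on S f \<Longrightarrow> smooth_on S (dir_deriv f v)"
  using smooth_on_derivative[of S f v] by (simp add: dir_deriv_def[abs_def])

lemma dir_deriv_has_derivative:
  assumes "smooth_on S f" "open S" "x \<in> S"
  shows "(f has_derivative (\<lambda>v. dir_deriv f v x)) (at x)"
  using smooth_on_has_derivative[OF assms] by (simp add: dir_deriv_def)

lemma dir_deriv_eq:
  assumes "(f has_derivative f') (at x)"
  shows "dir_deriv f v x = f' v"
  using frechet_derivative_at[OF assms] by (simp add: dir_deriv_def)

lemma dir_deriv_line:
  assumes "smooth_on S f" "open S" "y + a *\<^sub>R u \<in> S"
  shows "((\<lambda>t. f (y + t *\<^sub>R u)) has_vector_derivative dir_deriv f u (y + a *\<^sub>R u)) (at a)"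
proof -
  have d: "(f has_derivative (\<lambda>v. dir_deriv f v (y + a *\<^sub>R u))) (at (y + a *\<^sub>R u))"
    by (rule dir_deriv_has_derivative[OF assms])
  have l: "((\<lambda>t. y + t *\<^sub>R u) has_derivative (\<lambda>t. t *\<^sub>R u)) (at a)" by (auto intro!: derivative_eq_intros)
  show ?thesis
    using has_derivative_compose[OF l d] by (simp add: has_vector_derivative_def linear_cmul[OF has_derivative_linear[OF d]])
qed

text \<open>Two applications of the mean value theorem to the second difference. The values are
  paired with \<open>w\<close> because the theorem needs real functions; the intermediate point
  \<open>z\<close> may therefore depend on \<open>w\<close>.\<close>

lemma mixed_difference_mean_value:
  fixes F :: "'a::real_normed_vector \<Rightarrow> 'b::euclidean_space"
  assumes F: "smooth_on (ball y d) F" and s: "s > 0" "s * (norm u + norm v) < d"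
  shows "\<exists>z\<in>ball y d. (F (y + s *\<^sub>R u + s *\<^sub>R v) - F (y + s *\<^sub>R u) - F (y + s *\<^sub>R v) + F y) \<bullet> w
      = s\<^sup>2 * (dir_deriv (dir_deriv F u) v z \<bullet> w)"
proof -
  have mem: "y + a *\<^sub>R u + b *\<^sub>R v \<in> ball y d" if "0 \<le> a" "a \<le> s" "0 \<le> b" "b \<le> s" for a b
  proof -
    have "norm (a *\<^sub>R u + b *\<^sub>R v) \<le> a * norm u + b * norm v"
      using norm_triangle_ineq[of "a *\<^sub>R u" "b *\<^sub>R v"] that by simp
    also have "\<dots> \<le> s * norm u + s * norm v" using that by (intro add_mono mult_right_mono) auto
    also have "\<dots> < d" using s(2) by (simp add: distrib_left)
    finally have "norm (a *\<^sub>R u + b *\<^sub>R v) < d" .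
    moreover have "dist y (y + a *\<^sub>R u + b *\<^sub>R v) = norm (a *\<^sub>R u + b *\<^sub>R v)"
      by (metis add.assoc add_diff_cancel_left' dist_commute dist_norm)
    ultimately show ?thesis by simp
  qed
  have der: "((\<lambda>t. f (x + t *\<^sub>R h) \<bullet> w) has_real_derivative dir_deriv f h (x + a *\<^sub>R h) \<bullet> w) (at a)"
    if "smooth_on (ball y d) f" "x + a *\<^sub>R h \<in> ball y d" for f :: "'a \<Rightarrow> 'b" and x h a
    using bounded_linear.has_vector_derivative[OF bounded_linear_inner_left dir_deriv_line[OF that(1) open_ball that(2)]]
    by (simp add: has_real_derivative_iff_has_vector_derivative)
  define g where "g a = F (y + s *\<^sub>R v + a *\<^sub>R u) \<bullet> w - F (y + a *\<^sub>R u) \<bullet> w" for a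
  have "\<exists>\<xi>>0. \<xi> < s \<and> g s - g 0 = (s - 0) * (dir_deriv F u (y + s *\<^sub>R v + \<xi> *\<^sub>R u) \<bullet> w - dir_deriv F u (y + \<xi> *\<^sub>R u) \<bullet> w)"
  proof (rule MVT2[OF s(1)])
    fix a assume a: "0 \<le> a" "a \<le> s"
    show "(g has_real_derivative dir_deriv F u (y + s *\<^sub>R v + a *\<^sub>R u) \<bullet> w - dir_deriv F u (y + a *\<^sub>R u) \<bullet> w) (at a)"
      unfolding g_def using mem[of a s] mem[of a 0] a s(1)
      by (intro DERIV_diff der F) (simp_all add: ac_simps)
  qed
  then obtain \<xi> where \<xi>: "0 < \<xi>" "\<xi> < s"
      "g s - g 0 = s * (dir_deriv F u (y + s *\<^sub>R v + \<xi> *\<^sub>R u) \<bullet> w - dir_deriv F u (y + \<xi> *\<^sub>R u) \<bullet> w)" by auto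
  have "\<exists>\<eta>>0. \<eta> < s \<and> dir_deriv F u (y + \<xi> *\<^sub>R u + s *\<^sub>R v) \<bullet> w - dir_deriv F u (y + \<xi> *\<^sub>R u + 0 *\<^sub>R v) \<bullet> w
      = (s - 0) * (dir_deriv (dir_deriv F u) v (y + \<xi> *\<^sub>R u + \<eta> *\<^sub>R v) \<bullet> w)"
    using \<xi> mem[of \<xi>] by (intro MVT2[OF s(1)] der smooth_on_dir_deriv F) auto
  then obtain \<eta> where \<eta>: "0 < \<eta>" "\<eta> < s" "dir_deriv F u (y + \<xi> *\<^sub>R u + s *\<^sub>R v) \<bullet> w - dir_deriv F u (y + \<xi> *\<^sub>R u) \<bullet> w
      = s * (dir_deriv (dir_deriv F u) v (y + \<xi> *\<^sub>R u + \<eta> *\<^sub>R v) \<bullet> w)" by auto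
  have "(F (y + s *\<^sub>R u + s *\<^sub>R v) - F (y + s *\<^sub>R u) - F (y + s *\<^sub>R v) + F y) \<bullet> w = g s - g 0"
    unfolding g_def by (simp add: inner_diff_left inner_add_left ac_simps)
  also have "\<dots> = s\<^sup>2 * (dir_deriv (dir_deriv F u) v (y + \<xi> *\<^sub>R u + \<eta> *\<^sub>R v) \<bullet> w)"
    using \<xi>(3) \<eta>(3) by (simp add: ac_simps power2_eq_square)
  finally show ?thesis using mem[of \<xi> \<eta>] \<xi> \<eta> by (intro bexI) auto
qed

text \<open>The second difference is symmetric in \<open>u\<close> and \<open>v\<close>, so the two
  mixed derivatives agree at two points close to \<open>y\<close>; continuity brings these points
  back to \<open>y\<close>.\<close>

lemma dir_deriv_commute:
  fixes F :: "'a::real_normed_vector \<Rightarrow> 'b::euclidean_space"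
  assumes F: "smooth_on S F" and S: "open S" "y \<in> S"
  shows "dir_deriv (dir_deriv F u) v y = dir_deriv (dir_deriv F v) u y"
proof (rule euclidean_eqI, rule ccontr)
  fix w :: 'b
  let ?P = "\<lambda>z. dir_deriv (dir_deriv F u) v z \<bullet> w" and ?Q = "\<lambda>z. dir_deriv (dir_deriv F v) u z \<bullet> w"
  assume ne: "?P y \<noteq> ?Q y"
  \<comment> \<open>Half the supposed gap: two errors below \<open>e\<close> cannot bridge
    it.\<close>
  define e where "e = \<bar>?P y - ?Q y\<bar> / 2"
  have e: "e > 0" using ne by (simp add: e_def)
  have "continuous_on S (\<lambda>z. dir_deriv (dir_deriv F a) b z \<bullet> w)" for a b
    by (intro continuous_intros smooth_on_continuous smooth_on_dir_deriv F)
  then have cont: "isCont (\<lambda>z. dir_deriv (dir_deriv F a) b z \<bullet> w) y" for a b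
    using S by (simp add: continuous_on_eq_continuous_at)
  obtain d1 where d1: "d1 > 0" "\<And>z. dist z y < d1 \<Longrightarrow> dist (?P z) (?P y) < e"
    using cont[of u v] e unfolding continuous_at_eps_delta by blast
  obtain d2 where d2: "d2 > 0" "\<And>z. dist z y < d2 \<Longrightarrow> dist (?Q z) (?Q y) < e"
    using cont[of v u] e unfolding continuous_at_eps_delta by blast
  obtain d3 where d3: "d3 > 0" "ball y d3 \<subseteq> S" using S open_contains_ball by metis
  define d where "d = min d1 (min d2 d3)"
  have d: "d > 0" "d \<le> d1" "d \<le> d2" "d \<le> d3" using d1(1) d2(1) d3(1) by (auto simp: d_def)
  have sm: "smooth_on (ball y d) F"
    by (rule smooth_on_subset[OF F]) (use d3(2) d(4) in auto)
  \<comment> \<open>The summand 1 keeps the denominator positive when both directions vanish; the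
    factor 2 makes the later inequality strict.\<close>
  define s where "s = d / (2 * (norm u + norm v + 1))"
  have s: "s > 0" using d(1) by (auto simp: s_def intro!: divide_pos_pos add_nonneg_pos)
  have "s * (norm u + norm v) \<le> s * (norm u + norm v + 1)" using s by (intro mult_left_mono) auto
  also have "\<dots> = d / 2"
  proof -
    have "norm u + norm v + 1 \<noteq> 0" using norm_ge_zero[of u] norm_ge_zero[of v] by linarith
    then show ?thesis by (simp add: s_def field_simps)
  qed
  finally have s': "s * (norm u + norm v) < d" "s * (norm v + norm u) < d" using d(1) by (simp_all add: add.commute)
  obtain z1 where z1: "z1 \<in> ball y d"
      "(F (y + s *\<^sub>R u + s *\<^sub>R v) - F (y + s *\<^sub>R u) - F (y + s *\<^sub>R v) + F y) \<bullet> w = s\<^sup>2 * ?P z1"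
    using mixed_difference_mean_value[OF sm s s'(1)] by blast
  obtain z2 where z2: "z2 \<in> ball y d"
      "(F (y + s *\<^sub>R v + s *\<^sub>R u) - F (y + s *\<^sub>R v) - F (y + s *\<^sub>R u) + F y) \<bullet> w = s\<^sup>2 * ?Q z2"
    using mixed_difference_mean_value[OF sm s s'(2)] by blast
  have "s\<^sup>2 * ?P z1 = s\<^sup>2 * ?Q z2"
    unfolding z1(2)[symmetric] z2(2)[symmetric] by (simp add: ac_simps inner_diff_left inner_add_left)
  then have "?P z1 = ?Q z2" using s by simp
  moreover have "dist z1 y < d1" "dist z2 y < d2" using z1(1) z2(1) d by (auto simp: dist_commute)
  then have "\<bar>?P z1 - ?P y\<bar> < e" "\<bar>?Q z2 - ?Q y\<bar> < e" using d1(2) d2(2) by (auto simp: dist_real_def)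
  moreover have "\<bar>?P y - ?Q y\<bar> = 2 * e" by (simp add: e_def)
  ultimately show False by arith
qed

text \<open>The first-order condition at a maximum, in a form that needs no derivatives.\<close>

lemma linear_term_zero:
  fixes a b :: real
  assumes "\<And>t. a * t + b * t\<^sup>2 \<le> 0"
  shows "a = 0"
proof (rule ccontr)
  assume a: "a \<noteq> 0"
  \<comment> \<open>At \<open>t = a / c\<close> the left side is
    \<open>a\<^sup>2 * (c + b) / c\<^sup>2\<close>, which is positive once \<open>c\<close> and
    \<open>c + b\<close> are.\<close>
  define c where "c = \<bar>b\<bar> + 1"
  have c: "c > 0" "c + b > 0" by (auto simp: c_def)
  have "a * (a / c) + b * (a / c)\<^sup>2 = a\<^sup>2 * (c + b) / c\<^sup>2"
    using c by (simp add: field_simps power2_eq_square)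
  moreover have "\<dots> > 0" using a c by simp
  ultimately show False using assms[of "a / c"] by linarith
qed

section \<open>Singular value decomposition with one nonzero singular value\<close>

lemma singular_space_cong:
  "(\<And>u. u \<in> T \<Longrightarrow> A u = A' u) \<Longrightarrow> singular_space T A \<sigma> = singular_space T A' \<sigma>"
  unfolding singular_space_def by (rule Collect_cong) auto

lemma subspace_singular_space:
  assumes "linear A" "subspace T"
  shows "subspace (singular_space T A \<sigma>)"
  using assms unfolding singular_space_def subspace_def
  by (auto simp: linear_add linear_cmul linear_0 inner_add_left algebra_simps)

text \<open>Take a maximiser of the Rayleigh quotient on \<open>R\<close>; its first variation in
  the directions of \<open>R\<close> is the claimed relation.\<close>

lemma singular_vector_exists:
  fixes A :: "'a::euclidean_space \<Rightarrow> 'b::euclidean_space"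
  assumes A: "linear A" and R: "subspace R" "R \<noteq> {0}"
  shows "\<exists>u\<in>R. u \<noteq> 0 \<and> (\<exists>\<mu>\<ge>0. \<forall>w\<in>R. A u \<bullet> A w = \<mu> * (u \<bullet> w))"
proof -
  have "0 \<in> R" using R(1) by (rule subspace_0)
  then obtain z where z: "z \<in> R" "z \<noteq> 0" using R(2) by blast
  define K where "K = R \<inter> sphere 0 1"
  have "z /\<^sub>R norm z \<in> K" using z R(1) by (simp add: K_def subspace_mul)
  then have ne: "K \<noteq> {}" by blast
  have "compact K" unfolding K_def by (rule closed_Int_compact[OF closed_subspace[OF R(1)] compact_sphere])
  moreover have "continuous_on K (\<lambda>r. A r \<bullet> A r)"
    by (intro continuous_intros linear_continuous_on linear_conv_bounded_linear[THEN iffD1] A)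
  ultimately obtain u where u: "u \<in> K" "\<And>r. r \<in> K \<Longrightarrow> A r \<bullet> A r \<le> A u \<bullet> A u"
    using continuous_attains_sup[OF _ ne] by blast
  define \<mu> where "\<mu> = A u \<bullet> A u"
  have uR: "u \<in> R" and u1: "u \<bullet> u = 1" using u(1) by (auto simp: K_def norm_eq_1)
  have le: "A r \<bullet> A r \<le> \<mu> * (r \<bullet> r)" if "r \<in> R" for r
  proof (cases "r = 0")
    case True then show ?thesis by (simp add: linear_0[OF A])
  next
    case False
    then have "r /\<^sub>R norm r \<in> K" using that R(1) by (simp add: K_def subspace_mul)
    then have "A (r /\<^sub>R norm r) \<bullet> A (r /\<^sub>R norm r) \<le> \<mu>" using u(2) \<mu>_def by blast
    then have "(A r \<bullet> A r) / (norm r)\<^sup>2 \<le> \<mu>"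
      by (simp add: linear_cmul[OF A] power2_eq_square divide_inverse mult.commute mult.left_commute)
    then show ?thesis using False by (simp add: divide_le_eq dot_square_norm)
  qed
  have "A u \<bullet> A w = \<mu> * (u \<bullet> w)" if w: "w \<in> R" for w
  proof -
    \<comment> \<open>Insert \<open>u + t *\<^sub>R w\<close> into \<open>le\<close>: the constant
      terms agree, which leaves a quadratic in t without constant term.\<close>
    have "2 * (A u \<bullet> A w - \<mu> * (u \<bullet> w)) = 0"
    proof (rule linear_term_zero[where b="A w \<bullet> A w - \<mu> * (w \<bullet> w)"])
      fix t
      have "u + t *\<^sub>R w \<in> R" using w uR R(1) by (simp add: subspace_add subspace_mul)
      from le[OF this] show "2 * (A u \<bullet> A w - \<mu> * (u \<bullet> w)) * t + (A w \<bullet> A w - \<mu> * (w \<bullet> w)) * t\<^sup>2 \<le> 0"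
        using u1 \<mu>_def by (simp add: linear_add[OF A] linear_cmul[OF A] inner_add_left inner_add_right
            inner_commute[of "A w" "A u"] inner_commute[of w u] algebra_simps power2_eq_square)
    qed
    then show ?thesis by simp
  qed
  moreover have "\<mu> \<ge> 0" by (simp add: \<mu>_def)
  ultimately show ?thesis using uR u1 by (metis inner_zero_left zero_neq_one)
qed

text \<open>Were the kernel and the space of lam not to span \<open>T\<close>, the orthogonal
  complement would contain a vector that is singular for all of \<open>T\<close>. Its value is 0 or
  lam, so it would lie in one of the two spaces and be orthogonal to itself.\<close>

lemma singular_decomposition:
  fixes A :: "'a::euclidean_space \<Rightarrow> 'b::euclidean_space"
  assumes A: "linear A" and T: "subspace T" and sv: "singular_values T A - {0} = {lam}"
  obtains BV BH where "orthonormal_basis T (BV \<union> BH)" "BV \<inter> BH = {}"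
    "\<And>v. v \<in> BV \<Longrightarrow> A v = 0" "\<And>h w. h \<in> BH \<Longrightarrow> w \<in> T \<Longrightarrow> A h \<bullet> A w = lam\<^sup>2 * (h \<bullet> w)"
    "card BH = singular_multiplicity T A lam" "card BV + card BH = dim T" "lam > 0"
proof -
  have "lam \<in> singular_values T A - {0}" using sv by simp
  then have lam: "lam > 0" by (simp add: singular_values_def)
  define V where "V = singular_space T A 0"
  define H where "H = singular_space T A lam"
  have V: "subspace V" and H: "subspace H" unfolding V_def H_def by (rule subspace_singular_space[OF A T])+
  have V0: "A v = 0" if "v \<in> V" for v
  proof -
    from that have "A v \<bullet> A v = 0\<^sup>2 * (v \<bullet> v)" unfolding V_def singular_space_def by blast
    then show ?thesis by simp
  qed
  have Hw: "A h \<bullet> A w = lam\<^sup>2 * (h \<bullet> w)" if "h \<in> H" "w \<in> T" for h w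
    using that unfolding H_def singular_space_def by blast
  have VT: "V \<subseteq> T" and HT: "H \<subseteq> T" unfolding V_def H_def singular_space_def by auto
  obtain BV where BV: "BV \<subseteq> V" "pairwise orthogonal BV" "\<And>x. x \<in> BV \<Longrightarrow> norm x = 1" "span BV = V"
    using orthonormal_basis_subspace[OF V] by metis
  obtain BH where BH: "BH \<subseteq> H" "pairwise orthogonal BH" "\<And>x. x \<in> BH \<Longrightarrow> norm x = 1" "card BH = dim H" "span BH = H"
    using orthonormal_basis_subspace[OF H] by metis
  have VH: "v \<bullet> h = 0" if "v \<in> V" "h \<in> H" for v h
    using Hw[OF that(2), of v] V0[OF that(1)] VT that lam by (auto simp: inner_commute)
  define U where "U = span (BV \<union> BH)"
  have U: "subspace U" and VU: "V \<subseteq> U" and HU: "H \<subseteq> U"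
    unfolding U_def BV(4)[symmetric] BH(5)[symmetric] by (auto intro: span_mono[THEN subsetD])
  have UT: "U \<subseteq> T" unfolding U_def using BV(1) BH(1) VT HT T by (intro span_minimal) auto
  have "U = T"
  proof (rule ccontr)
    assume "U \<noteq> T"
    then obtain x where x: "x \<in> T" "x \<notin> U" using UT by blast
    define R where "R = {r \<in> T. \<forall>w\<in>U. r \<bullet> w = 0}"
    have R: "subspace R" using T unfolding R_def subspace_def by (auto simp: inner_add_left)
    have dec: "\<exists>y\<in>U. \<exists>z\<in>R. w = y + z" if w: "w \<in> T" for w
    proof -
      obtain y z where yz: "y \<in> span U" "\<And>w. w \<in> span U \<Longrightarrow> orthogonal z w" "w = y + z"
        using orthogonal_subspace_decomp_exists[of U w] by blast
      have sp: "span U = U" using U span_eq_iff by blast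
      have "z = w - y" using yz(3) by simp
      then have "z \<in> T" using w yz(1) sp UT subspace_diff[OF T] by auto
      then have "z \<in> R" using yz(2) sp by (simp add: R_def orthogonal_def)
      then show ?thesis using yz sp by auto
    qed
    have "R \<noteq> {0}" using dec[OF x(1)] x(2) by auto
    then obtain u \<mu> where u: "u \<in> R" "u \<noteq> 0" "\<mu> \<ge> 0" "\<And>w. w \<in> R \<Longrightarrow> A u \<bullet> A w = \<mu> * (u \<bullet> w)"
      using singular_vector_exists[OF A R] by blast
    have uT: "u \<in> T" and u0: "\<And>w. w \<in> U \<Longrightarrow> u \<bullet> w = 0" using u(1) by (auto simp: R_def)
    \<comment> \<open>\<open>A u\<close> is orthogonal to the image of \<open>U\<close>, so the
      relation known for \<open>w\<close> in \<open>R\<close> extends to all of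
      \<open>T\<close>.\<close>
    have "A u \<bullet> A w = 0" if "w \<in> U" for w
    proof -
      have "subspace {w. A u \<bullet> A w = 0}"
        unfolding subspace_def by (auto simp: linear_0[OF A] linear_add[OF A] linear_cmul[OF A] inner_add_right)
      moreover have "BV \<union> BH \<subseteq> {w. A u \<bullet> A w = 0}"
        using V0 BV(1) Hw[OF _ uT] u0 HU BH(1) by (auto simp: inner_commute subset_iff)
      ultimately have "U \<subseteq> {w. A u \<bullet> A w = 0}" unfolding U_def by (rule span_minimal[rotated])
      then show ?thesis using that by blast
    qed
    then have "A u \<bullet> A w = \<mu> * (u \<bullet> w)" if "w \<in> T" for w
      using dec[OF that] u(4) u0 by (auto simp: linear_add[OF A] inner_add_right)
    then have us: "u \<in> singular_space T A (sqrt \<mu>)" using uT u(3) by (simp add: singular_space_def)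
    then have "\<not> singular_space T A (sqrt \<mu>) \<subseteq> {0}" using u(2) by blast
    then have "sqrt \<mu> \<in> singular_values T A"
      using u(3) by (simp add: singular_values_def singular_multiplicity_def zero_less_iff_neq_zero dim_eq_0)
    then have "sqrt \<mu> = 0 \<or> sqrt \<mu> = lam" using sv by blast
    then have "u \<in> V \<or> u \<in> H" using us V_def H_def by metis
    then have "u \<bullet> u = 0" using u0 VU HU by blast
    then show False using u(2) by simp
  qed
  have cross: "v \<bullet> h = 0" "h \<bullet> v = 0" if "v \<in> BV" "h \<in> BH" for v h
    using VH[OF subsetD[OF BV(1) that(1)] subsetD[OF BH(1) that(2)]] by (simp_all add: inner_commute)
  have orth: "orthonormal_basis T (BV \<union> BH)"
    unfolding orthonormal_basis_def
  proof (intro conjI ballI)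
    show "pairwise orthogonal (BV \<union> BH)"
      using BV(2) BH(2) cross unfolding pairwise_def orthogonal_def by auto
    show "span (BV \<union> BH) = T" using \<open>U = T\<close> U_def by simp
  qed (use BV(3) BH(3) in auto)
  have disj: "BV \<inter> BH = {}"
  proof (rule ccontr)
    assume "BV \<inter> BH \<noteq> {}"
    then obtain b where "b \<in> BV" "b \<in> BH" by blast
    then have "b \<bullet> b = 0" "norm b = 1" using cross BV(3) by metis+
    then show False by (simp add: norm_eq_1)
  qed
  have "card (BV \<union> BH) = dim T"
    using dim_span_eq_card_independent[OF orthonormal_basis_finite(2)[OF orth]] \<open>U = T\<close>
    unfolding U_def by (simp only:)
  then have cards: "card BV + card BH = dim T"
    using disj orthonormal_basis_finite(1)[OF orth] by (simp add: card_Un_disjoint)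
  have "A v = 0" if "v \<in> BV" for v by (rule V0[OF subsetD[OF BV(1) that]])
  moreover have "A h \<bullet> A w = lam\<^sup>2 * (h \<bullet> w)" if "h \<in> BH" "w \<in> T" for h w
    by (rule Hw[OF subsetD[OF BH(1) that(1)] that(2)])
  moreover have "card BH = singular_multiplicity T A lam" using BH(4) by (simp add: H_def singular_multiplicity_def)
  ultimately show thesis using that[OF orth disj] cards lam by presburger
qed

section \<open>Maps of spheres with equal singular values\<close>

lemma Basis_expand_linear:
  assumes "linear L" shows "(\<Sum>b\<in>Basis. (u \<bullet> b) *\<^sub>R L b) = L (u::'a::euclidean_space)"
proof -
  have "L u = L (\<Sum>b\<in>Basis. (u \<bullet> b) *\<^sub>R b)" by (simp add: euclidean_representation)
  also have "\<dots> = (\<Sum>b\<in>Basis. (u \<bullet> b) *\<^sub>R L b)" by (simp only: linear_sum[OF assms] linear_cmul[OF assms])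
  finally show ?thesis by simp
qed

locale sphere_extension =
  fixes F :: "'a::euclidean_space \<Rightarrow> 'b::euclidean_space"
  assumes smooth: "smooth_on (-{0}) F"
    and unit: "\<And>y. y \<noteq> 0 \<Longrightarrow> norm (F y) = 1"
    and homogeneous: "\<And>y c. y \<noteq> 0 \<Longrightarrow> c > 0 \<Longrightarrow> F (c *\<^sub>R y) = F y"
begin

abbreviation D :: "'a \<Rightarrow> 'a \<Rightarrow> 'b" where "D \<equiv> dir_deriv F"
abbreviation DD :: "'a \<Rightarrow> 'a \<Rightarrow> 'a \<Rightarrow> 'b" where "DD u v \<equiv> dir_deriv (dir_deriv F v) u"

lemma open_punctured: "open (-{0::'a})"
  by (rule open_Compl) (rule closed_singleton)

lemma F_inner: "y \<noteq> 0 \<Longrightarrow> F y \<bullet> F y = 1"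
  using unit[of y] by (simp add: norm_eq_1)

lemma F_deriv: "y \<noteq> 0 \<Longrightarrow> (F has_derivative (\<lambda>v. D v y)) (at y)"
  by (rule dir_deriv_has_derivative[OF smooth open_punctured]) simp

lemma D_deriv: "y \<noteq> 0 \<Longrightarrow> (D v has_derivative (\<lambda>u. DD u v y)) (at y)"
  by (rule dir_deriv_has_derivative[OF smooth_on_dir_deriv[OF smooth] open_punctured]) simp

lemma linear_D: "y \<noteq> 0 \<Longrightarrow> linear (\<lambda>v. D v y)"
  by (rule has_derivative_linear[OF F_deriv])

lemma linear_DD: "y \<noteq> 0 \<Longrightarrow> linear (\<lambda>u. DD u v y)"
  by (rule has_derivative_linear[OF D_deriv])

lemma DD_commute: "y \<noteq> 0 \<Longrightarrow> DD u v y = DD v u y"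
  by (rule dir_deriv_commute[OF smooth open_punctured]) simp

text \<open>Linearity in the direction taken first is inherited from the other slot by
  symmetry.\<close>

lemma linear_DD2: "y \<noteq> 0 \<Longrightarrow> linear (\<lambda>v. DD u v y)"
  using linear_DD[of y u] by (simp add: DD_commute[of y u])

text \<open>Differentiating \<open>F (c *\<^sub>R z) = F z\<close> makes the first derivative
  homogeneous of degree -1; repeating this gives degree -2 for \<open>DD\<close>.\<close>

lemma D_scale:
  assumes "y \<noteq> 0" "c > 0" shows "D v (c *\<^sub>R y) = D v y /\<^sub>R c"
proof -
  have cy: "c *\<^sub>R y \<noteq> 0" using assms by simp
  have l: "((\<lambda>z. c *\<^sub>R z) has_derivative (\<lambda>h. c *\<^sub>R h)) (at y)" by (auto intro!: derivative_eq_intros)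
  have 1: "((\<lambda>z. F (c *\<^sub>R z)) has_derivative (\<lambda>h. D (c *\<^sub>R h) (c *\<^sub>R y))) (at y)"
    by (rule has_derivative_compose[OF l F_deriv[OF cy]])
  have 2: "((\<lambda>z. F (c *\<^sub>R z)) has_derivative (\<lambda>v. D v y)) (at y)"
    by (rule has_derivative_transform_within_open[OF F_deriv[OF assms(1)] open_punctured])
       (use assms homogeneous in auto)
  have "(\<lambda>h. D (c *\<^sub>R h) (c *\<^sub>R y)) = (\<lambda>v. D v y)" by (rule has_derivative_unique[OF 1 2])
  then have "D (c *\<^sub>R v) (c *\<^sub>R y) = D v y" by (rule fun_cong)
  then have "c *\<^sub>R D v (c *\<^sub>R y) = D v y" using linear_cmul[OF linear_D[OF cy], of c v] by simp
  then have "inverse c *\<^sub>R c *\<^sub>R D v (c *\<^sub>R y) = inverse c *\<^sub>R D v y" by simp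
  then show ?thesis using assms(2) by simp
qed

lemma DD_scale:
  assumes "y \<noteq> 0" "c > 0" shows "DD u v (c *\<^sub>R y) = DD u v y /\<^sub>R c\<^sup>2"
proof -
  have cy: "c *\<^sub>R y \<noteq> 0" using assms by simp
  have l: "((\<lambda>z. c *\<^sub>R z) has_derivative (\<lambda>h. c *\<^sub>R h)) (at y)" by (auto intro!: derivative_eq_intros)
  have 1: "((\<lambda>z. D v (c *\<^sub>R z)) has_derivative (\<lambda>h. DD (c *\<^sub>R h) v (c *\<^sub>R y))) (at y)"
    by (rule has_derivative_compose[OF l D_deriv[OF cy]])
  have s: "((\<lambda>z. D v z /\<^sub>R c) has_derivative (\<lambda>u. DD u v y /\<^sub>R c)) (at y)"
    by (rule has_derivative_scaleR_right[OF D_deriv[OF assms(1)]])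
  have 2: "((\<lambda>z. D v (c *\<^sub>R z)) has_derivative (\<lambda>u. DD u v y /\<^sub>R c)) (at y)"
    by (rule has_derivative_transform_within_open[OF s open_punctured])
       (use assms D_scale in auto)
  have "(\<lambda>h. DD (c *\<^sub>R h) v (c *\<^sub>R y)) = (\<lambda>u. DD u v y /\<^sub>R c)" by (rule has_derivative_unique[OF 1 2])
  then have "DD (c *\<^sub>R u) v (c *\<^sub>R y) = DD u v y /\<^sub>R c" by (rule fun_cong)
  then have "c *\<^sub>R DD u v (c *\<^sub>R y) = DD u v y /\<^sub>R c" using linear_cmul[OF linear_DD[OF cy], of v c u] by simp
  then have "inverse c *\<^sub>R c *\<^sub>R DD u v (c *\<^sub>R y) = inverse c *\<^sub>R (DD u v y /\<^sub>R c)" by simp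
  then show ?thesis using assms(2) by (simp add: power2_eq_square)
qed

lemma radial_line:
  fixes y :: 'a
  shows "y + t *\<^sub>R y = (1 + t) *\<^sub>R y"
  by (simp add: algebra_simps)

lemma D_radial: assumes "y \<noteq> 0" shows "D y y = 0"
proof -
  have 1: "((\<lambda>t. F (y + t *\<^sub>R y)) has_vector_derivative D y (y + 0 *\<^sub>R y)) (at 0)"
    by (rule dir_deriv_line[OF smooth open_punctured]) (use assms in simp)
  have 2: "((\<lambda>t. F (y + t *\<^sub>R y)) has_vector_derivative 0) (at 0)"
  \<comment> \<open>On this parameter set 1 + t is positive, so homogeneity applies.\<close>
  proof (rule has_vector_derivative_transform_within_open[of "\<lambda>t. F y" 0 0 "{-1<..}"])
    show "F y = F (y + t *\<^sub>R y)" if "t \<in> {-1<..}" for t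
      using that assms homogeneous[of y "1 + t"] by (simp add: radial_line)
  qed auto
  show ?thesis using vector_derivative_unique_at[OF 1 2] by simp
qed

lemma DD_radial: assumes "y \<noteq> 0" shows "DD y y y = 0"
proof -
  have 1: "((\<lambda>t. D y (y + t *\<^sub>R y)) has_vector_derivative DD y y (y + 0 *\<^sub>R y)) (at 0)"
    by (rule dir_deriv_line[OF smooth_on_dir_deriv[OF smooth] open_punctured]) (use assms in simp)
  have 2: "((\<lambda>t. D y (y + t *\<^sub>R y)) has_vector_derivative 0) (at 0)"
  proof (rule has_vector_derivative_transform_within_open[of "\<lambda>t. 0" 0 0 "{-1<..}"])
    show "0 = D y (y + t *\<^sub>R y)" if "t \<in> {-1<..}" for t
      using that assms D_scale[of y "1 + t" y] by (simp add: radial_line D_radial)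
  qed auto
  show ?thesis using vector_derivative_unique_at[OF 1 2] by simp
qed

lemma D_inner_F: assumes "y \<noteq> 0" shows "D v y \<bullet> F y = 0"
proof -
  have 1: "((\<lambda>z. F z \<bullet> F z) has_derivative (\<lambda>h. F y \<bullet> D h y + D h y \<bullet> F y)) (at y)"
    by (rule bounded_bilinear.FDERIV[OF bounded_bilinear_inner F_deriv F_deriv]) (rule assms)+
  have 2: "((\<lambda>z. F z \<bullet> F z) has_derivative (\<lambda>h. 0)) (at y)"
    by (rule has_derivative_transform_within_open[OF has_derivative_const[of 1] open_punctured])
       (use assms F_inner in auto)
  show ?thesis using fun_cong[OF has_derivative_unique[OF 1 2], of v] by (simp add: inner_commute)
qed

text \<open>Differentiates \<open>D v z \<bullet> F z = 0\<close>, itself the derivative of |F|^2 =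
  1. It supplies the components of both traces along \<open>F\<close>.\<close>

lemma DD_inner_F: assumes "y \<noteq> 0" shows "DD u v y \<bullet> F y = - (D u y \<bullet> D v y)"
proof -
  have 1: "((\<lambda>z. D v z \<bullet> F z) has_derivative (\<lambda>h. D v y \<bullet> D h y + DD h v y \<bullet> F y)) (at y)"
    by (rule bounded_bilinear.FDERIV[OF bounded_bilinear_inner D_deriv F_deriv]) (rule assms)+
  have 2: "((\<lambda>z. D v z \<bullet> F z) has_derivative (\<lambda>h. 0)) (at y)"
    by (rule has_derivative_transform_within_open[OF has_derivative_const[of 0] open_punctured])
       (use assms D_inner_F in auto)
  show ?thesis using fun_cong[OF has_derivative_unique[OF 1 2], of u] by (simp add: inner_commute)
qed

end

text \<open>An orthonormal frame of the tangent hyperplane at \<open>y\<close>, split into kernel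
  and complement. The singular value at \<open>y\<close> is lam / |y| because \<open>D\<close> has
  degree -1 for a map constant on rays. The relation for \<open>BH\<close> can be asked of every
  \<open>w\<close>, as radial \<open>w\<close> contribute 0 to both sides. The last equation says
  card BV = n - p.\<close>

definition singular_frame ::
    "('a::euclidean_space \<Rightarrow> 'b::euclidean_space) \<Rightarrow> real \<Rightarrow> nat \<Rightarrow> 'a \<Rightarrow> 'a set \<Rightarrow> 'a set \<Rightarrow> bool" where
  "singular_frame F lam p y BV BH \<longleftrightarrow>
     orthonormal_basis {u. y \<bullet> u = 0} (BV \<union> BH) \<and> BV \<inter> BH = {} \<and> (\<forall>v\<in>BV. dir_deriv F v y = 0) \<and>
     (\<forall>h\<in>BH. \<forall>w. dir_deriv F h y \<bullet> dir_deriv F w y = lam\<^sup>2 / (norm y)\<^sup>2 * (h \<bullet> w)) \<and>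
     card BH = p \<and> card BV + p + 1 = DIM('a)"

locale equal_singular_values = sphere_extension F
  for F :: "'a::euclidean_space \<Rightarrow> 'b::euclidean_space" +
  fixes lam :: real and p :: nat
  assumes frame_unit: "\<And>x. norm x = 1 \<Longrightarrow> \<exists>BV BH. singular_frame F lam p x BV BH"
    and lam_pos: "lam > 0"
begin

lemma frame_scale:
  assumes y: "y \<noteq> 0" and c: "c > 0" and f: "singular_frame F lam p y BV BH"
  shows "singular_frame F lam p (c *\<^sub>R y) BV BH"
  using f c unfolding singular_frame_def
  by (simp add: D_scale[OF y c] field_simps power2_eq_square)

lemma frame_exists:
  assumes "y \<noteq> 0" shows "\<exists>BV BH. singular_frame F lam p y BV BH"
proof -
  obtain BV BH where f: "singular_frame F lam p (y /\<^sub>R norm y) BV BH"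
    using frame_unit[of "y /\<^sub>R norm y"] assms by auto
  have "singular_frame F lam p (norm y *\<^sub>R (y /\<^sub>R norm y)) BV BH"
    by (rule frame_scale[OF _ _ f]) (use assms in auto)
  then show ?thesis using assms by auto
qed

text \<open>Reduces a linear condition on all vectors to the radial vector and the frame.\<close>

lemma frame_decompose:
  assumes y: "y \<noteq> 0" and f: "singular_frame F lam p y BV BH"
    and S: "subspace S" "y \<in> S" "BV \<subseteq> S" "BH \<subseteq> S"
  shows "a \<in> S"
proof -
  define u where "u = a - ((a \<bullet> y) / (y \<bullet> y)) *\<^sub>R y"
  have "y \<bullet> u = 0" using y by (simp add: u_def inner_diff_right inner_commute)
  then have "u \<in> span (BV \<union> BH)" using f unfolding singular_frame_def orthonormal_basis_def by blast
  moreover have "span (BV \<union> BH) \<subseteq> S" using S by (intro span_minimal) auto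
  ultimately have "u + ((a \<bullet> y) / (y \<bullet> y)) *\<^sub>R y \<in> S" using S(1,2) by (intro subspace_add subspace_mul) auto
  then show ?thesis by (simp add: u_def)
qed

text \<open>The singular value condition in a form that can be differentiated without choosing a smooth
  frame of the kernel distribution.\<close>

lemma D_adjoint_D:
  assumes y: "y \<noteq> 0"
  shows "(y \<bullet> y) *\<^sub>R (\<Sum>b\<in>Basis. (D a y \<bullet> D b y) *\<^sub>R D b y) = lam\<^sup>2 *\<^sub>R D a y"
proof -
  note l = linear_D[OF y]
  obtain BV BH where f: "singular_frame F lam p y BV BH" using frame_exists[OF y] by blast
  let ?S = "{a. (y \<bullet> y) *\<^sub>R (\<Sum>b\<in>Basis. (D a y \<bullet> D b y) *\<^sub>R D b y) = lam\<^sup>2 *\<^sub>R D a y}"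
  have "a \<in> ?S"
  proof (rule frame_decompose[OF y f])
    show "subspace ?S" unfolding subspace_def
    proof (intro conjI ballI allI; clarsimp)
      show "(y \<bullet> y) *\<^sub>R (\<Sum>b\<in>Basis. (D 0 y \<bullet> D b y) *\<^sub>R D b y) = lam\<^sup>2 *\<^sub>R D 0 y"
        using linear_0[OF l] by simp
    next
      fix a b assume h: "(y \<bullet> y) *\<^sub>R (\<Sum>b\<in>Basis. (D a y \<bullet> D b y) *\<^sub>R D b y) = lam\<^sup>2 *\<^sub>R D a y"
        "(y \<bullet> y) *\<^sub>R (\<Sum>ba\<in>Basis. (D b y \<bullet> D ba y) *\<^sub>R D ba y) = lam\<^sup>2 *\<^sub>R D b y"
      show "(y \<bullet> y) *\<^sub>R (\<Sum>ba\<in>Basis. (D (a + b) y \<bullet> D ba y) *\<^sub>R D ba y) = lam\<^sup>2 *\<^sub>R D (a + b) y"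
        using h linear_add[OF l, of a b] by (simp add: inner_add_left scaleR_add_left sum.distrib scaleR_add_right)
    next
      fix c a assume h: "(y \<bullet> y) *\<^sub>R (\<Sum>b\<in>Basis. (D a y \<bullet> D b y) *\<^sub>R D b y) = lam\<^sup>2 *\<^sub>R D a y"
      have "(\<Sum>b\<in>Basis. (D (c *\<^sub>R a) y \<bullet> D b y) *\<^sub>R D b y) = c *\<^sub>R (\<Sum>b\<in>Basis. (D a y \<bullet> D b y) *\<^sub>R D b y)"
        using linear_cmul[OF l, of c a] by (simp add: scaleR_sum_right)
      then have "(y \<bullet> y) *\<^sub>R (\<Sum>b\<in>Basis. (D (c *\<^sub>R a) y \<bullet> D b y) *\<^sub>R D b y)
          = c *\<^sub>R ((y \<bullet> y) *\<^sub>R (\<Sum>b\<in>Basis. (D a y \<bullet> D b y) *\<^sub>R D b y))"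
        by (simp only: scaleR_left_commute)
      then show "(y \<bullet> y) *\<^sub>R (\<Sum>b\<in>Basis. (D (c *\<^sub>R a) y \<bullet> D b y) *\<^sub>R D b y) = lam\<^sup>2 *\<^sub>R D (c *\<^sub>R a) y"
        using linear_cmul[OF l, of c a] h by (simp only: scaleR_left_commute)
    qed
    show "y \<in> ?S" by (simp add: D_radial[OF y])
    show "BV \<subseteq> ?S" using f by (auto simp: singular_frame_def)
    show "BH \<subseteq> ?S"
    proof
      fix h assume "h \<in> BH"
      then have h: "D h y \<bullet> D w y = lam\<^sup>2 / (norm y)\<^sup>2 * (h \<bullet> w)" for w using f by (simp add: singular_frame_def)
      have e: "(\<Sum>b\<in>Basis. (h \<bullet> b) *\<^sub>R D b y) = D h y" by (rule Basis_expand_linear[OF l])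
      \<comment> \<open>On \<open>BH\<close> the map d* d is multiplication by lam^2 /
        |y|^2.\<close>
      have "(\<Sum>b\<in>Basis. (D h y \<bullet> D b y) *\<^sub>R D b y) = (lam\<^sup>2 / (norm y)\<^sup>2) *\<^sub>R (\<Sum>b\<in>Basis. (h \<bullet> b) *\<^sub>R D b y)"
        by (simp add: h scaleR_sum_right)
      then show "h \<in> ?S" using y by (simp add: e dot_square_norm)
    qed
  qed
  then show ?thesis by blast
qed

text \<open>\<open>a\<close> is a fixed vector, so only \<open>D\<close> is differentiated; for
  tangent \<open>e\<close> the factor \<open>y \<bullet> y\<close> is stationary and drops
  out.\<close>

lemma D_adjoint_D_deriv:
  assumes y: "y \<noteq> 0" and e: "y \<bullet> e = 0"
  shows "(y \<bullet> y) *\<^sub>R (\<Sum>b\<in>Basis. (DD e a y \<bullet> D b y + D a y \<bullet> DD e b y) *\<^sub>R D b y + (D a y \<bullet> D b y) *\<^sub>R DD e b y)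
    = lam\<^sup>2 *\<^sub>R DD e a y"
proof -
  note d = D_deriv[OF y]
  have 1: "((\<lambda>z. (z \<bullet> z) *\<^sub>R (\<Sum>b\<in>Basis. (D a z \<bullet> D b z) *\<^sub>R D b z)) has_derivative
     (\<lambda>h. (y \<bullet> y) *\<^sub>R (\<Sum>b\<in>Basis. (D a y \<bullet> D b y) *\<^sub>R DD h b y + (D a y \<bullet> DD h b y + DD h a y \<bullet> D b y) *\<^sub>R D b y)
        + (y \<bullet> h + h \<bullet> y) *\<^sub>R (\<Sum>b\<in>Basis. (D a y \<bullet> D b y) *\<^sub>R D b y))) (at y)"
    by (intro has_derivative_scaleR has_derivative_sum has_derivative_inner has_derivative_ident d)
  have s: "((\<lambda>z. lam\<^sup>2 *\<^sub>R D a z) has_derivative (\<lambda>h. lam\<^sup>2 *\<^sub>R DD h a y)) (at y)"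
    by (rule has_derivative_scaleR_right[OF d])
  have 2: "((\<lambda>z. (z \<bullet> z) *\<^sub>R (\<Sum>b\<in>Basis. (D a z \<bullet> D b z) *\<^sub>R D b z)) has_derivative (\<lambda>h. lam\<^sup>2 *\<^sub>R DD h a y)) (at y)"
    by (rule has_derivative_transform_within_open[OF s open_punctured]) (use y D_adjoint_D in auto)
  show ?thesis using fun_cong[OF has_derivative_unique[OF 1 2], of e] e
    by (simp add: inner_commute[of e y] add.commute)
qed

section \<open>Traces of the second derivative over the kernel and its complement\<close>

context
  fixes y :: 'a and BV BH :: "'a set"
  assumes y: "y \<noteq> 0" and fr: "singular_frame F lam p y BV BH"
begin

lemma frame_orth: "b \<in> BV \<union> BH \<Longrightarrow> y \<bullet> b = 0" "b \<in> BV \<union> BH \<Longrightarrow> b \<bullet> b = 1"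
  using fr orthonormal_basis_subset[of "{u. y \<bullet> u = 0}" "BV \<union> BH"]
  unfolding singular_frame_def orthonormal_basis_def by (auto simp: norm_eq_1)

lemma frame_V: "v \<in> BV \<Longrightarrow> D v y = 0" using fr by (simp add: singular_frame_def)

lemma frame_H: "h \<in> BH \<Longrightarrow> D h y \<bullet> D w y = lam\<^sup>2 / (norm y)\<^sup>2 * (h \<bullet> w)" using fr by (simp add: singular_frame_def)

lemma frame_finite: "finite BV" "finite BH"
  using fr orthonormal_basis_finite(1) unfolding singular_frame_def by blast+

text \<open>With both directions equal to \<open>v\<close>, every term containing
  \<open>D v y\<close> vanishes. What remains exhibits \<open>DD v v y\<close> as a combination of
  the vectors \<open>D b y\<close>, hence in the image of d.\<close>

lemma DD_V_image:
  assumes "v \<in> BV"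
  shows "(y \<bullet> y) *\<^sub>R (\<Sum>b\<in>Basis. (DD v v y \<bullet> D b y) *\<^sub>R D b y) = lam\<^sup>2 *\<^sub>R DD v v y"
  using D_adjoint_D_deriv[OF y, of v v] frame_orth(1)[of v] assms by (simp add: frame_V)

text \<open>Pairing the differentiated identity with \<open>D k y\<close> gives x = 2 x + z after
  division by lam^2, where x and z are the two summands of the claim.\<close>

lemma DD_H_skew:
  assumes e: "e \<in> BH" and h: "h \<in> BH" and k: "k \<in> BH"
  shows "DD e h y \<bullet> D k y + D h y \<bullet> DD e k y = 0"
proof -
  define q where "q = lam\<^sup>2 / (norm y)\<^sup>2"
  have q: "q > 0" using lam_pos y by (simp add: q_def)
  have yq: "(y \<bullet> y) * q = lam\<^sup>2" using y by (simp add: q_def dot_square_norm)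
  have Hq: "D b y \<bullet> D k y = q * (k \<bullet> b)" "D h y \<bullet> D b y = q * (h \<bullet> b)" for b
    using frame_H[OF k, of b] frame_H[OF h, of b] by (simp_all add: q_def inner_commute)
  have "(y \<bullet> e) = 0" using frame_orth(1) e by blast
  from arg_cong[OF D_adjoint_D_deriv[OF y this, of h], of "\<lambda>z. z \<bullet> D k y"]
  have "lam\<^sup>2 * (DD e h y \<bullet> D k y) = (y \<bullet> y) *
      (\<Sum>b\<in>Basis. ((DD e h y \<bullet> D b y + D h y \<bullet> DD e b y) *\<^sub>R D b y + (D h y \<bullet> D b y) *\<^sub>R DD e b y) \<bullet> D k y)"
    unfolding inner_scaleR_left inner_sum_left by simp
  also have "(\<Sum>b\<in>Basis. ((DD e h y \<bullet> D b y + D h y \<bullet> DD e b y) *\<^sub>R D b y + (D h y \<bullet> D b y) *\<^sub>R DD e b y) \<bullet> D k y)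
     = (\<Sum>b\<in>Basis. q * (DD e h y \<bullet> ((k \<bullet> b) *\<^sub>R D b y) + D h y \<bullet> ((k \<bullet> b) *\<^sub>R DD e b y)
          + ((h \<bullet> b) *\<^sub>R DD e b y) \<bullet> D k y))"
    unfolding inner_add_left inner_scaleR_left inner_scaleR_right Hq
    by (intro sum.cong refl) algebra
  also have "\<dots> = q * (DD e h y \<bullet> (\<Sum>b\<in>Basis. (k \<bullet> b) *\<^sub>R D b y) + D h y \<bullet> (\<Sum>b\<in>Basis. (k \<bullet> b) *\<^sub>R DD e b y)
       + (\<Sum>b\<in>Basis. (h \<bullet> b) *\<^sub>R DD e b y) \<bullet> D k y)"
    by (simp only: sum_distrib_left[symmetric] sum.distrib inner_sum_left inner_sum_right)
  also have "\<dots> = q * (DD e h y \<bullet> D k y + D h y \<bullet> DD e k y + DD e h y \<bullet> D k y)"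
    by (simp add: Basis_expand_linear[OF linear_D[OF y]] Basis_expand_linear[OF linear_DD2[OF y]])
  finally have "lam\<^sup>2 * (DD e h y \<bullet> D k y) = lam\<^sup>2 * (DD e h y \<bullet> D k y + D h y \<bullet> DD e k y + DD e h y \<bullet> D k y)"
    by (simp only: mult.assoc[symmetric] yq)
  then show ?thesis using lam_pos by simp
qed

text \<open>On \<open>BH\<close> the form \<open>DD e h y \<bullet> D k y\<close> is symmetric in
  \<open>e\<close>, \<open>h\<close> and skew in \<open>h\<close>, \<open>k\<close>; exchanging
  arguments makes it vanish for e = h. The other directions \<open>a\<close> lie in the kernel of
  d.\<close>

lemma DD_H_orthogonal:
  assumes h: "h \<in> BH" shows "DD h h y \<bullet> D a y = 0"
proof -
  have "a \<in> {a. DD h h y \<bullet> D a y = 0}"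
  proof (rule frame_decompose[OF y fr])
    show "subspace {a. DD h h y \<bullet> D a y = 0}"
      unfolding subspace_def
      by (simp add: linear_0[OF linear_D[OF y]] linear_add[OF linear_D[OF y]] linear_cmul[OF linear_D[OF y]] inner_add_right)
    show "y \<in> {a. DD h h y \<bullet> D a y = 0}" by (simp add: D_radial[OF y])
    show "BV \<subseteq> {a. DD h h y \<bullet> D a y = 0}" by (auto simp: frame_V)
    show "BH \<subseteq> {a. DD h h y \<bullet> D a y = 0}"
    proof
      fix k assume k: "k \<in> BH"
      have "DD h h y \<bullet> D k y = - (D h y \<bullet> DD h k y)" using DD_H_skew[OF h h k] by simp
      moreover have "D h y \<bullet> DD k h y = 0" using DD_H_skew[OF k h h] by (simp add: inner_commute)
      ultimately show "k \<in> {a. DD h h y \<bullet> D a y = 0}" by (simp add: DD_commute[OF y, of h k])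
    qed
  qed
  then show ?thesis by blast
qed

text \<open>Holds term by term: by \<open>DD_V_image\<close> each \<open>DD v v y\<close> is a
  combination of vectors \<open>D b y\<close>, and these are orthogonal to every
  \<open>DD h h y\<close>.\<close>

lemma frame_trace_orthogonal: "(\<Sum>v\<in>BV. DD v v y) \<bullet> (\<Sum>h\<in>BH. DD h h y) = 0"
proof -
  have "DD v v y \<bullet> DD h h y = 0" if v: "v \<in> BV" and h: "h \<in> BH" for v h
  proof -
    have "lam\<^sup>2 * (DD v v y \<bullet> DD h h y) = ((y \<bullet> y) *\<^sub>R (\<Sum>b\<in>Basis. (DD v v y \<bullet> D b y) *\<^sub>R D b y)) \<bullet> DD h h y"
      by (simp add: DD_V_image[OF v])
    also have "\<dots> = 0" using DD_H_orthogonal[OF h] by (simp add: inner_sum_left inner_commute[of "D _ y" "DD h h y"])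
    finally show ?thesis using lam_pos by simp
  qed
  then show ?thesis by (simp add: inner_sum_left inner_sum_right)
qed

lemma frame_trace_F:
  "(\<Sum>v\<in>BV. DD v v y) \<bullet> F y = 0" "(\<Sum>h\<in>BH. DD h h y) \<bullet> F y = - (real p * lam\<^sup>2 / (norm y)\<^sup>2)"
proof -
  show "(\<Sum>v\<in>BV. DD v v y) \<bullet> F y = 0" by (simp add: inner_sum_left DD_inner_F[OF y] frame_V)
  have "(\<Sum>h\<in>BH. DD h h y) \<bullet> F y = (\<Sum>h\<in>BH. - (lam\<^sup>2 / (norm y)\<^sup>2))"
    using frame_orth(2) by (simp add: inner_sum_left DD_inner_F[OF y] frame_H)
  also have "\<dots> = - (real p * lam\<^sup>2 / (norm y)\<^sup>2)" using fr by (simp add: singular_frame_def)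
  finally show "(\<Sum>h\<in>BH. DD h h y) \<bullet> F y = - (real p * lam\<^sup>2 / (norm y)\<^sup>2)" .
qed

text \<open>Pairing with the first sum leaves only its square. The equation then makes the second
  sum a multiple of \<open>F y\<close>, and the multiple is read off from
  \<open>frame_trace_F\<close>, so neither scalar appears in the result.\<close>

lemma frame_traces:
  assumes eq: "\<alpha> *\<^sub>R F y + (\<Sum>v\<in>BV. DD v v y) + \<kappa> *\<^sub>R (\<Sum>h\<in>BH. DD h h y) = 0" and "\<kappa> \<noteq> 0"
  shows "(\<Sum>v\<in>BV. DD v v y) = 0" "(\<Sum>h\<in>BH. DD h h y) = - (real p * lam\<^sup>2 / (norm y)\<^sup>2) *\<^sub>R F y"
proof -
  let ?A = "\<Sum>v\<in>BV. DD v v y" and ?B = "\<Sum>h\<in>BH. DD h h y"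
  have "(\<alpha> *\<^sub>R F y + ?A + \<kappa> *\<^sub>R ?B) \<bullet> ?A = 0" using eq by simp
  then have "?A \<bullet> ?A = 0"
    unfolding inner_add_left inner_scaleR_left
    unfolding inner_commute[of "F y" ?A] inner_commute[of ?B ?A]
    using frame_trace_orthogonal frame_trace_F(1) by simp
  then show A: "?A = 0" by simp
  define \<beta> where "\<beta> = - \<alpha> / \<kappa>"
  have "\<kappa> *\<^sub>R ?B = (- \<alpha>) *\<^sub>R F y" using eq A by (simp add: add_eq_0_iff)
  then have "inverse \<kappa> *\<^sub>R \<kappa> *\<^sub>R ?B = inverse \<kappa> *\<^sub>R (- \<alpha>) *\<^sub>R F y" by simp
  then have B: "?B = \<beta> *\<^sub>R F y" using assms(2) by (simp add: \<beta>_def divide_inverse mult.commute)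
  have "\<beta> = ?B \<bullet> F y" unfolding B using F_inner[OF y] by simp
  then have "\<beta> = - (real p * lam\<^sup>2 / (norm y)\<^sup>2)" by (simp only: frame_trace_F(2))
  then show "?B = - (real p * lam\<^sup>2 / (norm y)\<^sup>2) *\<^sub>R F y" using B by (simp only:)
qed

end

end

section \<open>Graphs\<close>

text \<open>Source of the linear equations for tangent vectors: each pair of ambient maps that agree
  on \<open>M\<close> gives one.\<close>

lemma tangent_derivative_agree:
  assumes "(g has_derivative g') (at x)" "(h has_derivative h') (at x)"
    and "\<And>q. q \<in> M \<Longrightarrow> g q = h q" "x \<in> M" "v \<in> tangent_space M x"
  shows "g' v = h' v"
proof (rule tangent_derivative_unique)
  show "(g has_derivative g') (at x within M)" by (rule has_derivative_at_withinI[OF assms(1)])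
  show "(g has_derivative h') (at x within M)"
    by (rule has_derivative_transform_within[OF has_derivative_at_withinI[OF assms(2)] zero_less_one assms(4)])
       (use assms(3) in simp)
qed (rule assms(5))

lemma smooth_on_imp_smooth_map_on:
  assumes "smooth_on W V" "open W" "M \<subseteq> W"
  shows "smooth_map_on M V"
  unfolding smooth_map_on_def
proof
  fix x assume "x \<in> M"
  then have "open W \<and> x \<in> W \<and> smooth_on W V \<and> (\<forall>y\<in>M \<inter> W. V y = V y)" using assms by auto
  then show "\<exists>W F. open W \<and> x \<in> W \<and> smooth_on W F \<and> (\<forall>y\<in>M \<inter> W. V y = F y)" by (intro exI)
qed

lemma tangent_field_nearI:
  assumes "smooth_on W V" "open W" "M \<subseteq> W" "\<And>q. q \<in> M \<Longrightarrow> V q \<in> tangent_space M q"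
  shows "tangent_field_near M p V"
proof -
  have "smooth_map_on (M \<inter> UNIV) V" using smooth_on_imp_smooth_map_on[OF assms(1-3)] by simp
  then show ?thesis unfolding tangent_field_near_def using assms(4) by (intro exI[of _ UNIV]) simp
qed

text \<open>The sum is the adjoint of \<open>L\<close> at \<open>w\<close>, written in coordinates;
  normal vectors to graphs are built from it.\<close>

lemma inner_adjoint_sum:
  fixes L :: "'a::euclidean_space \<Rightarrow> 'b::euclidean_space"
  assumes "linear L"
  shows "u \<bullet> (\<Sum>b\<in>Basis. (w \<bullet> L b) *\<^sub>R b) = w \<bullet> L u"
proof -
  have "u \<bullet> (\<Sum>b\<in>Basis. (w \<bullet> L b) *\<^sub>R b) = w \<bullet> (\<Sum>b\<in>Basis. (u \<bullet> b) *\<^sub>R L b)"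
    by (simp add: inner_sum_right mult.commute)
  then show ?thesis by (simp only: Basis_expand_linear[OF assms])
qed

text \<open>The lifts \<open>(b, L b)\<close> are orthogonal of squared length 1 + \<mu> b, because
  \<open>B\<close> diagonalises both inner products that add up to the graph metric.\<close>

lemma graph_orthonormal_basis:
  fixes L :: "'a::euclidean_space \<Rightarrow> 'b::euclidean_space"
  assumes B: "orthonormal_basis T B" and L: "linear L"
    and orth: "\<And>b c. b \<in> B \<Longrightarrow> c \<in> B \<Longrightarrow> L b \<bullet> L c = (if b = c then \<mu> b else 0)"
  defines "g \<equiv> \<lambda>b. (1 / sqrt (1 + \<mu> b)) *\<^sub>R (b, L b)"
  shows "orthonormal_basis ((\<lambda>u. (u, L u)) ` T) (g ` B)" "inj_on g B"
    "\<And>b. b \<in> B \<Longrightarrow> \<mu> b \<ge> 0"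
proof -
  show mu: "\<mu> b \<ge> 0" if "b \<in> B" for b using orth[OF that that] by (metis inner_ge_zero)
  have bc: "b \<bullet> c = (if b = c then 1 else 0)" if "b \<in> B" "c \<in> B" for b c
    using B that unfolding orthonormal_basis_def pairwise_def orthogonal_def by (auto simp: norm_eq_1)
  have gg: "g b \<bullet> g c = (if b = c then 1 else 0)" if "b \<in> B" "c \<in> B" for b c
    using mu[OF that(1)] bc[OF that] orth[OF that] by (auto simp: g_def real_sqrt_mult[symmetric] add_divide_distrib[symmetric])
  show inj: "inj_on g B" by (rule inj_onI) (metis gg zero_neq_one)
  have lin: "linear (\<lambda>u. (u, L u))"
    using linear_add[OF L] linear_cmul[OF L] by (intro linearI) simp_all
  have "span (g ` B) = (\<lambda>u. (u, L u)) ` span B"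
  proof -
    have "span (g ` B) = span ((\<lambda>u. (u, L u)) ` B)"
    proof (rule antisym; rule span_minimal)
      show "g ` B \<subseteq> span ((\<lambda>u. (u, L u)) ` B)" unfolding g_def by (intro image_subsetI span_mul span_base) auto
      show "(\<lambda>u. (u, L u)) ` B \<subseteq> span (g ` B)"
      proof (rule image_subsetI)
        fix b assume b: "b \<in> B"
        then have "sqrt (1 + \<mu> b) *\<^sub>R g b \<in> span (g ` B)" by (intro span_mul span_base imageI)
        then show "(b, L b) \<in> span (g ` B)" using mu[OF b] by (simp add: g_def)
      qed
    qed simp_all
    then show ?thesis by (simp add: linear_span_image[OF lin])
  qed
  moreover have "pairwise orthogonal (g ` B)" by (auto simp: pairwise_def orthogonal_def gg)
  moreover have "\<forall>b\<in>g ` B. norm b = 1" by (auto simp: norm_eq_1 gg)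
  ultimately show "orthonormal_basis ((\<lambda>u. (u, L u)) ` T) (g ` B)"
    using B unfolding orthonormal_basis_def by simp
qed

text \<open>The normalising factor of a lift enters twice, which produces the weight 1 / (1 + \<mu>
  b). \<open>T\<close> will be the whole space for graphs over open sets and a hyperplane for graphs
  over spheres.\<close>

lemma mean_curvature_graph_inner:
  fixes L :: "'a::euclidean_space \<Rightarrow> 'b::euclidean_space"
  assumes N: "subspace (tangent_space N p)"
    and T: "tangent_space M p = (\<lambda>u. (u, L u)) ` T" "subspace T"
    and pM: "p \<in> M"
    and ext: "\<And>e. e \<in> tangent_space M p \<Longrightarrow> \<exists>V. tangent_field_near M p V \<and> V p = e"
    and \<nu>0: "\<And>q t. q \<in> M \<Longrightarrow> t \<in> tangent_space M q \<Longrightarrow> t \<bullet> \<nu> q = 0"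
    and \<nu>: "(\<nu> has_derivative \<nu>') (at p)" "\<nu> p \<in> tangent_space N p"
    and B: "orthonormal_basis T B" and L: "linear L"
    and orth: "\<And>b c. b \<in> B \<Longrightarrow> c \<in> B \<Longrightarrow> L b \<bullet> L c = (if b = c then \<mu> b else 0)"
  shows "mean_curvature N M p \<bullet> \<nu> p = - (\<Sum>b\<in>B. ((b, L b) \<bullet> \<nu>' (b, L b)) / (1 + \<mu> b))"
proof -
  define g where "g b = (1 / sqrt (1 + \<mu> b)) *\<^sub>R (b, L b)" for b
  have gb: "orthonormal_basis ((\<lambda>u. (u, L u)) ` T) (g ` B)" "inj_on g B" "\<And>b. b \<in> B \<Longrightarrow> \<mu> b \<ge> 0"
    unfolding g_def by (rule graph_orthonormal_basis[OF B L]; simp add: orth)+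
  have lin: "linear (\<lambda>u. (u, L u))"
    using linear_add[OF L] linear_cmul[OF L] by (intro linearI) simp_all
  have M: "subspace (tangent_space M p)" unfolding T(1) by (rule linear_subspace_image[OF lin T(2)])
  have "mean_curvature N M p \<bullet> \<nu> p = - (\<Sum>e\<in>g ` B. e \<bullet> \<nu>' e)"
    by (rule mean_curvature_inner[OF N M pM ext _ open_UNIV UNIV_I _ \<nu>]) (use gb(1) T(1) \<nu>0 in auto)
  also have "(\<Sum>e\<in>g ` B. e \<bullet> \<nu>' e) = (\<Sum>b\<in>B. g b \<bullet> \<nu>' (g b))" by (simp add: sum.reindex[OF gb(2)])
  also have "\<dots> = (\<Sum>b\<in>B. ((b, L b) \<bullet> \<nu>' (b, L b)) / (1 + \<mu> b))"
  proof (rule sum.cong)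
    fix b assume "b \<in> B"
    then have mu: "\<mu> b \<ge> 0" by (rule gb(3))
    define s where "s = 1 / sqrt (1 + \<mu> b)"
    have "s * s = 1 / (1 + \<mu> b)" using mu by (simp add: s_def real_sqrt_mult[symmetric])
    moreover have "g b \<bullet> \<nu>' (g b) = (s * s) * ((b, L b) \<bullet> \<nu>' (b, L b))"
      unfolding g_def s_def[symmetric] by (simp only: linear_cmul[OF has_derivative_linear[OF \<nu>(1)]] inner_scaleR_left inner_scaleR_right mult.assoc)
    ultimately show "g b \<bullet> \<nu>' (g b) = ((b, L b) \<bullet> \<nu>' (b, L b)) / (1 + \<mu> b)" by simp
  qed simp
  finally show ?thesis .
qed

section \<open>Graphs over open sets\<close>

definition graph_over :: "'a set \<Rightarrow> ('a \<Rightarrow> 'b) \<Rightarrow> ('a \<times> 'b) set" where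
  "graph_over S G = (\<lambda>y. (y, G y)) ` S"

lemma fst_preimage_open: "open S \<Longrightarrow> open {q. fst q \<in> S}"
  by (rule open_vimage_fst[unfolded vimage_def])

lemma smooth_on_fst_compose:
  fixes G :: "'a::euclidean_space \<Rightarrow> 'c::real_normed_vector"
  assumes "open S" "smooth_on S G"
  shows "smooth_on {q :: 'a \<times> 'b::euclidean_space. fst q \<in> S} (\<lambda>q. G (fst q))"
proof (rule smooth_on_compose[OF fst_preimage_open[OF assms(1)] assms(1) _ _ assms(2)])
  show "smooth_on {q :: 'a \<times> 'b. fst q \<in> S} fst"
    by (rule smooth_on_bounded_linear[OF bounded_linear_fst fst_preimage_open[OF assms(1)]])
qed auto

locale smooth_graph =
  fixes S :: "'a::euclidean_space set" and G :: "'a \<Rightarrow> 'b::euclidean_space"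
  assumes S: "open S" and G: "smooth_on S G"
begin

lemma G_deriv: "y \<in> S \<Longrightarrow> (G has_derivative (\<lambda>v. dir_deriv G v y)) (at y)"
  by (rule dir_deriv_has_derivative[OF G S])

lemma linear_dG: "y \<in> S \<Longrightarrow> linear (\<lambda>v. dir_deriv G v y)"
  by (rule has_derivative_linear[OF G_deriv])

lemma dG_deriv: "y \<in> S \<Longrightarrow> (dir_deriv G v has_derivative (\<lambda>u. dir_deriv (dir_deriv G v) u y)) (at y)"
  by (rule dir_deriv_has_derivative[OF smooth_on_dir_deriv[OF G] S])

text \<open>A tangent vector satisfies the linearisation of \<open>snd q = G (fst q)\<close>;
  conversely a line in the base lifts to a curve in the graph.\<close>

lemma tangent_space_graph:
  assumes y: "y \<in> S"
  shows "tangent_space (graph_over S G) (y, G y) = (\<lambda>u. (u, dir_deriv G u y)) ` UNIV"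
proof (intro set_eqI iffI)
  fix v assume v: "v \<in> tangent_space (graph_over S G) (y, G y)"
  have "snd v = dir_deriv G (fst v) y"
  proof (rule tangent_derivative_agree[OF _ _ _ _ v])
    show "(snd has_derivative snd) (at (y, G y))" by (rule bounded_linear_imp_has_derivative[OF bounded_linear_snd])
    have f: "(fst has_derivative fst) (at (y, G y))" by (rule bounded_linear_imp_has_derivative[OF bounded_linear_fst])
    show "((\<lambda>q. G (fst q)) has_derivative (\<lambda>h. dir_deriv G (fst h) y)) (at (y, G y))"
      by (rule has_derivative_compose[OF f]) (simp add: G_deriv[OF y])
  qed (use y in \<open>auto simp: graph_over_def\<close>)
  then have "v = (fst v, dir_deriv G (fst v) y)" by (simp add: prod_eq_iff)
  then show "v \<in> (\<lambda>u. (u, dir_deriv G u y)) ` UNIV" by blast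
next
  fix v assume "v \<in> (\<lambda>u. (u, dir_deriv G u y)) ` UNIV"
  then obtain u where v: "v = (u, dir_deriv G u y)" by blast
  let ?A = "(\<lambda>t. y + t *\<^sub>R u) -` S"
  have cont: "continuous_on UNIV (\<lambda>t. y + t *\<^sub>R u)" by (intro continuous_intros)
  have A: "open ?A" by (rule open_vimage[OF S cont])
  have l: "smooth_on ?A (\<lambda>t. y + t *\<^sub>R u)"
    by (rule smooth_on_add[OF A smooth_on_const smooth_on_bounded_linear[OF bounded_linear_scaleR_left A]])
  show "v \<in> tangent_space (graph_over S G) (y, G y)" unfolding v
  proof (rule tangent_spaceI[OF A])
    have "smooth_on ?A (\<lambda>t. G (y + t *\<^sub>R u))" by (rule smooth_on_compose[OF A S _ l G]) auto
    then show "smooth_on ?A (\<lambda>t. (y + t *\<^sub>R u, G (y + t *\<^sub>R u)))" by (rule smooth_on_Pair[OF A l])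
    have "((\<lambda>t. G (y + t *\<^sub>R u)) has_vector_derivative dir_deriv G u (y + 0 *\<^sub>R u)) (at 0)"
      by (rule dir_deriv_line[OF G S]) (use y in simp)
    moreover have "((\<lambda>t. y + t *\<^sub>R u) has_vector_derivative u) (at 0)" by (auto intro!: derivative_eq_intros)
    ultimately show "((\<lambda>t. (y + t *\<^sub>R u, G (y + t *\<^sub>R u))) has_vector_derivative (u, dir_deriv G u y)) (at 0)"
      using has_vector_derivative_Pair by fastforce
  qed (use y in \<open>auto simp: graph_over_def\<close>)
qed

lemma tangent_field_graph:
  assumes "y \<in> S" "e \<in> tangent_space (graph_over S G) (y, G y)"
  shows "\<exists>V. tangent_field_near (graph_over S G) (y, G y) V \<and> V (y, G y) = e"
proof -
  obtain u where u: "e = (u, dir_deriv G u y)" using assms tangent_space_graph by blast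
  let ?W = "{q :: 'a \<times> 'b. fst q \<in> S}"
  let ?V = "\<lambda>q :: 'a \<times> 'b. (u, dir_deriv G u (fst q))"
  have W: "open ?W" by (rule fst_preimage_open[OF S])
  have "smooth_on ?W ?V"
    by (rule smooth_on_Pair[OF W smooth_on_const smooth_on_fst_compose[OF S smooth_on_dir_deriv[OF G]]])
  then have "tangent_field_near (graph_over S G) (y, G y) ?V"
    by (rule tangent_field_nearI[OF _ W]) (auto simp: graph_over_def tangent_space_graph[unfolded graph_over_def])
  then show ?thesis using u by (intro exI[of _ ?V]) simp
qed

text \<open>The adjoint in the first component makes the field orthogonal to all lifts. The field
  depends on the base point alone, hence extends off the graph and can be differentiated in the
  ambient space.\<close>

definition normal_field :: "'b \<Rightarrow> 'a \<times> 'b \<Rightarrow> 'a \<times> 'b" where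
  "normal_field w q = (- (\<Sum>b\<in>Basis. (w \<bullet> dir_deriv G b (fst q)) *\<^sub>R b), w)"

lemma normal_field_orthogonal:
  assumes "q \<in> graph_over S G" "t \<in> tangent_space (graph_over S G) q"
  shows "t \<bullet> normal_field w q = 0"
proof -
  obtain y where y: "y \<in> S" "q = (y, G y)" using assms(1) by (auto simp: graph_over_def)
  then obtain u where u: "t = (u, dir_deriv G u y)" using assms(2) tangent_space_graph by blast
  show ?thesis
    by (simp add: u y(2) normal_field_def inner_adjoint_sum[OF linear_dG[OF y(1)]] inner_commute)
qed

lemma normal_field_deriv:
  assumes y: "y \<in> S"
  shows "(normal_field w has_derivative
     (\<lambda>h. (- (\<Sum>b\<in>Basis. (w \<bullet> dir_deriv (dir_deriv G b) (fst h) y) *\<^sub>R b), 0))) (at (y, G y))"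
proof -
  have f: "(fst has_derivative fst) (at (y, G y))" by (rule bounded_linear_imp_has_derivative[OF bounded_linear_fst])
  have 1: "((\<lambda>q. dir_deriv G b (fst q)) has_derivative (\<lambda>h. dir_deriv (dir_deriv G b) (fst h) y)) (at (y, G y))" for b
    by (rule has_derivative_compose[OF f]) (simp add: dG_deriv[OF y])
  have 2: "((\<lambda>q. w \<bullet> dir_deriv G b (fst q)) has_derivative (\<lambda>h. w \<bullet> dir_deriv (dir_deriv G b) (fst h) y)) (at (y, G y))" for b
    by (rule has_derivative_inner_right[OF 1])
  show ?thesis unfolding normal_field_def[abs_def]
    by (intro has_derivative_Pair has_derivative_minus has_derivative_sum has_derivative_const has_derivative_scaleR_left 2)
qed

text \<open>The mean curvature is normal, hence itself the value of some
  \<open>normal_field w\<close>; its pairings with these fields decide whether it vanishes.\<close>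

lemma graph_mean_curvature_zero_iff:
  assumes y: "y \<in> S" and B: "orthonormal_basis UNIV B"
    and orth: "\<And>b c. b \<in> B \<Longrightarrow> c \<in> B \<Longrightarrow> dir_deriv G b y \<bullet> dir_deriv G c y = (if b = c then \<mu> b else 0)"
  shows "mean_curvature UNIV (graph_over S G) (y, G y) = 0 \<longleftrightarrow>
     (\<Sum>b\<in>B. dir_deriv (dir_deriv G b) b y /\<^sub>R (1 + \<mu> b)) = 0"
proof -
  let ?M = "graph_over S G" and ?p = "(y, G y)"
  let ?H = "mean_curvature UNIV ?M ?p" and ?s = "\<Sum>b\<in>B. dir_deriv (dir_deriv G b) b y /\<^sub>R (1 + \<mu> b)"
  note ts = tangent_space_graph[OF y] and dl = linear_dG[OF y]
  have pM: "?p \<in> ?M" using y by (auto simp: graph_over_def)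
  have lin2: "linear (\<lambda>v. dir_deriv (dir_deriv G v) u y)" for u
  proof -
    have "(\<lambda>v. dir_deriv (dir_deriv G v) u y) = (\<lambda>v. dir_deriv (dir_deriv G u) v y)"
      by (rule ext) (rule dir_deriv_commute[OF G S y])
    then show ?thesis using has_derivative_linear[OF dG_deriv[OF y]] by simp
  qed
  have H: "?H \<bullet> normal_field w ?p = w \<bullet> ?s" for w
  proof -
    have "?H \<bullet> normal_field w ?p = - (\<Sum>b\<in>B. ((b, dir_deriv G b y) \<bullet>
       (- (\<Sum>c\<in>Basis. (w \<bullet> dir_deriv (dir_deriv G c) (fst (b, dir_deriv G b y)) y) *\<^sub>R c), 0)) / (1 + \<mu> b))"
      by (rule mean_curvature_graph_inner[OF _ ts subspace_UNIV pM tangent_field_graph[OF y]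
          normal_field_orthogonal normal_field_deriv[OF y] _ B dl orth])
         (simp_all add: tangent_space_UNIV subspace_UNIV)
    also have "\<dots> = (\<Sum>b\<in>B. (w \<bullet> dir_deriv (dir_deriv G b) b y) / (1 + \<mu> b))"
      by (simp add: inner_adjoint_sum[OF lin2] sum_negf)
    finally show ?thesis by (simp add: inner_sum_right divide_inverse mult.commute)
  qed
  show ?thesis
  proof
    assume "?H = 0"
    \<comment> \<open>Test with \<open>w\<close> equal to the weighted trace itself.\<close>
    then have "?s \<bullet> ?s = 0" using H[of ?s] by simp
    then show "?s = 0" by simp
  next
    assume s: "?s = 0"
    have "linear (\<lambda>u. (u, dir_deriv G u y))" using linear_add[OF dl] linear_cmul[OF dl] by (intro linearI) simp_all
    then have M: "subspace (tangent_space ?M ?p)" unfolding ts by (rule linear_subspace_image) simp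
    have perp: "?H \<bullet> (u, dir_deriv G u y) = 0" for u
      by (rule mean_curvature_subspace(2)[OF _ M]) (auto simp: tangent_space_UNIV ts)
    \<comment> \<open>Orthogonality to all lifts determines the first component from the
      second.\<close>
    have "fst ?H = - (\<Sum>b\<in>Basis. (snd ?H \<bullet> dir_deriv G b y) *\<^sub>R b)"
    proof (rule vector_eq_ldot[THEN iffD1, rule_format])
      fix u
      show "u \<bullet> fst ?H = u \<bullet> - (\<Sum>b\<in>Basis. (snd ?H \<bullet> dir_deriv G b y) *\<^sub>R b)"
        using perp[of u] inner_adjoint_sum[OF dl, of u "snd ?H"]
        by (cases ?H) (simp add: inner_commute[of u])
    qed
    then have "?H = normal_field (snd ?H) ?p" by (simp add: normal_field_def prod_eq_iff)
    then have "?H \<bullet> ?H = 0" using H[of "snd ?H"] s by simp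
    then show "?H = 0" by simp
  qed
qed

text \<open>The slice chart is the vertical shear that subtracts \<open>G\<close>; the same chart
  serves every point.\<close>

lemma embedded_submanifold_graph: "embedded_submanifold DIM('a) (graph_over S G)"
  unfolding embedded_submanifold_def
proof
  fix p assume p: "p \<in> graph_over S G"
  let ?W = "{q :: 'a \<times> 'b. fst q \<in> S}"
  let ?\<Phi> = "\<lambda>q. (fst q, snd q - G (fst q))" and ?\<Psi> = "\<lambda>q. (fst q, snd q + G (fst q))"
  let ?T = "(UNIV :: 'a set) \<times> {0 :: 'b}"
  have W: "open ?W" by (rule fst_preimage_open[OF S])
  have f: "smooth_on ?W fst" by (rule smooth_on_bounded_linear[OF bounded_linear_fst W])
  have s: "smooth_on ?W snd" by (rule smooth_on_bounded_linear[OF bounded_linear_snd W])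
  have g: "smooth_on ?W (\<lambda>q. G (fst q))" by (rule smooth_on_fst_compose[OF S G])
  have \<Phi>: "smooth_on ?W ?\<Phi>" by (rule smooth_on_Pair[OF W f smooth_on_diff[OF W s g]])
  have \<Psi>: "smooth_on ?W ?\<Psi>" by (rule smooth_on_Pair[OF W f smooth_on_add[OF W s g]])
  have hom: "homeomorphism ?W ?W ?\<Phi> ?\<Psi>"
    by (rule homeomorphismI) (auto intro: smooth_on_continuous \<Phi> \<Psi>)
  have sub: "subspace ?T" by (rule subspace_Times[OF subspace_UNIV subspace_single_0])
  have dim: "dim ?T = DIM('a)" using dim_Times[OF subspace_UNIV, of "{0::'b}"] by simp
  have "graph_over S G \<inter> ?W = graph_over S G" by (auto simp: graph_over_def)
  then have img: "?\<Phi> ` (graph_over S G \<inter> ?W) = ?T \<inter> ?W"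
    by (auto simp: graph_over_def image_image)
  have "p \<in> ?W" using p by (auto simp: graph_over_def)
  then have "open ?W \<and> p \<in> ?W \<and> open ?W \<and> homeomorphism ?W ?W ?\<Phi> ?\<Psi> \<and> smooth_on ?W ?\<Phi> \<and>
      smooth_on ?W ?\<Psi> \<and> subspace ?T \<and> dim ?T = DIM('a) \<and> ?\<Phi> ` (graph_over S G \<inter> ?W) = ?T \<inter> ?W"
    by (intro conjI W hom \<Phi> \<Psi> sub dim img)
  then show "\<exists>W W' \<Phi> \<Psi> (T :: ('a \<times> 'b) set). open W \<and> p \<in> W \<and> open W' \<and> homeomorphism W W' \<Phi> \<Psi> \<and> smooth_on W \<Phi> \<and>
      smooth_on W' \<Psi> \<and> subspace T \<and> dim T = DIM('a) \<and> \<Phi> ` (graph_over S G \<inter> W) = T \<inter> W'"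
    by (intro exI)
qed

end

section \<open>Graphs over spheres\<close>

context sphere_extension
begin

text \<open>Besides the graph equation, the constancy of |fst q|^2 cuts out the hyperplane.\<close>

lemma tangent_space_sphere_graph:
  assumes y: "norm y = c" and c: "c > 0"
  shows "tangent_space (graph_over (sphere 0 c) (\<lambda>z. \<kappa> *\<^sub>R F z)) (y, \<kappa> *\<^sub>R F y) = (\<lambda>u. (u, \<kappa> *\<^sub>R D u y)) ` {u. y \<bullet> u = 0}"
    (is "tangent_space ?M ?p = ?T")
proof (intro set_eqI iffI)
  have y0: "y \<noteq> 0" using y c by auto
  fix v assume v: "v \<in> tangent_space ?M ?p"
  have pM: "?p \<in> ?M" using y by (auto simp: graph_over_def)
  have f: "(fst has_derivative fst) (at ?p)" by (rule bounded_linear_imp_has_derivative[OF bounded_linear_fst])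
  have 1: "snd v = \<kappa> *\<^sub>R D (fst v) y"
  proof (rule tangent_derivative_agree[OF _ _ _ pM v])
    show "(snd has_derivative snd) (at ?p)" by (rule bounded_linear_imp_has_derivative[OF bounded_linear_snd])
    have "((\<lambda>q. F (fst q)) has_derivative (\<lambda>h. D (fst h) y)) (at ?p)"
      by (rule has_derivative_compose[OF f]) (simp add: F_deriv[OF y0])
    then show "((\<lambda>q. \<kappa> *\<^sub>R F (fst q)) has_derivative (\<lambda>h. \<kappa> *\<^sub>R D (fst h) y)) (at ?p)"
      by (rule has_derivative_scaleR_right)
  qed (auto simp: graph_over_def)
  have "y \<bullet> fst v + fst v \<bullet> y = 0"
  proof (rule tangent_derivative_agree[OF _ has_derivative_const[of "c\<^sup>2"] _ pM v])
    show "((\<lambda>q. fst q \<bullet> fst q) has_derivative (\<lambda>h. y \<bullet> fst h + fst h \<bullet> y)) (at ?p)"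
      using has_derivative_inner[OF f f] by simp
  qed (auto simp: graph_over_def dot_square_norm)
  then have "y \<bullet> fst v = 0" by (simp add: inner_commute)
  moreover have "v = (fst v, \<kappa> *\<^sub>R D (fst v) y)" using 1 by (simp add: prod_eq_iff)
  ultimately show "v \<in> ?T" by blast
next
  have y0: "y \<noteq> 0" using y c by auto
  fix v assume "v \<in> ?T"
  then obtain u where u: "y \<bullet> u = 0" and v: "v = (u, \<kappa> *\<^sub>R D u y)" by blast
  let ?A = "{t. y + t *\<^sub>R u \<noteq> 0}"
  let ?q = "\<lambda>t. (c / norm (y + t *\<^sub>R u)) *\<^sub>R (y + t *\<^sub>R u)"
  have A: "open ?A" by (rule smooth_on_normalized_line)
  have l: "smooth_on ?A (\<lambda>t. y + t *\<^sub>R u)"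
    by (rule smooth_on_add[OF A smooth_on_const smooth_on_bounded_linear[OF bounded_linear_scaleR_left A]])
  have "smooth_on ?A (\<lambda>t. c *\<^sub>R ((y + t *\<^sub>R u) /\<^sub>R norm (y + t *\<^sub>R u)))"
    by (rule smooth_on_linear_compose[OF bounded_linear_scaleR_right A smooth_on_normalized_line(1)])
  then have q: "smooth_on ?A ?q" by (simp add: divide_inverse)
  have Fl: "smooth_on ?A (\<lambda>t. F (y + t *\<^sub>R u))"
    by (rule smooth_on_compose[OF A open_punctured _ l smooth]) auto
  show "v \<in> tangent_space ?M ?p" unfolding v
  proof (rule tangent_spaceI[OF A])
    \<comment> \<open>The second component needs no normalisation, as \<open>F\<close> is constant
      on rays.\<close>
    show "smooth_on ?A (\<lambda>t. (?q t, \<kappa> *\<^sub>R F (y + t *\<^sub>R u)))"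
      by (rule smooth_on_Pair[OF A q smooth_on_linear_compose[OF bounded_linear_scaleR_right A Fl]])
    show "(\<lambda>t. (?q t, \<kappa> *\<^sub>R F (y + t *\<^sub>R u))) ` ?A \<subseteq> ?M"
    proof (rule image_subsetI)
      fix t assume t: "t \<in> ?A"
      then have "F (?q t) = F (y + t *\<^sub>R u)" using c by (intro homogeneous) auto
      moreover have "?q t \<in> sphere 0 c" using t c by simp
      ultimately show "(?q t, \<kappa> *\<^sub>R F (y + t *\<^sub>R u)) \<in> ?M"
        unfolding graph_over_def by (intro image_eqI[where x="?q t"]) (simp_all only:)
    qed
    have "((\<lambda>t. F (y + t *\<^sub>R u)) has_vector_derivative D u (y + 0 *\<^sub>R u)) (at 0)"
      by (rule dir_deriv_line[OF smooth open_punctured]) (use y0 in simp)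
    then have "((\<lambda>t. \<kappa> *\<^sub>R F (y + t *\<^sub>R u)) has_vector_derivative \<kappa> *\<^sub>R D u y) (at 0)"
      by (auto intro: bounded_linear.has_vector_derivative[OF bounded_linear_scaleR_right])
    then show "((\<lambda>t. (?q t, \<kappa> *\<^sub>R F (y + t *\<^sub>R u))) has_vector_derivative (u, \<kappa> *\<^sub>R D u y)) (at 0)"
      by (rule has_vector_derivative_Pair[OF normalized_line_derivative[OF u y c]])
  qed (use y0 y u c in auto)
qed

text \<open>A constant first component would leave the tangent space as the base point moves.
  Subtracting its radial part repairs this and does not affect the second component, as
  \<open>D\<close> kills radial vectors.\<close>

lemma tangent_field_sphere_graph:
  assumes y: "norm y = c" and c: "c > 0"
    and e: "e \<in> tangent_space (graph_over (sphere 0 c) (\<lambda>z. \<kappa> *\<^sub>R F z)) (y, \<kappa> *\<^sub>R F y)"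
  shows "\<exists>V. tangent_field_near (graph_over (sphere 0 c) (\<lambda>z. \<kappa> *\<^sub>R F z)) (y, \<kappa> *\<^sub>R F y) V \<and> V (y, \<kappa> *\<^sub>R F y) = e"
    (is "\<exists>V. tangent_field_near ?M ?p V \<and> _")
proof -
  obtain u where u: "y \<bullet> u = 0" "e = (u, \<kappa> *\<^sub>R D u y)" using e tangent_space_sphere_graph[OF y c] by blast
  let ?W = "{q :: 'a \<times> 'b. fst q \<in> - {0}}"
  let ?V = "\<lambda>q :: 'a \<times> 'b. (u - ((u \<bullet> fst q) / c\<^sup>2) *\<^sub>R fst q, \<kappa> *\<^sub>R D u (fst q))"
  have W: "open ?W" by (rule fst_preimage_open[OF open_punctured])
  have f: "smooth_on ?W fst" by (rule smooth_on_bounded_linear[OF bounded_linear_fst W])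
  have i: "smooth_on ?W (\<lambda>q. (u \<bullet> fst q) / c\<^sup>2)"
    by (rule smooth_on_linear_compose[OF bounded_linear_divide W smooth_on_inner[OF W smooth_on_const f]])
  have V1: "smooth_on ?W (\<lambda>q. u - ((u \<bullet> fst q) / c\<^sup>2) *\<^sub>R fst q)"
    by (rule smooth_on_diff[OF W smooth_on_const smooth_on_scaleR[OF W i f]])
  have V2: "smooth_on ?W (\<lambda>q. \<kappa> *\<^sub>R D u (fst q))"
    by (rule smooth_on_linear_compose[OF bounded_linear_scaleR_right W
          smooth_on_fst_compose[OF open_punctured smooth_on_dir_deriv[OF smooth]]])
  have "tangent_field_near ?M ?p ?V"
  proof (rule tangent_field_nearI[OF smooth_on_Pair[OF W V1 V2] W])
    show "?M \<subseteq> ?W" using c by (auto simp: graph_over_def)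
    fix q assume "q \<in> ?M"
    then obtain z where z: "norm z = c" "q = (z, \<kappa> *\<^sub>R F z)" by (auto simp: graph_over_def)
    then have z0: "z \<noteq> 0" using c by auto
    let ?u = "u - ((u \<bullet> z) / c\<^sup>2) *\<^sub>R z"
    have "z \<bullet> z = c\<^sup>2" using z(1) by (simp add: dot_square_norm)
    then have "z \<bullet> ?u = 0" using c by (simp add: inner_diff_right inner_commute[of z u])
    moreover have "D ?u z = D u z"
      using linear_diff[OF linear_D[OF z0], of u] linear_cmul[OF linear_D[OF z0], of _ z] D_radial[OF z0] by simp
    ultimately have "(?u, \<kappa> *\<^sub>R D u z) \<in> (\<lambda>u. (u, \<kappa> *\<^sub>R D u z)) ` {u. z \<bullet> u = 0}"
      by (intro image_eqI[of _ _ ?u]) auto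
    then show "?V q \<in> tangent_space ?M q"
      unfolding z(2) tangent_space_sphere_graph[OF z(1) c] by simp
  qed
  moreover have "?V ?p = e" using u by (simp add: inner_commute)
  ultimately show ?thesis by blast
qed

end

context equal_singular_values
begin

text \<open>Here \<kappa> is the sine of the angle and c its cosine. Expanding the vanishing mean
  curvature against normal fields gives the equation needed by \<open>frame_traces\<close>, where
  the role of its scalar \<kappa> is taken by the weight \<beta> below.\<close>

lemma sphere_graph_minimal_traces:
  assumes c: "c > 0" and \<kappa>: "\<kappa> > 0" and c\<kappa>: "c\<^sup>2 + \<kappa>\<^sup>2 = 1"
    and y: "norm y = c" and fr: "singular_frame F lam p y BV BH"
    and H0: "mean_curvature (sphere 0 1) (graph_over (sphere 0 c) (\<lambda>z. \<kappa> *\<^sub>R F z)) (y, \<kappa> *\<^sub>R F y) = 0"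
  shows "(\<Sum>v\<in>BV. DD v v y) = 0" "(\<Sum>h\<in>BH. DD h h y) = - (real p * lam\<^sup>2 / (norm y)\<^sup>2) *\<^sub>R F y"
proof -
  have y0: "y \<noteq> 0" using y c by auto
  let ?M = "graph_over (sphere 0 c) (\<lambda>z. \<kappa> *\<^sub>R F z)" and ?p = "(y, \<kappa> *\<^sub>R F y)"
  let ?T = "{u. y \<bullet> u = 0}"
  define L where "L u = \<kappa> *\<^sub>R D u y" for u
  \<comment> \<open>The squared singular values of \<open>L\<close>: \<kappa>^2 times that of
    \<open>D\<close> on \<open>BH\<close>, zero on the kernel.\<close>
  define \<mu> where "\<mu> b = (if b \<in> BH then \<kappa>\<^sup>2 * (lam\<^sup>2 / (norm y)\<^sup>2) else 0)" for b
  \<comment> \<open>The first term makes the field orthogonal to the lifts. The second is a radial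
    correction that makes it tangent to the unit sphere: paired with the position vector it gives
    -\<kappa> (w \<bullet> F), which cancels the contribution of the second component.\<close>
  define \<nu> where "\<nu> w q = (- (\<kappa> *\<^sub>R (\<Sum>b\<in>Basis. (w \<bullet> D b (fst q)) *\<^sub>R b)) - (\<kappa> / c\<^sup>2) *\<^sub>R ((w \<bullet> F (fst q)) *\<^sub>R fst q), w)"
    for w :: 'b and q :: "'a \<times> 'b"
  define \<nu>' where "\<nu>' w h = (- (\<kappa> *\<^sub>R (\<Sum>b\<in>Basis. (w \<bullet> DD (fst h) b y) *\<^sub>R b))
      - (\<kappa> / c\<^sup>2) *\<^sub>R ((w \<bullet> F y) *\<^sub>R fst h + (w \<bullet> D (fst h) y) *\<^sub>R y), 0 :: 'b)" for w :: 'b and h :: "'a \<times> 'b"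
  \<comment> \<open>Arises from differentiating the position vector in the radial correction: each
    frame vector contributes 1 / c^2 times its weight.\<close>
  define \<alpha> where "\<alpha> = (\<Sum>b\<in>BV \<union> BH. 1 / (c\<^sup>2 * (1 + \<mu> b)))"
  have linL: "linear L" unfolding L_def[abs_def]
    using linear_compose_scale_right[OF linear_D[OF y0]] by simp
  have T: "tangent_space ?M ?p = (\<lambda>u. (u, L u)) ` ?T"
    using tangent_space_sphere_graph[OF y c] by (simp add: L_def)
  have pM: "?p \<in> ?M" using y by (auto simp: graph_over_def)
  have B: "orthonormal_basis ?T (BV \<union> BH)" and disj: "BV \<inter> BH = {}" using fr by (auto simp: singular_frame_def)
  have bb: "b \<bullet> b = 1" "y \<bullet> b = 0" if "b \<in> BV \<union> BH" for b
    using frame_orth[OF y0 fr that] by auto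
  have orth: "L b \<bullet> L d = (if b = d then \<mu> b else 0)" if b: "b \<in> BV \<union> BH" and d: "d \<in> BV \<union> BH" for b d
  proof (cases "b \<in> BH")
    case True
    have bd: "b \<noteq> d \<Longrightarrow> b \<bullet> d = 0"
      using B b d unfolding orthonormal_basis_def pairwise_def orthogonal_def by blast
    have "L b \<bullet> L d = \<kappa>\<^sup>2 * (lam\<^sup>2 / (norm y)\<^sup>2 * (b \<bullet> d))"
      using frame_H[OF y0 fr True, of d] by (simp add: L_def power2_eq_square)
    then show ?thesis using bd bb[OF b] True by (auto simp: \<mu>_def)
  next
    case False
    then have "D b y = 0" using b frame_V[OF y0 fr] by auto
    then show ?thesis using False by (auto simp: L_def \<mu>_def)
  qed
  have norm1: "norm ?p = 1"
    using y c\<kappa> unit[OF y0] by (simp add: norm_Pair)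
  have N: "tangent_space (sphere 0 1) ?p = {u. ?p \<bullet> u = 0}" by (rule tangent_space_sphere[OF norm1]) simp
  have \<nu>0: "t \<bullet> \<nu> w q = 0" if q: "q \<in> ?M" and t: "t \<in> tangent_space ?M q" for t w q
  proof -
    obtain z where z: "norm z = c" "q = (z, \<kappa> *\<^sub>R F z)" using q by (auto simp: graph_over_def)
    then have z0: "z \<noteq> 0" using c by auto
    obtain u where u: "z \<bullet> u = 0" "t = (u, \<kappa> *\<^sub>R D u z)"
      using t unfolding z(2) tangent_space_sphere_graph[OF z(1) c] by blast
    show ?thesis using u(1) inner_adjoint_sum[OF linear_D[OF z0], of u w]
      by (simp add: u(2) z(2) \<nu>_def inner_diff_right inner_commute)
  qed
  have \<nu>N: "\<nu> w ?p \<in> tangent_space (sphere 0 1) ?p" for w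
    unfolding N using inner_adjoint_sum[OF linear_D[OF y0], of y w] D_radial[OF y0] y c
    by (simp add: \<nu>_def inner_diff_right dot_square_norm inner_commute)
  have f: "(fst has_derivative fst) (at ?p)" by (rule bounded_linear_imp_has_derivative[OF bounded_linear_fst])
  have d1: "((\<lambda>q. w \<bullet> D b (fst q)) has_derivative (\<lambda>h. w \<bullet> DD (fst h) b y)) (at ?p)" for w b
    by (rule has_derivative_inner_right[OF has_derivative_compose[OF f]]) (simp add: D_deriv[OF y0])
  have d2: "((\<lambda>q. w \<bullet> F (fst q)) has_derivative (\<lambda>h. w \<bullet> D (fst h) y)) (at ?p)" for w
    by (rule has_derivative_inner_right[OF has_derivative_compose[OF f]]) (simp add: F_deriv[OF y0])
  have d3: "((\<lambda>q. (w \<bullet> F (fst q)) *\<^sub>R fst q) has_derivative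
      (\<lambda>h. (w \<bullet> F y) *\<^sub>R fst h + (w \<bullet> D (fst h) y) *\<^sub>R y)) (at ?p)" for w
    using has_derivative_scaleR[OF d2 f] by simp
  have \<nu>d: "(\<nu> w has_derivative \<nu>' w) (at ?p)" for w
    unfolding \<nu>_def[abs_def] \<nu>'_def[abs_def]
    by (intro has_derivative_Pair has_derivative_diff has_derivative_minus has_derivative_scaleR_right
        has_derivative_sum has_derivative_const has_derivative_scaleR_left d1 d3)
  have lin2: "linear (\<lambda>v. DD u v y)" for u by (rule linear_DD2[OF y0])
  have eq: "w \<bullet> (\<alpha> *\<^sub>R F y + (\<Sum>b\<in>BV \<union> BH. DD b b y /\<^sub>R (1 + \<mu> b))) = 0" for w
  proof -
    \<comment> \<open>The term with \<open>w \<bullet> D b y\<close> disappears because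
      \<open>b\<close> is orthogonal to \<open>y\<close>.\<close>
    have summand: "(b, L b) \<bullet> \<nu>' w (b, L b) = - (\<kappa> * (w \<bullet> DD b b y + (w \<bullet> F y) / c\<^sup>2))" if "b \<in> BV \<union> BH" for b
    proof -
      have "(b, L b) \<bullet> \<nu>' w (b, L b) = - (\<kappa> * (b \<bullet> (\<Sum>d\<in>Basis. (w \<bullet> DD b d y) *\<^sub>R d)))
          - (\<kappa> / c\<^sup>2) * ((w \<bullet> F y) * (b \<bullet> b) + (w \<bullet> D b y) * (y \<bullet> b))"
        by (simp only: \<nu>'_def inner_Pair fst_conv inner_diff_right inner_minus_right inner_scaleR_right
            inner_add_right inner_zero_right inner_commute[of b y] add_0_right)
      then show ?thesis using bb[OF that] by (simp add: inner_adjoint_sum[OF lin2] algebra_simps)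
    qed
    have "0 = mean_curvature (sphere 0 1) ?M ?p \<bullet> \<nu> w ?p" by (simp add: H0)
    also have "\<dots> = - (\<Sum>b\<in>BV \<union> BH. ((b, L b) \<bullet> \<nu>' w (b, L b)) / (1 + \<mu> b))"
    proof (rule mean_curvature_graph_inner[OF _ T subspace_hyperplane pM _ \<nu>0 \<nu>d \<nu>N B linL orth])
      show "subspace (tangent_space (sphere 0 1) ?p)" unfolding N by (rule subspace_hyperplane)
    qed (rule tangent_field_sphere_graph[OF y c])
    also have "\<dots> = (\<Sum>b\<in>BV \<union> BH. \<kappa> * (w \<bullet> DD b b y + (w \<bullet> F y) / c\<^sup>2) / (1 + \<mu> b))"
      unfolding sum_negf[symmetric] by (intro sum.cong refl) (simp add: summand)
    also have "\<dots> = \<kappa> * (\<Sum>b\<in>BV \<union> BH. (w \<bullet> F y) * (1 / (c\<^sup>2 * (1 + \<mu> b))) + w \<bullet> (DD b b y /\<^sub>R (1 + \<mu> b)))"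
      unfolding sum_distrib_left
      by (intro sum.cong refl) (simp add: add_divide_distrib distrib_left divide_inverse mult_ac)
    also have "\<dots> = \<kappa> * (w \<bullet> (\<alpha> *\<^sub>R F y + (\<Sum>b\<in>BV \<union> BH. DD b b y /\<^sub>R (1 + \<mu> b))))"
      unfolding sum.distrib sum_distrib_left[symmetric] \<alpha>_def inner_add_right inner_sum_right inner_scaleR_right
      by (simp only: mult.commute)
    finally show ?thesis using \<kappa> by simp
  qed
  \<comment> \<open>The weight shared by all of \<open>BH\<close>, the inverse of a number that is
    at least 1.\<close>
  define \<beta> where "\<beta> = inverse (1 + \<kappa>\<^sup>2 * (lam\<^sup>2 / (norm y)\<^sup>2))"
  have \<beta>: "\<beta> \<noteq> 0"
  proof -
    have "\<kappa>\<^sup>2 * (lam\<^sup>2 / (norm y)\<^sup>2) \<ge> 0" by simp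
    then show ?thesis unfolding \<beta>_def by (simp add: add_nonneg_eq_0_iff)
  qed
  have "(\<Sum>b\<in>BV \<union> BH. DD b b y /\<^sub>R (1 + \<mu> b)) = (\<Sum>b\<in>BV. DD b b y /\<^sub>R (1 + \<mu> b)) + (\<Sum>b\<in>BH. DD b b y /\<^sub>R (1 + \<mu> b))"
    by (rule sum.union_disjoint[OF frame_finite[OF y0 fr] disj])
  also have "(\<Sum>b\<in>BV. DD b b y /\<^sub>R (1 + \<mu> b)) = (\<Sum>b\<in>BV. DD b b y)"
    using disj by (intro sum.cong refl) (auto simp: \<mu>_def)
  also have "(\<Sum>b\<in>BH. DD b b y /\<^sub>R (1 + \<mu> b)) = \<beta> *\<^sub>R (\<Sum>b\<in>BH. DD b b y)"
    unfolding scaleR_sum_right by (intro sum.cong refl) (simp add: \<mu>_def \<beta>_def)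
  finally have split: "(\<Sum>b\<in>BV \<union> BH. DD b b y /\<^sub>R (1 + \<mu> b)) = (\<Sum>b\<in>BV. DD b b y) + \<beta> *\<^sub>R (\<Sum>b\<in>BH. DD b b y)" .
  have traces: "\<alpha> *\<^sub>R F y + (\<Sum>b\<in>BV. DD b b y) + \<beta> *\<^sub>R (\<Sum>b\<in>BH. DD b b y) = 0"
    using eq[of "\<alpha> *\<^sub>R F y + (\<Sum>b\<in>BV \<union> BH. DD b b y /\<^sub>R (1 + \<mu> b))"] by (simp add: split add.assoc)
  show "(\<Sum>v\<in>BV. DD v v y) = 0" "(\<Sum>h\<in>BH. DD h h y) = - (real p * lam\<^sup>2 / (norm y)\<^sup>2) *\<^sub>R F y"
    by (rule frame_traces[OF y0 fr traces \<beta>])+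
qed

text \<open>Both sides of the trace identities are homogeneous of degree -2, so the identities
  spread from the sphere of radius c to every nonzero \<open>y\<close>.\<close>

lemma minimal_traces:
  assumes c: "c > 0" and \<kappa>: "\<kappa> > 0" and c\<kappa>: "c\<^sup>2 + \<kappa>\<^sup>2 = 1"
    and min: "minimal_submanifold (sphere 0 1) (graph_over (sphere 0 c) (\<lambda>z. \<kappa> *\<^sub>R F z))"
    and y: "y \<noteq> 0" and fr: "singular_frame F lam p y BV BH"
  shows "(\<Sum>v\<in>BV. DD v v y) = 0" "(\<Sum>h\<in>BH. DD h h y) = - (real p * lam\<^sup>2 / (norm y)\<^sup>2) *\<^sub>R F y"
proof -
  define s where "s = c / norm y"
  have s: "s > 0" using c y by (simp add: s_def)
  let ?z = "s *\<^sub>R y"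
  have z: "norm ?z = c" using c y by (simp add: s_def)
  have fz: "singular_frame F lam p ?z BV BH" by (rule frame_scale[OF y s fr])
  have "(?z, \<kappa> *\<^sub>R F ?z) \<in> graph_over (sphere 0 c) (\<lambda>z. \<kappa> *\<^sub>R F z)" using z unfolding graph_over_def by (intro imageI) simp
  then have H0: "mean_curvature (sphere 0 1) (graph_over (sphere 0 c) (\<lambda>z. \<kappa> *\<^sub>R F z)) (?z, \<kappa> *\<^sub>R F ?z) = 0"
    using min unfolding minimal_submanifold_def by blast
  have sc: "(\<Sum>v\<in>A. DD v v y) = s\<^sup>2 *\<^sub>R (\<Sum>v\<in>A. DD v v ?z)" for A
    using s by (simp add: DD_scale[OF y s] scaleR_sum_right)
  note tr = sphere_graph_minimal_traces[OF c \<kappa> c\<kappa> z fz H0]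
  show "(\<Sum>v\<in>BV. DD v v y) = 0" by (simp only: sc tr(1) scaleR_zero_right)
  show "(\<Sum>h\<in>BH. DD h h y) = - (real p * lam\<^sup>2 / (norm y)\<^sup>2) *\<^sub>R F y"
    unfolding sc[of BH] tr(2) homogeneous[OF y s] z using c y by (simp add: s_def power_divide)
qed

end

section \<open>Rotational graphs\<close>

text \<open>Passes from \<open>dir_deriv\<close> in direction 1 to \<open>deriv\<close>, in which
  the differential equation is written.\<close>

lemma smooth_on_real_deriv:
  fixes \<rho> :: "real \<Rightarrow> real"
  assumes U: "open U" and \<rho>: "smooth_on U \<rho>"
  shows "\<And>r. r \<in> U \<Longrightarrow> (\<rho> has_real_derivative deriv \<rho> r) (at r)" "smooth_on U (deriv \<rho>)"
proof -
  have d: "(\<rho> has_real_derivative dir_deriv \<rho> 1 r) (at r)" if "r \<in> U" for r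
  proof -
    have l: "(\<rho> has_derivative (\<lambda>v. dir_deriv \<rho> v r)) (at r)" by (rule dir_deriv_has_derivative[OF \<rho> U that])
    have "(\<lambda>v. dir_deriv \<rho> v r) = (*) (dir_deriv \<rho> 1 r)"
    proof
      fix v show "dir_deriv \<rho> v r = dir_deriv \<rho> 1 r * v"
        using linear_cmul[OF has_derivative_linear[OF l], of v 1] by (simp add: mult.commute)
    qed
    then show ?thesis using l unfolding has_field_derivative_def by (simp only:)
  qed
  then have eq: "dir_deriv \<rho> 1 r = deriv \<rho> r" if "r \<in> U" for r
    using DERIV_imp_deriv[OF d[OF that]] by simp
  show "(\<rho> has_real_derivative deriv \<rho> r) (at r)" if "r \<in> U" for r
    using d[OF that] by (simp only: eq[OF that])
  show "smooth_on U (deriv \<rho>)" by (rule smooth_on_cong[OF U eq smooth_on_dir_deriv[OF \<rho>]])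
qed

context equal_singular_values
begin

lemma rotational_graph:
  fixes \<rho> :: "real \<Rightarrow> real"
  assumes U: "open U" "U \<subseteq> {0<..}" and \<rho>: "smooth_on U \<rho>"
  shows "smooth_graph {y. norm y \<in> U} (\<lambda>y. \<rho> (norm y) *\<^sub>R F y)"
proof
  let ?S = "{y :: 'a. norm y \<in> U}"
  show S: "open ?S" using open_vimage[OF U(1) continuous_on_norm_id] by (simp add: vimage_def)
  have S0: "0 \<notin> ?S" using U(2) by auto
  have r: "smooth_on ?S (\<lambda>y. \<rho> (norm y))"
    by (rule smooth_on_compose[OF S U(1) _ smooth_on_norm[OF S S0] \<rho>]) auto
  have f: "smooth_on ?S F" by (rule smooth_on_subset[OF smooth]) (use S0 in auto)
  show "smooth_on ?S (\<lambda>y. \<rho> (norm y) *\<^sub>R F y)" by (rule smooth_on_scaleR[OF S r f])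
qed

lemma norm_compose_deriv:
  fixes \<phi> :: "real \<Rightarrow> real" and z :: 'a
  assumes "z \<noteq> 0" "(\<phi> has_real_derivative d) (at (norm z))"
  shows "((\<lambda>z. \<phi> (norm z)) has_derivative (\<lambda>h. d * ((z \<bullet> h) / norm z))) (at z)"
proof -
  have n: "(norm has_derivative (\<lambda>h. (z \<bullet> h) / norm z)) (at z)"
    using has_derivative_norm[OF assms(1)]
    by (simp add: sgn_div_norm divide_inverse mult.commute inner_commute)
  show ?thesis
    using has_derivative_compose[OF n assms(2)[unfolded has_field_derivative_def]] .
qed

context
  fixes \<rho> :: "real \<Rightarrow> real" and U :: "real set"
  assumes U: "open U" "U \<subseteq> {0<..}" and \<rho>: "smooth_on U \<rho>"
begin

abbreviation G :: "'a \<Rightarrow> 'b" where "G \<equiv> \<lambda>y. \<rho> (norm y) *\<^sub>R F y"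

lemma rotational_nonzero: "norm z \<in> U \<Longrightarrow> z \<noteq> (0::'a)"
  using U(2) by auto

lemma dir_deriv_rotational:
  assumes z: "norm z \<in> U"
  shows "dir_deriv G v z = \<rho> (norm z) *\<^sub>R D v z + (deriv \<rho> (norm z) * ((z \<bullet> v) / norm z)) *\<^sub>R F z"
proof (rule dir_deriv_eq)
  note z0 = rotational_nonzero[OF z]
  show "(G has_derivative (\<lambda>v. \<rho> (norm z) *\<^sub>R D v z + (deriv \<rho> (norm z) * ((z \<bullet> v) / norm z)) *\<^sub>R F z)) (at z)"
    by (rule has_derivative_scaleR[OF norm_compose_deriv[OF z0 smooth_on_real_deriv(1)[OF U(1) \<rho> z]] F_deriv[OF z0]])
qed

text \<open>Equal directions suffice for the weighted trace. The coefficient of \<open>F y\<close>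
  reduces to rho_r / r for unit \<open>v\<close> orthogonal to \<open>y\<close>, and to rho_rr for
  the unit radial \<open>v\<close>.\<close>

lemma dir_deriv2_rotational:
  assumes y: "norm y \<in> U"
  shows "dir_deriv (dir_deriv G v) v y = \<rho> (norm y) *\<^sub>R DD v v y + (2 * deriv \<rho> (norm y) * ((y \<bullet> v) / norm y)) *\<^sub>R D v y
    + (deriv (deriv \<rho>) (norm y) * ((y \<bullet> v) / norm y)\<^sup>2
       + deriv \<rho> (norm y) * ((v \<bullet> v) / norm y - (y \<bullet> v)\<^sup>2 / (norm y) ^ 3)) *\<^sub>R F y"
proof -
  note y0 = rotational_nonzero[OF y]
  let ?r = "norm y"
  note d\<rho> = smooth_on_real_deriv[OF U(1) \<rho>]
  note dd\<rho> = smooth_on_real_deriv(1)[OF U(1) d\<rho>(2) y]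
  have 1: "((\<lambda>z. \<rho> (norm z) *\<^sub>R D v z) has_derivative
      (\<lambda>h. \<rho> ?r *\<^sub>R DD h v y + (deriv \<rho> ?r * ((y \<bullet> h) / ?r)) *\<^sub>R D v y)) (at y)"
    by (rule has_derivative_scaleR[OF norm_compose_deriv[OF y0 d\<rho>(1)[OF y]] D_deriv[OF y0]])
  have i: "((\<lambda>z. inverse (norm z)) has_derivative (\<lambda>h. - (inverse (?r ^ Suc (Suc 0))) * ((y \<bullet> h) / ?r))) (at y)"
  proof (rule norm_compose_deriv[OF y0])
    show "(inverse has_real_derivative - (inverse (?r ^ Suc (Suc 0)))) (at ?r)"
      using DERIV_inverse[of ?r UNIV] y0 by (simp add: power_inverse)
  qed
  have v: "((\<lambda>z. z \<bullet> v) has_derivative (\<lambda>h. h \<bullet> v)) (at y)"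
    by (rule bounded_linear_imp_has_derivative[OF bounded_linear_inner_left])
  have q: "((\<lambda>z. (z \<bullet> v) * inverse (norm z)) has_derivative
      (\<lambda>h. (y \<bullet> v) * (- (inverse (?r ^ Suc (Suc 0))) * ((y \<bullet> h) / ?r)) + (h \<bullet> v) * inverse ?r)) (at y)"
    by (rule has_derivative_mult[OF v i])
  have 2: "((\<lambda>z. (deriv \<rho> (norm z) * ((z \<bullet> v) * inverse (norm z))) *\<^sub>R F z) has_derivative
      (\<lambda>h. (deriv \<rho> ?r * ((y \<bullet> v) * inverse ?r)) *\<^sub>R D h y +
         (deriv \<rho> ?r * ((y \<bullet> v) * (- (inverse (?r ^ Suc (Suc 0))) * ((y \<bullet> h) / ?r)) + (h \<bullet> v) * inverse ?r)
          + (deriv (deriv \<rho>) ?r * ((y \<bullet> h) / ?r)) * ((y \<bullet> v) * inverse ?r)) *\<^sub>R F y)) (at y)"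
    by (rule has_derivative_scaleR[OF has_derivative_mult[OF norm_compose_deriv[OF y0 dd\<rho>] q] F_deriv[OF y0]])
  have S: "open {y :: 'a. norm y \<in> U}" by (rule smooth_graph.S[OF rotational_graph[OF U \<rho>]])
  have "(dir_deriv G v has_derivative (\<lambda>h. (\<rho> ?r *\<^sub>R DD h v y + (deriv \<rho> ?r * ((y \<bullet> h) / ?r)) *\<^sub>R D v y) +
      ((deriv \<rho> ?r * ((y \<bullet> v) * inverse ?r)) *\<^sub>R D h y +
         (deriv \<rho> ?r * ((y \<bullet> v) * (- (inverse (?r ^ Suc (Suc 0))) * ((y \<bullet> h) / ?r)) + (h \<bullet> v) * inverse ?r)
          + (deriv (deriv \<rho>) ?r * ((y \<bullet> h) / ?r)) * ((y \<bullet> v) * inverse ?r)) *\<^sub>R F y))) (at y)"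
    by (rule has_derivative_transform_within_open[OF has_derivative_add[OF 1 2] S])
       (use y in \<open>simp_all add: dir_deriv_rotational divide_inverse\<close>)
  from dir_deriv_eq[OF this, of v] have e: "dir_deriv (dir_deriv G v) v y =
     \<rho> ?r *\<^sub>R DD v v y + (deriv \<rho> ?r * ((y \<bullet> v) / ?r)) *\<^sub>R D v y +
      ((deriv \<rho> ?r * ((y \<bullet> v) * inverse ?r)) *\<^sub>R D v y +
         (deriv \<rho> ?r * ((y \<bullet> v) * (- (inverse (?r ^ Suc (Suc 0))) * ((y \<bullet> v) / ?r)) + (v \<bullet> v) * inverse ?r)
          + (deriv (deriv \<rho>) ?r * ((y \<bullet> v) / ?r)) * ((y \<bullet> v) * inverse ?r)) *\<^sub>R F y)" .
  have c1: "2 * deriv \<rho> ?r * ((y \<bullet> v) / ?r) = deriv \<rho> ?r * ((y \<bullet> v) / ?r) + deriv \<rho> ?r * ((y \<bullet> v) * inverse ?r)"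
    by (simp add: divide_inverse)
  have c2: "deriv (deriv \<rho>) ?r * ((y \<bullet> v) / ?r)\<^sup>2 + deriv \<rho> ?r * ((v \<bullet> v) / ?r - (y \<bullet> v)\<^sup>2 / ?r ^ 3)
     = deriv \<rho> ?r * ((y \<bullet> v) * (- (inverse (?r ^ Suc (Suc 0))) * ((y \<bullet> v) / ?r)) + (v \<bullet> v) * inverse ?r)
          + (deriv (deriv \<rho>) ?r * ((y \<bullet> v) / ?r)) * ((y \<bullet> v) * inverse ?r)"
    using y0 by (simp add: field_simps power2_eq_square power3_eq_cube)
  show ?thesis unfolding e c1 c2 by (simp only: scaleR_add_left add.assoc)
qed

text \<open>In the basis formed by the radial direction, \<open>BV\<close> and \<open>BH\<close> the
  metric is diagonal. The radial block gives the term with rho_rr, \<open>BV\<close> the one with n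
  - p and \<open>BH\<close> the one with p, each times \<open>F y\<close>.\<close>

lemma rotational_mean_curvature_zero_iff:
  assumes y: "norm y \<in> U" and fr: "singular_frame F lam p y BV BH"
    and trV: "(\<Sum>v\<in>BV. DD v v y) = 0"
    and trH: "(\<Sum>h\<in>BH. DD h h y) = - (real p * lam\<^sup>2 / (norm y)\<^sup>2) *\<^sub>R F y"
    and n: "DIM('a) = n + 1"
  shows "mean_curvature UNIV (graph_over {y. norm y \<in> U} G) (y, G y) = 0 \<longleftrightarrow>
     deriv (deriv \<rho>) (norm y) / (1 + (deriv \<rho> (norm y))\<^sup>2)
          + (real n - real p) * deriv \<rho> (norm y) / norm y
          + real p * (deriv \<rho> (norm y) / norm y - lam\<^sup>2 * \<rho> (norm y) / (norm y)\<^sup>2)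
              / (1 + lam\<^sup>2 * (\<rho> (norm y))\<^sup>2 / (norm y)\<^sup>2) = 0"
proof -
  interpret smooth_graph "{y. norm y \<in> U}" G by (rule rotational_graph[OF U \<rho>])
  note y0 = rotational_nonzero[OF y]
  define r where "r = norm y"
  have r: "r > 0" using y0 by (simp add: r_def)
  define e where "e = y /\<^sub>R r"
  define d1 where "d1 = deriv \<rho> r"
  define d2 where "d2 = deriv (deriv \<rho>) r"
  define q where "q = lam\<^sup>2 / r\<^sup>2"
  have yr: "y = r *\<^sub>R e" using r by (simp add: e_def)
  have ee: "e \<bullet> e = 1" using r by (simp add: e_def r_def dot_square_norm power2_eq_square)
  have ye: "y \<bullet> e = r" using ee by (simp add: yr)
  have De: "D e y = 0" using linear_cmul[OF linear_D[OF y0], of "inverse r" y] D_radial[OF y0] by (simp add: e_def)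
  have DDe: "DD e e y = 0"
  proof -
    have "DD e e y = inverse r *\<^sub>R DD y e y" using linear_cmul[OF linear_DD[OF y0], of e "inverse r" y] by (simp add: e_def)
    also have "DD y e y = inverse r *\<^sub>R DD y y y" using linear_cmul[OF linear_DD2[OF y0], of "inverse r" y y] by (simp add: e_def)
    finally show ?thesis using DD_radial[OF y0] by simp
  qed
  have fb: "b \<bullet> b = 1" "y \<bullet> b = 0" if "b \<in> BV \<union> BH" for b using frame_orth[OF y0 fr that] by auto
  have eb: "e \<bullet> b = 0" if "b \<in> BV \<union> BH" for b using fb(2)[OF that] by (simp add: e_def)
  have eni: "e \<notin> BV \<union> BH" using eb ee by force
  have B0: "orthonormal_basis {u. y \<bullet> u = 0} (BV \<union> BH)" and disj: "BV \<inter> BH = {}"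
    using fr by (auto simp: singular_frame_def)
  let ?B = "insert e (BV \<union> BH)"
  have B: "orthonormal_basis UNIV ?B"
    unfolding orthonormal_basis_def
  proof (intro conjI ballI)
    show "pairwise orthogonal ?B"
      using B0 eb unfolding orthonormal_basis_def by (simp add: pairwise_insert orthogonal_def inner_commute)
    show "norm b = 1" if "b \<in> ?B" for b using that ee fb by (auto simp: norm_eq_1)
    have "a \<in> span ?B" for a
      using frame_decompose[OF y0 fr subspace_span, of ?B a] span_superset[of ?B] span_mul[of e ?B r] yr by auto
    then show "span ?B = UNIV" by blast
  qed
  have dG: "dir_deriv G b y = \<rho> r *\<^sub>R D b y" if "b \<in> BV \<union> BH" for b
    using dir_deriv_rotational[OF y, of b] fb(2)[OF that] by (simp add: r_def)
  have dGe: "dir_deriv G e y = d1 *\<^sub>R F y"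
    using dir_deriv_rotational[OF y, of e] De ye r by (simp add: r_def[symmetric] d1_def)
  \<comment> \<open>Squared stretch factors of \<open>G\<close>: rho_r radially, 0 on the kernel,
    and \<rho> r * lam / r on \<open>BH\<close>.\<close>
  define \<mu> where "\<mu> b = (if b = e then d1\<^sup>2 else if b \<in> BH then (\<rho> r)\<^sup>2 * q else 0)" for b
  have orth: "dir_deriv G b y \<bullet> dir_deriv G c y = (if b = c then \<mu> b else 0)" if b: "b \<in> ?B" and c: "c \<in> ?B" for b c
  proof -
    consider "b = e" "c = e" | "b = e" "c \<in> BV \<union> BH" | "b \<in> BV \<union> BH" "c = e"
      | "b \<in> BV" "c \<in> BV \<union> BH" | "b \<in> BH" "c \<in> BV \<union> BH" using b c by blast
    then show ?thesis
    proof cases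
      case 1 then show ?thesis using F_inner[OF y0] by (simp add: dGe \<mu>_def power2_eq_square)
    next
      \<comment> \<open>The radial derivative points along \<open>F y\<close>, to which every
        \<open>D c y\<close> is orthogonal.\<close>
      case 2 then show ?thesis using eni D_inner_F[OF y0, of c] by (auto simp: dGe dG inner_commute)
    next
      case 3 then show ?thesis using eni D_inner_F[OF y0, of b] by (auto simp: dGe dG)
    next
      case 4
      then have "dir_deriv G b y = 0" using dG[of b] frame_V[OF y0 fr, of b] by simp
      moreover have "\<mu> b = 0" using 4 disj eni by (auto simp: \<mu>_def)
      ultimately show ?thesis by auto
    next
      case 5
      have bc: "b \<noteq> c \<Longrightarrow> b \<bullet> c = 0"
        using B0 5 unfolding orthonormal_basis_def pairwise_def orthogonal_def by blast
      have "dir_deriv G b y \<bullet> dir_deriv G c y = (\<rho> r)\<^sup>2 * (q * (b \<bullet> c))"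
        using dG[of b] dG[of c] 5 frame_H[OF y0 fr, of b c] by (simp add: power2_eq_square q_def r_def)
      moreover have "\<mu> b = (\<rho> r)\<^sup>2 * q" using 5 eni by (auto simp: \<mu>_def)
      ultimately show ?thesis using bc fb(1)[of b] 5 by auto
    qed
  qed
  let ?H = "\<lambda>b. dir_deriv (dir_deriv G b) b y"
  have He: "?H e = d2 *\<^sub>R F y"
    using dir_deriv2_rotational[OF y, of e] r
    by (simp add: De DDe ye ee r_def[symmetric] d1_def d2_def power2_eq_square power3_eq_cube)
  have Hb: "?H b = \<rho> r *\<^sub>R DD b b y + (d1 / r) *\<^sub>R F y" if "b \<in> BV \<union> BH" for b
    using dir_deriv2_rotational[OF y, of b] fb[OF that] by (simp add: r_def[symmetric] d1_def)
  \<comment> \<open>The frame gives card BV + p = n, so the difference of reals is a true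
    count.\<close>
  have cV: "real (card BV) = real n - real p" and cH: "card BH = p"
    using fr n unfolding singular_frame_def by linarith+
  note fin = frame_finite[OF y0 fr]
  \<comment> \<open>All weights are 1 here, and the vanishing kernel trace removes
    \<open>DD\<close>; each kernel direction leaves rho_r / r.\<close>
  have sV: "(\<Sum>b\<in>BV. ?H b /\<^sub>R (1 + \<mu> b)) = ((real n - real p) * d1 / r) *\<^sub>R F y"
  proof -
    have "(\<Sum>b\<in>BV. ?H b /\<^sub>R (1 + \<mu> b)) = (\<Sum>b\<in>BV. \<rho> r *\<^sub>R DD b b y + (d1 / r) *\<^sub>R F y)"
      using disj eni by (intro sum.cong refl) (auto simp: \<mu>_def Hb)
    also have "\<dots> = \<rho> r *\<^sub>R (\<Sum>b\<in>BV. DD b b y) + (real (card BV) * (d1 / r)) *\<^sub>R F y"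
      by (simp add: sum.distrib scaleR_sum_right sum_constant_scaleR)
    finally show ?thesis by (simp add: trV cV)
  qed
  \<comment> \<open>The trace over \<open>BH\<close> supplies the term with lam^2 \<rho>, and the
    common weight becomes the denominator.\<close>
  have sH: "(\<Sum>b\<in>BH. ?H b /\<^sub>R (1 + \<mu> b)) = (real p * (d1 / r - q * \<rho> r) / (1 + (\<rho> r)\<^sup>2 * q)) *\<^sub>R F y"
  proof -
    have "(\<Sum>b\<in>BH. ?H b /\<^sub>R (1 + \<mu> b)) = (\<Sum>b\<in>BH. inverse (1 + (\<rho> r)\<^sup>2 * q) *\<^sub>R (\<rho> r *\<^sub>R DD b b y + (d1 / r) *\<^sub>R F y))"
      using eni by (intro sum.cong refl) (auto simp: \<mu>_def Hb)
    also have "\<dots> = inverse (1 + (\<rho> r)\<^sup>2 * q) *\<^sub>R (\<rho> r *\<^sub>R (\<Sum>b\<in>BH. DD b b y) + (real p * (d1 / r)) *\<^sub>R F y)"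
      by (simp only: scaleR_sum_right[symmetric] sum.distrib sum_constant_scaleR cH scaleR_scaleR mult.commute)
    also have "\<dots> = (inverse (1 + (\<rho> r)\<^sup>2 * q) * (\<rho> r * - (real p * lam\<^sup>2 / r\<^sup>2) + real p * (d1 / r))) *\<^sub>R F y"
      by (simp only: trH r_def[symmetric] scaleR_scaleR scaleR_add_left[symmetric])
    also have "inverse (1 + (\<rho> r)\<^sup>2 * q) * (\<rho> r * - (real p * lam\<^sup>2 / r\<^sup>2) + real p * (d1 / r))
       = real p * (d1 / r - q * \<rho> r) / (1 + (\<rho> r)\<^sup>2 * q)"
      by (simp add: q_def divide_inverse algebra_simps)
    finally show ?thesis .
  qed
  have "(\<Sum>b\<in>?B. ?H b /\<^sub>R (1 + \<mu> b)) = ?H e /\<^sub>R (1 + \<mu> e) + (\<Sum>b\<in>BV \<union> BH. ?H b /\<^sub>R (1 + \<mu> b))"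
    using fin eni by (intro sum.insert) auto
  also have "(\<Sum>b\<in>BV \<union> BH. ?H b /\<^sub>R (1 + \<mu> b)) = (\<Sum>b\<in>BV. ?H b /\<^sub>R (1 + \<mu> b)) + (\<Sum>b\<in>BH. ?H b /\<^sub>R (1 + \<mu> b))"
    by (rule sum.union_disjoint[OF fin disj])
  also have "?H e /\<^sub>R (1 + \<mu> e) = (d2 / (1 + d1\<^sup>2)) *\<^sub>R F y"
    by (simp add: He \<mu>_def divide_inverse mult.commute)
  finally have "(\<Sum>b\<in>?B. ?H b /\<^sub>R (1 + \<mu> b)) = (d2 / (1 + d1\<^sup>2) + (real n - real p) * d1 / r
      + real p * (d1 / r - q * \<rho> r) / (1 + (\<rho> r)\<^sup>2 * q)) *\<^sub>R F y"
    by (simp only: sV sH scaleR_add_left add.assoc)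
  moreover have "F y \<noteq> 0" using F_inner[OF y0] by auto
  ultimately have "(\<Sum>b\<in>?B. ?H b /\<^sub>R (1 + \<mu> b)) = 0 \<longleftrightarrow> d2 / (1 + d1\<^sup>2) + (real n - real p) * d1 / r
      + real p * (d1 / r - q * \<rho> r) / (1 + (\<rho> r)\<^sup>2 * q) = 0"
    by simp
  moreover have "mean_curvature UNIV (graph_over {y. norm y \<in> U} G) (y, G y) = 0 \<longleftrightarrow> (\<Sum>b\<in>?B. ?H b /\<^sub>R (1 + \<mu> b)) = 0"
    by (rule graph_mean_curvature_zero_iff[OF _ B orth]) (use y in simp_all)
  moreover have "q * \<rho> r = lam\<^sup>2 * \<rho> r / r\<^sup>2" "(\<rho> r)\<^sup>2 * q = lam\<^sup>2 * (\<rho> r)\<^sup>2 / r\<^sup>2" by (simp_all add: q_def)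
  ultimately show ?thesis unfolding d1_def d2_def r_def by (simp only:)
qed

end

end

section \<open>From the given map to its extension, and the final equivalence\<close>

lemma sphere_extension_normalize:
  fixes f :: "'a::euclidean_space \<Rightarrow> 'b::euclidean_space"
  assumes "smooth_sphere_map f"
  shows "sphere_extension (\<lambda>y. f (y /\<^sub>R norm y))"
proof
  have maps: "f ` sphere 0 1 \<subseteq> sphere 0 1" and sm: "smooth_map_on (sphere 0 1) f"
    using assms by (auto simp: smooth_sphere_map_def)
  have op: "open (-{0::'a})" by (rule open_Compl) (rule closed_singleton)
  have cont: "continuous_on (-{0::'a}) (\<lambda>y. y /\<^sub>R norm y)"
    by (rule smooth_on_continuous[OF smooth_on_normalize[OF op]]) simp
  show "smooth_on (-{0}) (\<lambda>y. f (y /\<^sub>R norm y))"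
  proof (rule smooth_on_local)
    fix y :: 'a assume y: "y \<in> -{0}"
    then have "y /\<^sub>R norm y \<in> sphere 0 1" by simp
    from bspec[OF sm[unfolded smooth_map_on_def] this] obtain W F0 where W: "open W" "y /\<^sub>R norm y \<in> W" "smooth_on W F0"
      "\<forall>z\<in>sphere 0 1 \<inter> W. f z = F0 z" by metis
    let ?W = "(-{0}) \<inter> (\<lambda>y. y /\<^sub>R norm y) -` W"
    have oW: "open ?W" by (rule continuous_open_preimage[OF cont op W(1)])
    have n: "smooth_on ?W (\<lambda>y. y /\<^sub>R norm y)" by (rule smooth_on_normalize[OF oW]) simp
    \<comment> \<open>Normalisation lands on the sphere, where the local ambient extension
      \<open>F0\<close> agrees with \<open>f\<close>.\<close>
    have "smooth_on ?W (\<lambda>y. F0 (y /\<^sub>R norm y))" by (rule smooth_on_compose[OF oW W(1) _ n W(3)]) auto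
    then have "smooth_on ?W (\<lambda>y. f (y /\<^sub>R norm y))"
      by (rule smooth_on_cong[OF oW, rotated]) (use W(4) in simp)
    then show "\<exists>W. open W \<and> y \<in> W \<and> smooth_on W (\<lambda>y. f (y /\<^sub>R norm y))"
      using oW y W(2) by (intro exI[of _ ?W]) simp
  qed
  show "norm (f (y /\<^sub>R norm y)) = 1" if "y \<noteq> 0" for y
    using maps that by (simp add: image_subset_iff)
  show "f ((c *\<^sub>R y) /\<^sub>R norm (c *\<^sub>R y)) = f (y /\<^sub>R norm y)" if "y \<noteq> 0" "c > 0" for y c
    using that by (simp add: inverse_eq_divide)
qed

text \<open>On the unit sphere the extension agrees with \<open>f\<close>, so its derivative
  computes the differential on tangent vectors and the singular values carry over.\<close>

lemma equal_singular_values_normalize: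
  fixes f :: "'a::euclidean_space \<Rightarrow> 'b::euclidean_space"
  assumes f: "smooth_sphere_map f" 
    and sv: "\<And>x. x \<in> sphere 0 1 \<Longrightarrow> nonzero_singular_values_at f x = {lam}"
    and mult: "\<And>x. x \<in> sphere 0 1 \<Longrightarrow> singular_multiplicity_at f x lam = p"
  shows "equal_singular_values (\<lambda>y. f (y /\<^sub>R norm y)) lam p"
proof -
  let ?F = "\<lambda>y. f (y /\<^sub>R norm y)"
  interpret sphere_extension ?F by (rule sphere_extension_normalize[OF f])
  have fr: "(\<exists>BV BH. singular_frame ?F lam p x BV BH) \<and> lam > 0" if x: "norm x = 1" for x :: 'a
  proof -
    have xs: "x \<in> sphere 0 1" and x0: "x \<noteq> 0" and xx: "x \<bullet> x = 1" using x norm_eq_1[of x] by auto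
    let ?T = "{u. x \<bullet> u = 0}"
    let ?d = "differential (sphere 0 1) f x"
    have T: "tangent_space (sphere 0 1) x = ?T" by (rule tangent_space_sphere[OF x]) simp
    have "(?F has_derivative (\<lambda>v. D v x)) (at x within sphere 0 1)"
      by (rule has_derivative_at_withinI[OF F_deriv[OF x0]])
    then have "(f has_derivative (\<lambda>v. D v x)) (at x within sphere 0 1)"
      by (rule has_derivative_transform_within[OF _ zero_less_one xs]) simp
    then have d: "?d u = D u x" if "u \<in> ?T" for u by (rule differential_eq) (use T that in simp)
    have sp: "singular_space ?T ?d \<sigma> = singular_space ?T (\<lambda>u. D u x) \<sigma>" for \<sigma>
      by (rule singular_space_cong[OF d])
    have sv: "singular_values ?T (\<lambda>u. D u x) - {0} = {lam}"
      using sv[OF xs] unfolding nonzero_singular_values_at_def singular_values_def singular_multiplicity_def T sp .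
    obtain BV BH where
      B: "orthonormal_basis ?T (BV \<union> BH)" "BV \<inter> BH = {}" "\<And>v. v \<in> BV \<Longrightarrow> D v x = 0"
        "\<And>h w. h \<in> BH \<Longrightarrow> w \<in> ?T \<Longrightarrow> D h x \<bullet> D w x = lam\<^sup>2 * (h \<bullet> w)"
        "card BH = singular_multiplicity ?T (\<lambda>u. D u x) lam" "card BV + card BH = dim ?T" "lam > 0"
      by (rule singular_decomposition[OF linear_D[OF x0] subspace_hyperplane sv]) blast
    have cH: "card BH = p"
      using mult[OF xs] B(5) unfolding singular_multiplicity_at_def singular_multiplicity_def T sp by simp
    have "dim ?T = DIM('a) - 1" by (rule dim_hyperplane[OF x0])
    then have cV: "card BV + p + 1 = DIM('a)" using B(6) cH DIM_positive[where 'a='a] by linarith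
    \<comment> \<open>To pass from tangent \<open>w\<close> to all \<open>w\<close>, drop the radial
      part: it lies in the kernel of \<open>D\<close> and is orthogonal to \<open>h\<close>.\<close>
    have "D h x \<bullet> D w x = lam\<^sup>2 * (h \<bullet> w)" if h: "h \<in> BH" for h w
    proof -
      let ?u = "w - (x \<bullet> w) *\<^sub>R x"
      have "?u \<in> ?T" using xx by (simp add: inner_diff_right)
      from B(4)[OF h this] have "D h x \<bullet> D ?u x = lam\<^sup>2 * (h \<bullet> ?u)" .
      moreover have "D ?u x = D w x"
        using linear_diff[OF linear_D[OF x0], of w] linear_cmul[OF linear_D[OF x0], of _ x] D_radial[OF x0] by simp
      moreover have "h \<in> ?T" using orthonormal_basis_subset[OF B(1)] h by blast
      then have "h \<bullet> ?u = h \<bullet> w" by (simp add: inner_diff_right inner_commute[of h x])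
      ultimately show ?thesis by simp
    qed
    then have "singular_frame ?F lam p x BV BH"
      unfolding singular_frame_def using B(1-3) cH cV x by simp
    then show ?thesis using B(7) by blast
  qed
  \<comment> \<open>Positivity of lam is obtained at a point of the sphere, so one must
    exist.\<close>
  have "\<exists>x::'a. norm x = 1" using norm_Basis[OF SOME_Basis] by blast
  then have "lam > 0" using fr by blast
  then show ?thesis by unfold_locales (use fr in blast)
qed

text \<open>Substituting z = c x presents the submanifold in the form treated by
  \<open>minimal_traces\<close>.\<close>

lemma LOM_graph_over:
  assumes "0 < c"
  shows "{(c *\<^sub>R x, s *\<^sub>R f x) | x. x \<in> sphere 0 1} = graph_over (sphere 0 c) (\<lambda>z. s *\<^sub>R f (z /\<^sub>R norm z))"
proof (intro set_eqI iffI)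
  fix q assume "q \<in> {(c *\<^sub>R x, s *\<^sub>R f x) | x. x \<in> sphere 0 1}"
  then obtain x where x: "q = (c *\<^sub>R x, s *\<^sub>R f x)" "norm x = 1" by auto
  then show "q \<in> graph_over (sphere 0 c) (\<lambda>z. s *\<^sub>R f (z /\<^sub>R norm z))"
    unfolding graph_over_def using assms by (intro image_eqI[of _ _ "c *\<^sub>R x"]) auto
next
  fix q assume "q \<in> graph_over (sphere 0 c) (\<lambda>z. s *\<^sub>R f (z /\<^sub>R norm z))"
  then obtain z where z: "q = (z, s *\<^sub>R f (z /\<^sub>R norm z))" "norm z = c" by (auto simp: graph_over_def)
  then have "q = (c *\<^sub>R (z /\<^sub>R c), s *\<^sub>R f (z /\<^sub>R c))" "z /\<^sub>R c \<in> sphere 0 1" using assms by auto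
  then show "q \<in> {(c *\<^sub>R x, s *\<^sub>R f x) | x. x \<in> sphere 0 1}" by blast
qed

text \<open>Polar coordinates: r and x are recovered as \<open>norm y\<close> and
  \<open>y /\<^sub>R norm y\<close>, since r is positive on \<open>U\<close>.\<close>

lemma LO_graph_eq_graph_over:
  assumes "U \<subseteq> {0<..}"
  shows "LO_graph f \<rho> U = graph_over {y. norm y \<in> U} (\<lambda>y. \<rho> (norm y) *\<^sub>R f (y /\<^sub>R norm y))"
proof (intro set_eqI iffI)
  fix q assume "q \<in> LO_graph f \<rho> U"
  then obtain x r where x: "q = (r *\<^sub>R x, \<rho> r *\<^sub>R f x)" "norm x = 1" "r \<in> U" by (auto simp: LO_graph_def)
  then have "r > 0" using assms by auto
  then show "q \<in> graph_over {y. norm y \<in> U} (\<lambda>y. \<rho> (norm y) *\<^sub>R f (y /\<^sub>R norm y))"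
    unfolding graph_over_def using x by (intro image_eqI[of _ _ "r *\<^sub>R x"]) auto
next
  fix q assume "q \<in> graph_over {y. norm y \<in> U} (\<lambda>y. \<rho> (norm y) *\<^sub>R f (y /\<^sub>R norm y))"
  then obtain y where y: "q = (y, \<rho> (norm y) *\<^sub>R f (y /\<^sub>R norm y))" "norm y \<in> U" by (auto simp: graph_over_def)
  then have "y \<noteq> 0" using assms by auto
  then have "q = (norm y *\<^sub>R (y /\<^sub>R norm y), \<rho> (norm y) *\<^sub>R f (y /\<^sub>R norm y))" "y /\<^sub>R norm y \<in> sphere 0 1"
    using y by auto
  then show "q \<in> LO_graph f \<rho> U" unfolding LO_graph_def using y(2) by blast
qed

theorem theorem3p2:
  fixes f :: "'a::euclidean_space \<Rightarrow> 'b::euclidean_space"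
    and \<rho> :: "real \<Rightarrow> real" and U :: "real set"
    and n m p :: nat and lam :: real
  assumes "DIM('a) = n + 1" and "DIM('b) = m + 1"
    and "LOMSE f"
    and "\<And>x. x \<in> sphere 0 1 \<Longrightarrow> nonzero_singular_values_at f x = {lam}"
    and "\<And>x. x \<in> sphere 0 1 \<Longrightarrow> singular_multiplicity_at f x lam = p"
    and "open U" and "U \<subseteq> {0<..}" and "smooth_on U \<rho>"
  shows "minimal_submanifold UNIV (LO_graph f \<rho> U) \<longleftrightarrow>
    (\<forall>r\<in>U. deriv (deriv \<rho>) r / (1 + (deriv \<rho> r)\<^sup>2)
          + (real n - real p) * deriv \<rho> r / r
          + real p * (deriv \<rho> r / r - lam\<^sup>2 * \<rho> r / r\<^sup>2) / (1 + lam\<^sup>2 * (\<rho> r)\<^sup>2 / r\<^sup>2) = 0)"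
proof -
  let ?F = "\<lambda>y. f (y /\<^sub>R norm y)"
  let ?S = "{y :: 'a. norm y \<in> U}" and ?G = "\<lambda>y. \<rho> (norm y) *\<^sub>R f (y /\<^sub>R norm y)"
  let ?ode = "\<lambda>r. deriv (deriv \<rho>) r / (1 + (deriv \<rho> r)\<^sup>2)
          + (real n - real p) * deriv \<rho> r / r
          + real p * (deriv \<rho> r / r - lam\<^sup>2 * \<rho> r / r\<^sup>2) / (1 + lam\<^sup>2 * (\<rho> r)\<^sup>2 / r\<^sup>2) = 0"
  have LOM: "LOM f" using assms(3) by (simp add: LOMSE_def)
  then have f: "smooth_sphere_map f" by (simp add: LOM_def)
  interpret equal_singular_values ?F lam p
    by (rule equal_singular_values_normalize[OF f assms(4,5)])
  obtain \<theta> where \<theta>: "\<theta> \<in> {0<..<pi/2}"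
      "minimal_submanifold (sphere 0 1) {(cos \<theta> *\<^sub>R x, sin \<theta> *\<^sub>R f x) | x. x \<in> sphere 0 1}"
    using LOM unfolding LOM_def by blast
  have cs: "cos \<theta> > 0" "sin \<theta> > 0" "(cos \<theta>)\<^sup>2 + (sin \<theta>)\<^sup>2 = 1"
    using \<theta>(1) by (auto intro: cos_gt_zero sin_gt_zero2)
  note min = \<theta>(2)[unfolded LOM_graph_over[OF cs(1)]]
  have H: "mean_curvature UNIV (graph_over ?S ?G) (y, ?G y) = 0 \<longleftrightarrow> ?ode (norm y)" if y: "norm y \<in> U" for y
  proof -
    have y0: "y \<noteq> 0" using y assms(7) by auto
    obtain BV BH where fr: "singular_frame ?F lam p y BV BH" using frame_exists[OF y0] by blast
    show ?thesis
      by (rule rotational_mean_curvature_zero_iff[OF assms(6-8) y fr minimal_traces[OF cs min y0 fr] assms(1)])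
  qed
  have emb: "embedded_submanifold DIM('a) (graph_over ?S ?G)"
    by (rule smooth_graph.embedded_submanifold_graph[OF rotational_graph[OF assms(6-8)]])
  \<comment> \<open>Every radius occurs as a norm, so the equation at all points of the cone is the
    equation at all r in \<open>U\<close>.\<close>
  have norms: "\<exists>y::'a. norm y = r" if "r \<in> U" for r
    using norm_Basis[OF SOME_Basis, where ?'a='a] that assms(7) by (intro exI[of _ "r *\<^sub>R (SOME b. b \<in> Basis)"]) auto
  \<comment> \<open>Embeddedness holds for every smooth \<rho>, so only the vanishing of the mean
    curvature is at stake.\<close>
  have "minimal_submanifold UNIV (graph_over ?S ?G) \<longleftrightarrow>
      (\<forall>y\<in>?S. mean_curvature UNIV (graph_over ?S ?G) (y, ?G y) = 0)"
    unfolding minimal_submanifold_def using emb by (auto simp: graph_over_def)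
  also have "\<dots> \<longleftrightarrow> (\<forall>y\<in>?S. ?ode (norm y))" using H by simp
  also have "\<dots> \<longleftrightarrow> (\<forall>r\<in>U. ?ode r)"
  proof
    assume *: "\<forall>y\<in>?S. ?ode (norm y)"
    show "\<forall>r\<in>U. ?ode r"
    proof
      fix r assume r: "r \<in> U"
      then obtain y :: 'a where y: "norm y = r" using norms by blast
      then have "y \<in> ?S" using r by simp
      from bspec[OF * this] show "?ode r" unfolding y .
    qed
  qed simp
  finally show ?thesis unfolding LO_graph_eq_graph_over[OF assms(7)] .
qed

end
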